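(* The contractad $\mathsf{Ham}$ of directed Hamiltonian paths, equipped with its quadratic presentation $\mathsf{Ham}=\mathsf{BiPlan}/\langle R\rangle$ (generators $E=\mathsf{k}\{\nu,\nu^{(12)}\}$ in the component $\mathsf{P}_2$, relations $R$ described in the context), is Koszul; that is, the augmentation map $\mathsf{Ham}^{\text{!`}}\circ\mathsf{Ham}\to\mathbb{1}$ from the Koszul complex to the trivial module is a quasi-isomorphism.
   Context: Graphs: all graphs are finite, simple, undirected; $V_\Gamma$ is the vertex set of $\Gamma$, $\Gamma|_S$ the induced subgraph on $S\subseteq V_\Gamma$. A tube of $\Gamma$ is a nonempty $G\subseteq V_\Gamma$ with $\Gamma|_G$ connected. For a tube $G$, $\Gamma/G$ is obtained by contracting $G$ to one vertex $\{G\}$ (vertices outside $G$ keep their adjacencies; $v\notin G$ is adjacent to $\{G\}$ iff $v$ is adjacent to some vertex of $G$). A partition $I\vdash\Gamma$ is a partition of $V_\Gamma$ into tubes; $\Gamma/I$ has vertex set $I$, two blocks adjacent iff their union is a tube. $\mathsf{P}_n$ is the path graph on $\{1,\dots,n\}$ with edges $\{i,i+1\}$. Contractads: over a field $\mathsf{k}$, working with chain complexes and Koszul sign rules. A graphical collection $\mathcal{O}$ assigns to each nonempty connected graph $\Gamma$ a (dg) vector space $\mathcal{O}(\Gamma)$, functorially (contravariantly) in graph isomorphisms. The contraction product is $(\mathcal{P}\circ\mathcal{Q})(\Gamma)=\bigoplus_{I\vdash\Gamma}\mathcal{P}(\Gamma/I)\otimes\bigotimes_{G\in I}\mathcal{Q}(\Gamma|_G)$,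 with unit $\mathbb{1}$ ($\mathbb{1}(\mathsf{P}_1)=\mathsf{k}$, zero otherwise). A contractad is a monoid for $\circ$; equivalently it has a unit $\mathrm{Id}\in\mathcal{P}(\mathsf{P}_1)$ and equivariant, unital, associative infinitesimal compositions $\circ^\Gamma_G:\mathcal{P}(\Gamma/G)\otimes\mathcal{P}(\Gamma|_G)\to\mathcal{P}(\Gamma)$ for every tube $G$. The infinitesimal product is $(\mathcal{A}\circ'\mathcal{B})(\Gamma)=\bigoplus_{G\text{ tube}}\mathcal{A}(\Gamma/G)\otimes\mathcal{B}(\Gamma|_G)$. A right $\mathcal{P}$-module is a graphical collection $\mathcal{M}$ with an associative unital action $\mathcal{M}\circ\mathcal{P}\to\mathcal{M}$; $\mathcal{V}\circ\mathcal{P}$ is the free right module on $\mathcal{V}$. $\mathsf{Ham}$: for connected $\Gamma$ on $n$ vertices, $\mathsf{Ham}(\Gamma)$ is the vector space (in degree $0$) with basis the directed Hamiltonian paths $(v_1,\dots,v_n)$ (each vertex once, $v_i$ adjacent to $v_{i+1}$). For a tube $G$, a path $(v_1,\dots,v_{k-1},\{G\},v_{k+1},\dots,v_n)$ of $\Gamma/G$ and a path $(w_1,\dots,w_m)$ of $\Gamma|_G$, the composition $\circ^\Gamma_G$ gives $(v_1,\dots,v_{k-1},w_1,\dots,w_m,v_{k+1},\dots,v_n)$ if $v_{k-1}$ is adjacent to $w_1$ (or $k=1$) and $w_m$ is adjacent to $v_{k+1}$ (or $k$ is last), and $0$ otherwise. This makes $\mathsf{Ham}$ a contractad, augmented by the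 projection $\mathsf{Ham}\to\mathbb{1}$. Presentation: a $\Gamma$-admissible planar binary tree is a planar rooted tree, each internal vertex having two children, with leaves labelled bijectively by $V_\Gamma$, such that for every vertex the set of leaf labels below it is a tube. $\mathsf{BiPlan}(\Gamma)$ is the vector space with basis these trees; composition grafts a $\Gamma|_G$-admissible tree at the leaf $\{G\}$ of a $\Gamma/G$-admissible tree. $\mathsf{BiPlan}$ is the free contractad $\mathbb{T}(E)$ on $E=\mathsf{k}\{\nu,\nu^{(12)}\}$, $\nu$ the tree with leaves $1,2$ (left to right), $\nu^{(12)}$ the tree with leaves $2,1$. For a connected $3$-vertex graph and an ordering $(v_1,v_2,v_3)$ of its vertices, $((v_1v_2)v_3)$ is the planar tree whose root has left child a vertex with leaves $v_1,v_2$ and right child the leaf $v_3$, and $(v_1(v_2v_3))$ the tree whose root has left child leaf $v_1$ and right child a vertex with leaves $v_2,v_3$. $R\subseteq E\circ'E$ is spanned by: $((v_1v_2)v_3)-(v_1(v_2v_3))$ if $v_1v_2,v_2v_3$ are edges; $((v_1v_2)v_3)$ if $v_1v_2$ is an edge and $v_2v_3$ is not; $(v_1(v_2v_3))$ if $v_2v_3$ is an edge and $v_1v_2$ is not. The map $\nu\mapsto(1,2)$ identifies $\mathsf{BiPlan}/\langle R\rangle\cong\mathsf{Ham}$. Koszul complex: let $sE$ be $E$ shifted to degree $1$, and $\mathbb{T}^c(sE)$ the cofree conilpotent cocontractad on $sE$ (decorated admissible trees, decomposition by cutting trees). The Koszul dual cocontractad $\mathcal{P}^{\text{!`}}$ of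 $\mathcal{P}=\mathbb{T}(E)/\langle R\rangle$ is the largest sub-cocontractad of $\mathbb{T}^c(sE)$ whose composite with the projection onto $(sE\circ' sE)/s^2R$ vanishes. The Koszul complex is the free right $\mathcal{P}$-module $\mathcal{P}^{\text{!`}}\circ\mathcal{P}$ with differential $\partial_\kappa$, the right-module map induced by $\mathcal{P}^{\text{!`}}\to\mathcal{P}^{\text{!`}}\circ' sE\xrightarrow{s^{-1}}\mathcal{P}^{\text{!`}}\circ' E\hookrightarrow\mathcal{P}^{\text{!`}}\circ\mathcal{P}$ (the first map is the infinitesimal decomposition). Its augmentation to $\mathbb{1}$ is induced by the counit of $\mathcal{P}^{\text{!`}}$ and augmentation of $\mathcal{P}$. $\mathcal{P}$ is Koszul if this augmentation is a quasi-isomorphism (componentwise homology isomorphism). *)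

theory Defs
  imports "Graph_Theory.Graph_Theory" "HOL-Library.Function_Algebras"
    "HOL-Library.FuncSet" "HOL-Library.Disjoint_Sets"
begin

section \<open>Graphs, tubes, contractions\<close>

text \<open>
  A finite simple undirected graph is a \<open>pair_graph\<close>: a finite symmetric loop-free digraph without
  parallel arcs. The library's \<open>connected\<close> excludes the empty graph.
\<close>

type_synonym 'v graph = "'v pair_pre_digraph"

definition connected_graph :: "'v graph \<Rightarrow> bool" where
  "connected_graph \<Gamma> \<longleftrightarrow> pair_graph \<Gamma> \<and> connected (with_proj \<Gamma>)"

definition induced :: "'v graph \<Rightarrow> 'v set \<Rightarrow> 'v graph" where
  "induced \<Gamma> S = \<lparr> pverts = pverts \<Gamma> \<inter> S, parcs = parcs \<Gamma> \<inter> S \<times> S \<rparr>"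

definition tube :: "'v graph \<Rightarrow> 'v set \<Rightarrow> bool" where
  "tube \<Gamma> G \<longleftrightarrow> G \<noteq> {} \<and> G \<subseteq> pverts \<Gamma> \<and> connected (with_proj (induced \<Gamma> G))"

definition tube_partition :: "'v graph \<Rightarrow> 'v set set \<Rightarrow> bool" where
  "tube_partition \<Gamma> I \<longleftrightarrow> partition_on (pverts \<Gamma>) I \<and> (\<forall>G\<in>I. tube \<Gamma> G)"

text \<open>
  To keep every graph obtained by contractions over one and the same vertex type, the vertex
  \<open>{G}\<close> arising from a tube \<open>G\<close> is named by the representative \<open>Min G\<close>, both in \<open>\<Gamma>/G\<close> and in
  \<open>\<Gamma>/I\<close>. Since \<open>Min G \<in> G\<close>, it cannot clash with a vertex outside \<open>G\<close>; and iterated contractions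
  agree on the nose, e.g. merging two adjacent blocks \<open>A\<close>, \<open>B\<close> of \<open>I\<close> gives
  \<open>(\<Gamma>/I)/{Min A, Min B} = \<Gamma>/(I - {A, B} \<union> {A \<union> B})\<close>.
\<close>

definition contract :: "'v::linorder graph \<Rightarrow> 'v set \<Rightarrow> 'v graph" where
  "contract \<Gamma> G =
    (let W = pverts \<Gamma> - G; N = {v \<in> W. \<exists>g\<in>G. (v, g) \<in> parcs \<Gamma>} in
     \<lparr> pverts = insert (Min G) W,
       parcs = parcs \<Gamma> \<inter> W \<times> W \<union> N \<times> {Min G} \<union> {Min G} \<times> N \<rparr>)"

definition graph_quotient :: "'v::linorder graph \<Rightarrow> 'v set set \<Rightarrow> 'v graph" where
  "graph_quotient \<Gamma> I =
    \<lparr> pverts = Min ` I,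
      parcs = {(Min A, Min B) | A B. A \<in> I \<and> B \<in> I \<and> A \<noteq> B \<and> tube \<Gamma> (A \<union> B)} \<rparr>"

definition graph_iso :: "('v \<Rightarrow> 'v) \<Rightarrow> 'v graph \<Rightarrow> 'v graph \<Rightarrow> bool" where
  "graph_iso f \<Gamma> \<Gamma>' \<longleftrightarrow> bij_betw f (pverts \<Gamma>) (pverts \<Gamma>') \<and>
     (\<forall>u\<in>pverts \<Gamma>. \<forall>v\<in>pverts \<Gamma>. (u, v) \<in> parcs \<Gamma> \<longleftrightarrow> (f u, f v) \<in> parcs \<Gamma>')"


section \<open>Vector spaces with a distinguished basis\<close>

text \<open>
  The \<open>k\<close>-vector space with finite basis \<open>B\<close> is realised as the functions vanishing outside \<open>B\<close>;
  a value of such a function is the coefficient at that basis element.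
\<close>

definition fscale :: "'k::field \<Rightarrow> ('b \<Rightarrow> 'k) \<Rightarrow> 'b \<Rightarrow> 'k" where
  "fscale a f = (\<lambda>b. a * f b)"

interpretation fun_vs: vector_space "fscale :: 'k::field \<Rightarrow> ('b \<Rightarrow> 'k) \<Rightarrow> 'b \<Rightarrow> 'k"
  by unfold_locales (auto simp: fscale_def fun_eq_iff algebra_simps)

definition free_space :: "'b set \<Rightarrow> ('b \<Rightarrow> 'k::field) set" where
  "free_space B = {f. \<forall>b. b \<notin> B \<longrightarrow> f b = 0}"

definition basis_vector :: "'b \<Rightarrow> 'b \<Rightarrow> 'k::field" where
  "basis_vector b = (\<lambda>c. if c = b then 1 else 0)"

definition tensor_space :: "('b \<Rightarrow> 'k::field) set \<Rightarrow> ('c \<Rightarrow> 'k) set \<Rightarrow> ('b \<times> 'c \<Rightarrow> 'k) set" where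
  "tensor_space C D = fun_vs.span {(\<lambda>(b, c). f b * g c) | f g. f \<in> C \<and> g \<in> D}"


section \<open>Chain complexes and quasi-isomorphisms\<close>

definition chain_complex ::
  "(nat \<Rightarrow> ('b \<Rightarrow> 'k::field) set) \<Rightarrow> (('b \<Rightarrow> 'k) \<Rightarrow> 'b \<Rightarrow> 'k) \<Rightarrow> bool" where
  "chain_complex C d \<longleftrightarrow>
     Vector_Spaces.linear fscale fscale d \<and>
     (\<forall>n. fun_vs.subspace (C n)) \<and>
     (\<forall>x\<in>C 0. d x = 0) \<and>
     (\<forall>n. \<forall>x\<in>C (Suc n). d x \<in> C n \<and> d (d x) = 0)"

definition cycles ::
  "(nat \<Rightarrow> ('b \<Rightarrow> 'k::field) set) \<Rightarrow> (('b \<Rightarrow> 'k) \<Rightarrow> 'b \<Rightarrow> 'k) \<Rightarrow> nat \<Rightarrow> ('b \<Rightarrow> 'k) set" where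
  "cycles C d n = {x \<in> C n. d x = 0}"

definition homologous ::
  "(nat \<Rightarrow> ('b \<Rightarrow> 'k::field) set) \<Rightarrow> (('b \<Rightarrow> 'k) \<Rightarrow> 'b \<Rightarrow> 'k) \<Rightarrow> nat \<Rightarrow> ('b \<Rightarrow> 'k) rel" where
  "homologous C d n =
     {(x, y). x \<in> cycles C d n \<and> y \<in> cycles C d n \<and> x - y \<in> d ` C (Suc n)}"

definition homology ::
  "(nat \<Rightarrow> ('b \<Rightarrow> 'k::field) set) \<Rightarrow> (('b \<Rightarrow> 'k) \<Rightarrow> 'b \<Rightarrow> 'k) \<Rightarrow> nat \<Rightarrow> ('b \<Rightarrow> 'k) set set" where
  "homology C d n = cycles C d n // homologous C d n"

definition quasi_isomorphism ::
  "(nat \<Rightarrow> ('b \<Rightarrow> 'k::field) set) \<Rightarrow> (('b \<Rightarrow> 'k) \<Rightarrow> 'b \<Rightarrow> 'k) \<Rightarrow>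
   (nat \<Rightarrow> ('c \<Rightarrow> 'k) set) \<Rightarrow> (('c \<Rightarrow> 'k) \<Rightarrow> 'c \<Rightarrow> 'k) \<Rightarrow>
   (('b \<Rightarrow> 'k) \<Rightarrow> 'c \<Rightarrow> 'k) \<Rightarrow> bool" where
  "quasi_isomorphism C d D e f \<longleftrightarrow>
     chain_complex C d \<and> chain_complex D e \<and>
     Vector_Spaces.linear fscale fscale f \<and>
     (\<forall>n. \<forall>x\<in>C n. f x \<in> D n \<and> f (d x) = e (f x)) \<and>
     (\<forall>n. bij_betw (\<lambda>X. homologous D e n `` (f ` X)) (homology C d n) (homology D e n))"


section \<open>Graphical collections\<close>

text \<open>
  A graphical collection is represented by its family of components, each a subspace of a space of
  functions on some basis type. In the contraction product the basis of the ambient space consists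
  of triples \<open>(I, b, c)\<close> with \<open>I\<close> a partition, \<open>b\<close> a basis element for \<open>\<Gamma>/I\<close>, and \<open>c\<close> a family of
  basis elements indexed by the blocks of \<open>I\<close> (extended by \<open>undefined\<close> outside \<open>I\<close>).
\<close>

definition pure_tensor ::
  "'v set set \<Rightarrow> ('b \<Rightarrow> 'k::field) \<Rightarrow> ('v set \<Rightarrow> 'c \<Rightarrow> 'k) \<Rightarrow>
   'v set set \<times> 'b \<times> ('v set \<Rightarrow> 'c) \<Rightarrow> 'k" where
  "pure_tensor I f g =
     (\<lambda>(J, b, c). if J = I \<and> c \<in> extensional I then f b * (\<Prod>G\<in>I. g G (c G)) else 0)"

definition contraction_product ::
  "('v::linorder graph \<Rightarrow> ('b \<Rightarrow> 'k::field) set) \<Rightarrow> ('v graph \<Rightarrow> ('c \<Rightarrow> 'k) set) \<Rightarrow>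
   'v graph \<Rightarrow> ('v set set \<times> 'b \<times> ('v set \<Rightarrow> 'c) \<Rightarrow> 'k) set" where
  "contraction_product P Q \<Gamma> =
     fun_vs.span {pure_tensor I f g | I f g.
       tube_partition \<Gamma> I \<and> f \<in> P (graph_quotient \<Gamma> I) \<and> (\<forall>G\<in>I. g G \<in> Q (induced \<Gamma> G))}"

definition unit_collection :: "'v graph \<Rightarrow> (unit \<Rightarrow> 'k::field) set" where
  "unit_collection \<Gamma> = free_space {u. card (pverts \<Gamma>) = 1}"


section \<open>The contractad of Hamiltonian paths\<close>

definition ham_paths :: "'v graph \<Rightarrow> 'v list set" where
  "ham_paths \<Gamma> =
     {p. distinct p \<and> set p = pverts \<Gamma> \<and> successively (\<lambda>u v. (u, v) \<in> parcs \<Gamma>) p}"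

definition Ham :: "'v graph \<Rightarrow> ('v list \<Rightarrow> 'k::field) set" where
  "Ham \<Gamma> = free_space (ham_paths \<Gamma>)"

text \<open>Composition along \<open>G\<close> of basis elements of \<open>Ham (\<Gamma>/G)\<close> and \<open>Ham (\<Gamma>|G)\<close>; \<open>None\<close> stands for \<open>0\<close>.\<close>

definition ham_comp :: "'v::linorder graph \<Rightarrow> 'v set \<Rightarrow> 'v list \<Rightarrow> 'v list \<Rightarrow> 'v list option" where
  "ham_comp \<Gamma> G v w =
    (let l = takeWhile (\<lambda>x. x \<noteq> Min G) v; r = tl (dropWhile (\<lambda>x. x \<noteq> Min G) v) in
     if (l = [] \<or> (last l, hd w) \<in> parcs \<Gamma>) \<and> (r = [] \<or> (last w, hd r) \<in> parcs \<Gamma>)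
     then Some (l @ w @ r) else None)"

definition ham_augmentation :: "'v list \<Rightarrow> 'k::field" where
  "ham_augmentation p = (if length p = 1 then 1 else 0)"


section \<open>Planar binary trees and the cofree cocontractad\<close>

datatype 'v bintree = Leaf 'v | Node "'v bintree" "'v bintree"

fun leaves :: "'v bintree \<Rightarrow> 'v list" where
  "leaves (Leaf v) = [v]"
| "leaves (Node l r) = leaves l @ leaves r"

fun subtrees :: "'v bintree \<Rightarrow> 'v bintree set" where
  "subtrees (Leaf v) = {Leaf v}"
| "subtrees (Node l r) = insert (Node l r) (subtrees l \<union> subtrees r)"

fun inner :: "'v bintree \<Rightarrow> nat" where
  "inner (Leaf v) = 0"
| "inner (Node l r) = Suc (inner l + inner r)"

fun graft :: "'v bintree \<Rightarrow> 'v \<Rightarrow> 'v bintree \<Rightarrow> 'v bintree" where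
  "graft (Leaf v) a S = (if v = a then S else Leaf v)"
| "graft (Node l r) a S = Node (graft l a S) (graft r a S)"

text \<open>The number of internal vertices coming after the leaf \<open>a\<close> in preorder (root, left, right).\<close>

fun inner_after :: "'v \<Rightarrow> 'v bintree \<Rightarrow> nat" where
  "inner_after a (Leaf v) = 0"
| "inner_after a (Node l r) =
     (if a \<in> set (leaves l) then inner_after a l + inner r else inner_after a r)"

definition admissible :: "'v graph \<Rightarrow> 'v bintree \<Rightarrow> bool" where
  "admissible \<Gamma> T \<longleftrightarrow> distinct (leaves T) \<and> set (leaves T) = pverts \<Gamma> \<and>
     (\<forall>S\<in>subtrees T. tube \<Gamma> (set (leaves S)))"

definition BiPlan :: "'v graph \<Rightarrow> ('v bintree \<Rightarrow> 'k::field) set" where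
  "BiPlan \<Gamma> = free_space {T. admissible \<Gamma> T}"

text \<open>
  The cofree conilpotent cocontractad \<open>T\<^sup>c(sE)\<close> has the same underlying spaces as \<open>BiPlan\<close>, with
  all internal vertices of degree 1. A tree \<open>T\<close> stands for the tensor product of the degree 1
  decorations of its internal vertices taken in preorder, and its degree is \<open>inner T\<close>. Planar
  structures are permuted freely by relabellings, so graph isomorphisms act without signs.

  The component of the infinitesimal decomposition at \<open>G\<close> sends a tree \<open>T = T' \<circ>\<^sub>G S\<close> to \<open>T' \<otimes> S\<close>,
  and trees that cannot be cut in this way to \<open>0\<close>. The Koszul sign comes from moving the \<open>inner S\<close>
  vertices of \<open>S\<close>, which are contiguous in the preorder of \<open>T\<close>, past the vertices of \<open>T'\<close> after them.
\<close>

definition infinitesimal_decomposition ::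
  "'v::linorder graph \<Rightarrow> 'v set \<Rightarrow> ('v bintree \<Rightarrow> 'k::field) \<Rightarrow>
   'v bintree \<times> 'v bintree \<Rightarrow> 'k" where
  "infinitesimal_decomposition \<Gamma> G c =
    (\<lambda>(T', S). if admissible (contract \<Gamma> G) T' \<and> admissible (induced \<Gamma> G) S
      then (-1) ^ (inner S * inner_after (Min G) T') * c (graft T' (Min G) S) else 0)"

definition counit :: "'v bintree \<Rightarrow> 'k::field" where
  "counit T = (case T of Leaf _ \<Rightarrow> 1 | Node _ _ \<Rightarrow> 0)"

definition pullback ::
  "('v \<Rightarrow> 'v) \<Rightarrow> 'v graph \<Rightarrow> ('v bintree \<Rightarrow> 'k::field) \<Rightarrow> 'v bintree \<Rightarrow> 'k" where
  "pullback f \<Gamma> c = (\<lambda>T. if admissible \<Gamma> T then c (map_bintree f T) else 0)"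

definition sub_cocontractad ::
  "('v::linorder graph \<Rightarrow> ('v bintree \<Rightarrow> 'k::field) set) \<Rightarrow> bool" where
  "sub_cocontractad C \<longleftrightarrow>
     (\<forall>\<Gamma>. connected_graph \<Gamma> \<longrightarrow> fun_vs.subspace (C \<Gamma>) \<and> C \<Gamma> \<subseteq> BiPlan \<Gamma>) \<and>
     (\<forall>\<Gamma> \<Gamma>' f. connected_graph \<Gamma> \<longrightarrow> connected_graph \<Gamma>' \<longrightarrow> graph_iso f \<Gamma> \<Gamma>' \<longrightarrow>
        (\<forall>c\<in>C \<Gamma>'. pullback f \<Gamma> c \<in> C \<Gamma>)) \<and>
     (\<forall>\<Gamma> G. connected_graph \<Gamma> \<longrightarrow> tube \<Gamma> G \<longrightarrow>
        (\<forall>c\<in>C \<Gamma>. infinitesimal_decomposition \<Gamma> G c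
           \<in> tensor_space (C (contract \<Gamma> G)) (C (induced \<Gamma> G))))"


section \<open>The Koszul dual cocontractad\<close>

definition relators :: "'v graph \<Rightarrow> ('v bintree \<Rightarrow> 'k::field) set" where
  "relators \<Gamma> =
    {r. \<exists>v1 v2 v3. distinct [v1, v2, v3] \<and> pverts \<Gamma> = {v1, v2, v3} \<and>
      ((v1, v2) \<in> parcs \<Gamma> \<and> (v2, v3) \<in> parcs \<Gamma> \<and>
         r = basis_vector (Node (Node (Leaf v1) (Leaf v2)) (Leaf v3))
           - basis_vector (Node (Leaf v1) (Node (Leaf v2) (Leaf v3))) \<or>
       (v1, v2) \<in> parcs \<Gamma> \<and> (v2, v3) \<notin> parcs \<Gamma> \<and>
         r = basis_vector (Node (Node (Leaf v1) (Leaf v2)) (Leaf v3)) \<or>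
       (v1, v2) \<notin> parcs \<Gamma> \<and> (v2, v3) \<in> parcs \<Gamma> \<and>
         r = basis_vector (Node (Leaf v1) (Node (Leaf v2) (Leaf v3))))}"

text \<open>
  In a tree with two internal vertices the root always precedes the other one in preorder, so the
  identification of \<open>E \<circ>' E\<close> with \<open>sE \<circ>' sE\<close> matches basis trees without relative
  signs, and \<open>s\<^sup>2R\<close> has the same coordinates as \<open>R\<close>.
\<close>

definition relations :: "'v graph \<Rightarrow> ('v bintree \<Rightarrow> 'k::field) set" where
  "relations \<Gamma> = fun_vs.span (relators \<Gamma>)"

definition weight_part :: "nat \<Rightarrow> ('v bintree \<Rightarrow> 'k::field) \<Rightarrow> 'v bintree \<Rightarrow> 'k" where
  "weight_part n c = (\<lambda>T. if inner T = n then c T else 0)"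

definition projection_vanishes :: "('v graph \<Rightarrow> ('v bintree \<Rightarrow> 'k::field) set) \<Rightarrow> bool" where
  "projection_vanishes C \<longleftrightarrow>
     (\<forall>\<Gamma>. connected_graph \<Gamma> \<longrightarrow> (\<forall>c\<in>C \<Gamma>. weight_part 2 c \<in> relations \<Gamma>))"

text \<open>
  The largest sub-cocontractad whose projection to \<open>(sE \<circ>' sE)/s\<^sup>2R\<close> vanishes is the sum of all of
  them.
\<close>

definition Ham_dual :: "'v::linorder graph \<Rightarrow> ('v bintree \<Rightarrow> 'k::field) set" where
  "Ham_dual \<Gamma> = fun_vs.span (\<Union>{C \<Gamma> | C. sub_cocontractad C \<and> projection_vanishes C})"

lemma Ham_dual_upper:
  assumes "sub_cocontractad C" "projection_vanishes C"
  shows "C \<Gamma> \<subseteq> Ham_dual \<Gamma>"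
  unfolding Ham_dual_def using assms by (blast intro: fun_vs.span_base)

lemma tensor_space_mono:
  assumes "C \<subseteq> C'" "D \<subseteq> D'"
  shows "tensor_space C D \<subseteq> tensor_space C' D'"
  unfolding tensor_space_def by (rule fun_vs.span_mono) (use assms in blast)

lemma Ham_dual_projection_vanishes:
  "projection_vanishes (Ham_dual :: 'v::linorder graph \<Rightarrow> ('v bintree \<Rightarrow> 'k::field) set)"
  unfolding projection_vanishes_def
proof (intro allI impI ballI)
  fix \<Gamma> :: "'v graph" and c :: "'v bintree \<Rightarrow> 'k"
  assume \<Gamma>: "connected_graph \<Gamma>" and "c \<in> Ham_dual \<Gamma>"
  from this(2) show "weight_part 2 c \<in> relations \<Gamma>"
    unfolding Ham_dual_def
  proof (induction rule: fun_vs.span_induct_alt)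
    case base
    have "weight_part 2 0 = (0 :: 'v bintree \<Rightarrow> 'k)" by (auto simp: weight_part_def fun_eq_iff)
    then show ?case by (simp only: relations_def fun_vs.span_zero)
  next
    case (step a x y)
    have "weight_part 2 (fscale a x + y) = fscale a (weight_part 2 x) + weight_part 2 y"
      by (auto simp: weight_part_def fscale_def fun_eq_iff)
    moreover have "weight_part 2 x \<in> relations \<Gamma>"
      using step.hyps(1) \<Gamma> by (auto simp: projection_vanishes_def)
    ultimately show ?case using step.IH
      by (simp only: relations_def fun_vs.span_add fun_vs.span_scale)
  qed
qed

lemma Ham_dual_sub_cocontractad:
  "sub_cocontractad (Ham_dual :: 'v::linorder graph \<Rightarrow> ('v bintree \<Rightarrow> 'k::field) set)"
  unfolding sub_cocontractad_def
proof (intro conjI allI impI ballI)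
  fix \<Gamma> :: "'v graph"
  assume \<Gamma>: "connected_graph \<Gamma>"
  show "fun_vs.subspace (Ham_dual \<Gamma> :: ('v bintree \<Rightarrow> 'k) set)"
    unfolding Ham_dual_def by (rule fun_vs.subspace_span)
  have "fun_vs.subspace (BiPlan \<Gamma> :: ('v bintree \<Rightarrow> 'k) set)"
    by (auto simp: fun_vs.subspace_def BiPlan_def free_space_def fscale_def)
  then show "Ham_dual \<Gamma> \<subseteq> (BiPlan \<Gamma> :: ('v bintree \<Rightarrow> 'k) set)"
    unfolding Ham_dual_def
    by (rule fun_vs.span_minimal[rotated]) (use \<Gamma> in \<open>auto simp: sub_cocontractad_def\<close>)
next
  fix \<Gamma> \<Gamma>' :: "'v graph" and f and c :: "'v bintree \<Rightarrow> 'k"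
  assume *: "connected_graph \<Gamma>" "connected_graph \<Gamma>'" "graph_iso f \<Gamma> \<Gamma>'" and "c \<in> Ham_dual \<Gamma>'"
  from this(4) show "pullback f \<Gamma> c \<in> Ham_dual \<Gamma>"
    unfolding Ham_dual_def[of \<Gamma>']
  proof (induction rule: fun_vs.span_induct_alt)
    case base
    have "pullback f \<Gamma> 0 = (0 :: 'v bintree \<Rightarrow> 'k)" by (auto simp: pullback_def fun_eq_iff)
    then show ?case by (simp only: Ham_dual_def fun_vs.span_zero)
  next
    case (step a x y)
    have "pullback f \<Gamma> (fscale a x + y) = fscale a (pullback f \<Gamma> x) + pullback f \<Gamma> y"
      by (auto simp: pullback_def fscale_def fun_eq_iff)
    moreover obtain C where C: "sub_cocontractad C" "projection_vanishes C" "x \<in> C \<Gamma>'"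
      using step.hyps(1) by blast
    have "pullback f \<Gamma> x \<in> C \<Gamma>" using C(1,3) * by (simp add: sub_cocontractad_def)
    then have "pullback f \<Gamma> x \<in> Ham_dual \<Gamma>" using Ham_dual_upper[OF C(1,2)] by blast
    ultimately show ?case using step.IH
      by (simp only: Ham_dual_def fun_vs.span_add fun_vs.span_scale)
  qed
next
  fix \<Gamma> :: "'v graph" and G and c :: "'v bintree \<Rightarrow> 'k"
  assume *: "connected_graph \<Gamma>" "tube \<Gamma> G" and "c \<in> Ham_dual \<Gamma>"
  let ?D = "infinitesimal_decomposition \<Gamma> G :: _ \<Rightarrow> _ \<Rightarrow> 'k"
  let ?W = "tensor_space (Ham_dual (contract \<Gamma> G)) (Ham_dual (induced \<Gamma> G)) :: (_ \<Rightarrow> 'k) set"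
  from \<open>c \<in> Ham_dual \<Gamma>\<close> show "?D c \<in> ?W"
    unfolding Ham_dual_def[of \<Gamma>]
  proof (induction rule: fun_vs.span_induct_alt)
    case base
    have "?D 0 = 0" by (auto simp: infinitesimal_decomposition_def fun_eq_iff)
    then show ?case by (simp only: tensor_space_def fun_vs.span_zero)
  next
    case (step a x y)
    have "?D (fscale a x + y) = fscale a (?D x) + ?D y"
      by (auto simp: infinitesimal_decomposition_def fscale_def fun_eq_iff algebra_simps)
    moreover obtain C where C: "sub_cocontractad C" "projection_vanishes C" "x \<in> C \<Gamma>"
      using step.hyps(1) by blast
    have "?D x \<in> tensor_space (C (contract \<Gamma> G)) (C (induced \<Gamma> G))"
      using C(1,3) * by (simp add: sub_cocontractad_def)
    then have "?D x \<in> ?W"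
      using tensor_space_mono[OF Ham_dual_upper[OF C(1,2)] Ham_dual_upper[OF C(1,2)]] by blast
    ultimately show ?case using step.IH
      by (simp only: tensor_space_def fun_vs.span_add fun_vs.span_scale)
  qed
qed


section \<open>The Koszul complex\<close>

text \<open>Since \<open>Ham\<close> sits in degree 0, the degree of a basis element is that of its tree.\<close>

definition koszul_complex ::
  "'v::linorder graph \<Rightarrow> nat \<Rightarrow>
   ('v set set \<times> 'v bintree \<times> ('v set \<Rightarrow> 'v list) \<Rightarrow> 'k::field) set" where
  "koszul_complex \<Gamma> n =
     {x \<in> contraction_product Ham_dual Ham \<Gamma>. \<forall>I T p. x (I, T, p) \<noteq> 0 \<longrightarrow> inner T = n}"

definition path_families :: "'v graph \<Rightarrow> 'v set set \<Rightarrow> ('v set \<Rightarrow> 'v list) set" where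
  "path_families \<Gamma> I = (\<Pi>\<^sub>E G\<in>I. ham_paths (induced \<Gamma> G))"

text \<open>
  For disjoint tubes \<open>A\<close>, \<open>B\<close> of \<open>\<Gamma>\<close> whose union is a tube: the composite in \<open>Ham (\<Gamma>|(A \<union> B))\<close> of
  the generator \<open>(Min A, Min B)\<close>, i.e. the image of the tree with leaves \<open>Min A\<close>, \<open>Min B\<close>, with the
  paths \<open>v\<close> of \<open>\<Gamma>|A\<close> and \<open>w\<close> of \<open>\<Gamma>|B\<close>.
\<close>

definition generator_comp ::
  "'v::linorder graph \<Rightarrow> 'v set \<Rightarrow> 'v set \<Rightarrow> 'v list \<Rightarrow> 'v list \<Rightarrow> 'v list option" where
  "generator_comp \<Gamma> A B v w =
    (let \<Delta> = induced \<Gamma> (A \<union> B) in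
     Option.bind (ham_comp (contract \<Delta> A) B [Min A, Min B] w) (\<lambda>u. ham_comp \<Delta> A u v))"

text \<open>
  The component of \<open>x\<close> at a partition \<open>I\<close> and a family \<open>p\<close> of paths is decomposed at every
  two-vertex tube \<open>{Min A, Min B}\<close> of \<open>\<Gamma>/I\<close>, in either planar order of the generator. The generator
  split off is desuspended, where \<open>id \<otimes> s\<^sup>-\<^sup>1\<close> contributes the Koszul sign \<open>(-1)\<close> to the degree of the
  remaining tree, and is composed with \<open>p A\<close> and \<open>p B\<close>; the other blocks are unaffected.
\<close>

definition koszul_differential ::
  "'v::linorder graph \<Rightarrow>
   ('v set set \<times> 'v bintree \<times> ('v set \<Rightarrow> 'v list) \<Rightarrow> 'k::field) \<Rightarrow>
   'v set set \<times> 'v bintree \<times> ('v set \<Rightarrow> 'v list) \<Rightarrow> 'k" where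
  "koszul_differential \<Gamma> x = (\<lambda>(J, T', q).
     \<Sum>I | tube_partition \<Gamma> I. \<Sum>p\<in>path_families \<Gamma> I.
       \<Sum>(A, B) | A \<in> I \<and> B \<in> I \<and> A \<noteq> B \<and> tube \<Gamma> (A \<union> B).
         case generator_comp \<Gamma> A B (p A) (p B) of None \<Rightarrow> 0
         | Some w \<Rightarrow>
             if J = insert (A \<union> B) (I - {A, B}) \<and> q = restrict (p(A \<union> B := w)) J
             then (-1) ^ inner T' *
               infinitesimal_decomposition (graph_quotient \<Gamma> I) {Min A, Min B}
                 (\<lambda>T. x (I, T, p)) (T', Node (Leaf (Min A)) (Leaf (Min B)))
             else 0)"

text \<open>
  The augmentation to the trivial module: counit of the dual tensored with the augmentations of the
  path factors. It vanishes on every component except \<open>I = {{v}}\<close> for a one-vertex graph.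
\<close>

definition koszul_augmentation ::
  "'v::linorder graph \<Rightarrow>
   ('v set set \<times> 'v bintree \<times> ('v set \<Rightarrow> 'v list) \<Rightarrow> 'k::field) \<Rightarrow> unit \<Rightarrow> 'k" where
  "koszul_augmentation \<Gamma> x = (\<lambda>_.
     \<Sum>I | tube_partition \<Gamma> I. \<Sum>p\<in>path_families \<Gamma> I.
       \<Sum>T | admissible (graph_quotient \<Gamma> I) T.
         x (I, T, p) * (counit T * (\<Prod>G\<in>I. ham_augmentation (p G))))"

definition unit_complex :: "'v graph \<Rightarrow> nat \<Rightarrow> (unit \<Rightarrow> 'k::field) set" where
  "unit_complex \<Gamma> n = (if n = 0 then unit_collection \<Gamma> else {0})"

end

theory Submission
  imports Defs
begin

text \<open>
  Up to the signs of the associative case, the relations say that the coefficient of a tree in the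
  Koszul dual is unchanged by rotations that stay admissible. Any two admissible trees with the same
  order of leaves are connected by such rotations, so an element of the dual is just a function of
  those orders of the vertices that carry an admissible tree.

  Concatenating the paths of the blocks along the leaves gives an order \<open>w\<close> of all vertices which
  the differential preserves. The summand of \<open>w\<close> has a basis of sets \<open>F\<close> of edges between
  consecutive vertices of \<open>w\<close> (those inside the blocks), and the differential adds edges to \<open>F\<close>.
  Contracting an edge between consecutive leaves preserves the existence of an admissible tree, so
  all \<open>F\<close> occur as soon as the empty one does: the summand is the augmented cochain complex of a
  full simplex, which is contractible unless \<open>w\<close> has a single vertex.
\<close>

section \<open>Tubes and edges\<close>

text \<open>Two obstacles shape the argument. The relations speak of three vertices only, while the
  Koszul dual is known only through closure under cutting. Equality of signed coefficients on a
  larger graph is therefore carried from \<open>\<Gamma>/G\<close> and \<open>\<Gamma>|G\<close> to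
  \<Gamma>, by an induction on the number of vertices that ranges over all connected graphs at once.
  In the Koszul complex, coordinate functions live on all lists of paths, but an element determines
  their values only at lists that carry an admissible tree, so a cycle condition is known only
  there. The homotopy must read coordinates at no other lists. For this reason it joins blocks only
  along edges of \<Gamma>, and the vertex of the simplex that it uses depends on \<open>w\<close>:
  it is the first edge between consecutive entries. With at least two vertices there is one, since
  an admissible tree then has a cherry, whose leaves are consecutive and adjacent.\<close>

lemma pair_graph_iff:
  "pair_graph \<Gamma> \<longleftrightarrow> finite (pverts \<Gamma>) \<and> parcs \<Gamma> \<subseteq> pverts \<Gamma> \<times> pverts \<Gamma> \<and> sym (parcs \<Gamma>) \<and>
     (\<forall>v. (v, v) \<notin> parcs \<Gamma>)"
proof
  assume "pair_graph \<Gamma>"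
  then interpret pair_graph \<Gamma> .
  show "finite (pverts \<Gamma>) \<and> parcs \<Gamma> \<subseteq> pverts \<Gamma> \<times> pverts \<Gamma> \<and> sym (parcs \<Gamma>) \<and> (\<forall>v. (v, v) \<notin> parcs \<Gamma>)"
    using pair_finite_verts arc_fst_in_verts arc_snd_in_verts pair_sym_arcs pair_no_loops
    by (fastforce simp: symmetric_def)
next
  assume *: "finite (pverts \<Gamma>) \<and> parcs \<Gamma> \<subseteq> pverts \<Gamma> \<times> pverts \<Gamma> \<and> sym (parcs \<Gamma>) \<and> (\<forall>v. (v, v) \<notin> parcs \<Gamma>)"
  then have "finite (parcs \<Gamma>)" by (meson finite_SigmaI finite_subset)
  with * show "pair_graph \<Gamma>"
    by unfold_locales (auto simp: symmetric_def)
qed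

lemma
  assumes "pair_graph \<Gamma>"
  shows pair_graph_finite: "finite (pverts \<Gamma>)"
    and arc_in_verts: "(u, v) \<in> parcs \<Gamma> \<Longrightarrow> u \<in> pverts \<Gamma> \<and> v \<in> pverts \<Gamma>"
    and arc_sym: "(u, v) \<in> parcs \<Gamma> \<Longrightarrow> (v, u) \<in> parcs \<Gamma>"
    and arc_irrefl: "(v, v) \<notin> parcs \<Gamma>"
  using assms by (auto simp: pair_graph_iff dest: symD)

lemma pair_graph_induced: "pair_graph \<Gamma> \<Longrightarrow> pair_graph (induced \<Gamma> S)"
  by (auto simp: pair_graph_iff induced_def sym_def)

text \<open>In cut form, statements about unions and images of tubes need only a well-chosen subset
  instead of walks.\<close>

lemma connected_iff_cut:
  assumes "pair_graph \<Gamma>"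
  shows "connected (with_proj \<Gamma>) \<longleftrightarrow> pverts \<Gamma> \<noteq> {} \<and>
     (\<forall>X\<subseteq>pverts \<Gamma>. X \<noteq> {} \<longrightarrow> X \<noteq> pverts \<Gamma> \<longrightarrow> (\<exists>x\<in>X. \<exists>y\<in>pverts \<Gamma> - X. (x, y) \<in> parcs \<Gamma>))"
proof -
  \<comment> \<open>The library defines \<open>connected\<close> by reachability in the symmetric
    closure, which here is the arc set itself.\<close>
  have sc: "symcl (parcs \<Gamma>) = parcs \<Gamma>"
    using arc_sym[OF assms] by (auto simp: symcl_def)
  let ?R = "rtrancl_on (pverts \<Gamma>) (parcs \<Gamma>)"
  have "(\<forall>u\<in>pverts \<Gamma>. \<forall>v\<in>pverts \<Gamma>. (u, v) \<in> ?R) \<longleftrightarrow>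
    (\<forall>X\<subseteq>pverts \<Gamma>. X \<noteq> {} \<longrightarrow> X \<noteq> pverts \<Gamma> \<longrightarrow> (\<exists>x\<in>X. \<exists>y\<in>pverts \<Gamma> - X. (x, y) \<in> parcs \<Gamma>))"
    (is "?A \<longleftrightarrow> ?B")
  proof
    assume ?A
    show ?B
    proof (intro allI impI)
      fix X assume X: "X \<subseteq> pverts \<Gamma>" "X \<noteq> {}" "X \<noteq> pverts \<Gamma>"
      then obtain u v where uv: "u \<in> X" "v \<in> pverts \<Gamma> - X" by blast
      have "(u, v) \<in> ?R" using \<open>?A\<close> uv X by blast
      then have "v \<notin> X \<longrightarrow> (\<exists>x\<in>X. \<exists>y\<in>pverts \<Gamma> - X. (x, y) \<in> parcs \<Gamma>)"
        using uv(1) by (induction rule: rtrancl_on_induct) auto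
      then show "\<exists>x\<in>X. \<exists>y\<in>pverts \<Gamma> - X. (x, y) \<in> parcs \<Gamma>" using uv by blast
    qed
  next
    assume B: ?B
    show ?A
    proof (intro ballI)
      fix u v assume uv: "u \<in> pverts \<Gamma>" "v \<in> pverts \<Gamma>"
      \<comment> \<open>The set reachable from \<open>u\<close> has no outgoing edge, so by the cut
        condition it is everything.\<close>
      let ?X = "{y \<in> pverts \<Gamma>. (u, y) \<in> ?R}"
      have "\<not> (\<exists>x\<in>?X. \<exists>y\<in>pverts \<Gamma> - ?X. (x, y) \<in> parcs \<Gamma>)"
        by (auto intro: rtrancl_on_into_rtrancl_on)
      moreover have "u \<in> ?X" using uv by auto
      ultimately have "?X = pverts \<Gamma>" using B[rule_format, of ?X] by blast
      then show "(u, v) \<in> ?R" using uv by blast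
    qed
  qed
  then show ?thesis unfolding connected_conv by (simp add: sc)
qed

lemma tube_iff_cut:
  assumes "pair_graph \<Gamma>"
  shows "tube \<Gamma> G \<longleftrightarrow> G \<noteq> {} \<and> G \<subseteq> pverts \<Gamma> \<and>
     (\<forall>X\<subseteq>G. X \<noteq> {} \<longrightarrow> X \<noteq> G \<longrightarrow> (\<exists>x\<in>X. \<exists>y\<in>G - X. (x, y) \<in> parcs \<Gamma>))"
proof (cases "G \<subseteq> pverts \<Gamma>")
  case True
  then have [simp]: "pverts (induced \<Gamma> G) = G" by (auto simp: induced_def)
  have "(\<forall>X\<subseteq>G. X \<noteq> {} \<longrightarrow> X \<noteq> G \<longrightarrow> (\<exists>x\<in>X. \<exists>y\<in>G - X. (x, y) \<in> parcs (induced \<Gamma> G))) \<longleftrightarrow>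
    (\<forall>X\<subseteq>G. X \<noteq> {} \<longrightarrow> X \<noteq> G \<longrightarrow> (\<exists>x\<in>X. \<exists>y\<in>G - X. (x, y) \<in> parcs \<Gamma>))"
    by (intro all_cong1 imp_cong refl bex_cong) (auto simp: induced_def)
  then show ?thesis unfolding tube_def connected_iff_cut[OF pair_graph_induced[OF assms]]
    using True by simp
qed (auto simp: tube_def)

lemma connected_graph_iff_tube:
  "connected_graph \<Gamma> \<longleftrightarrow> pair_graph \<Gamma> \<and> tube \<Gamma> (pverts \<Gamma>)"
  by (auto simp: connected_graph_def connected_iff_cut tube_iff_cut)

lemma connected_graphD:
  assumes "connected_graph \<Gamma>"
  shows "pair_graph \<Gamma>" "pverts \<Gamma> \<noteq> {}" "finite (pverts \<Gamma>)"
  using assms by (auto simp: connected_graph_iff_tube tube_def pair_graph_finite)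

lemma tube_singleton: "pair_graph \<Gamma> \<Longrightarrow> tube \<Gamma> {v} \<longleftrightarrow> v \<in> pverts \<Gamma>"
  by (auto simp: tube_iff_cut)

lemma tube_finite: "pair_graph \<Gamma> \<Longrightarrow> tube \<Gamma> G \<Longrightarrow> finite G"
  by (meson finite_subset pair_graph_finite tube_def)

text \<open>A proper subset of the union cuts \<open>A\<close>, or cuts \<open>B\<close>, or
  contains one of them and misses the other; in the last case the given edge crosses it.\<close>

lemma tube_union:
  assumes "pair_graph \<Gamma>" "tube \<Gamma> A" "tube \<Gamma> B" "(a, b) \<in> parcs \<Gamma>" "a \<in> A" "b \<in> B"
  shows "tube \<Gamma> (A \<union> B)"
proof -
  have A: "A \<noteq> {}" "A \<subseteq> pverts \<Gamma>" "\<And>X. X\<subseteq>A \<Longrightarrow> X \<noteq> {} \<Longrightarrow> X \<noteq> A \<Longrightarrow> (\<exists>x\<in>X. \<exists>y\<in>A - X. (x, y) \<in> parcs \<Gamma>)"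
    using assms(2) unfolding tube_iff_cut[OF assms(1)] by auto
  have B: "B \<noteq> {}" "B \<subseteq> pverts \<Gamma>" "\<And>X. X\<subseteq>B \<Longrightarrow> X \<noteq> {} \<Longrightarrow> X \<noteq> B \<Longrightarrow> (\<exists>x\<in>X. \<exists>y\<in>B - X. (x, y) \<in> parcs \<Gamma>)"
    using assms(3) unfolding tube_iff_cut[OF assms(1)] by auto
  show ?thesis unfolding tube_iff_cut[OF assms(1)]
  proof (intro conjI allI impI)
    fix X assume X: "X \<subseteq> A \<union> B" "X \<noteq> {}" "X \<noteq> A \<union> B"
    show "\<exists>x\<in>X. \<exists>y\<in>A \<union> B - X. (x, y) \<in> parcs \<Gamma>"
    proof (cases "X \<inter> A = {} \<or> X \<inter> A = A")
      case False
      then show ?thesis using A(3)[of "X \<inter> A"] by blast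
    next
      case TA: True
      show ?thesis
      proof (cases "X \<inter> B = {} \<or> X \<inter> B = B")
        case False
        then show ?thesis using B(3)[of "X \<inter> B"] by blast
      next
        case True
        then consider "X \<inter> A = A" "X \<inter> B = {}" | "X \<inter> A = {}" "X \<inter> B = B"
          using TA X by blast
        then show ?thesis
        proof cases
          case 1
          then have "a \<in> X" "b \<in> A \<union> B - X" using assms by auto
          then show ?thesis using assms(4) by blast
        next
          case 2
          then have "b \<in> X" "a \<in> A \<union> B - X" using assms by auto
          then show ?thesis using arc_sym[OF assms(1,4)] by blast
        qed
      qed
    qed
  qed (use A B in auto)
qed

text \<open>For the forward direction the cut is \<open>A\<close> itself, a proper subset of the
  union by disjointness.\<close>

lemma tube_union_iff:
  assumes "pair_graph \<Gamma>" "tube \<Gamma> A" "tube \<Gamma> B" "A \<inter> B = {}"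
  shows "tube \<Gamma> (A \<union> B) \<longleftrightarrow> (\<exists>a\<in>A. \<exists>b\<in>B. (a, b) \<in> parcs \<Gamma>)"
proof
  have ne: "A \<noteq> {}" "B \<noteq> {}" using assms by (auto simp: tube_def)
  assume "tube \<Gamma> (A \<union> B)"
  then have "\<exists>x\<in>A. \<exists>y\<in>(A \<union> B) - A. (x, y) \<in> parcs \<Gamma>"
    using ne assms(4) by (elim tube_iff_cut[OF assms(1), THEN iffD1, THEN conjunct2, THEN conjunct2, rule_format]) auto
  then show "\<exists>a\<in>A. \<exists>b\<in>B. (a, b) \<in> parcs \<Gamma>" by blast
qed (use tube_union[OF assms(1-3)] in blast)

text \<open>An edge that leaves the preimage of a cut cannot be collapsed by \<open>f\<close>, so
  its image leaves the cut. Collapsed edges are allowed because the maps in question are the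
  projections from \<Gamma> to \<open>\<Gamma>/G\<close> and \<open>\<Gamma>/I\<close>.\<close>

lemma tube_image:
  assumes "pair_graph \<Gamma>" "pair_graph \<Delta>" "tube \<Gamma> G" "f ` G \<subseteq> pverts \<Delta>"
    "\<And>u v. u \<in> G \<Longrightarrow> v \<in> G \<Longrightarrow> (u, v) \<in> parcs \<Gamma> \<Longrightarrow> f u = f v \<or> (f u, f v) \<in> parcs \<Delta>"
  shows "tube \<Delta> (f ` G)"
  unfolding tube_iff_cut[OF assms(2)]
proof (intro conjI allI impI)
  show "f ` G \<noteq> {}" using assms(3) by (auto simp: tube_def)
  fix X assume X: "X \<subseteq> f ` G" "X \<noteq> {}" "X \<noteq> f ` G"
  let ?Y = "{v \<in> G. f v \<in> X}"
  have "?Y \<subseteq> G" "?Y \<noteq> {}" "?Y \<noteq> G" using X by auto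
  then obtain x y where "x \<in> ?Y" "y \<in> G - ?Y" "(x, y) \<in> parcs \<Gamma>"
    using assms(3) unfolding tube_iff_cut[OF assms(1)] by meson
  then show "\<exists>x\<in>X. \<exists>y\<in>f ` G - X. (x, y) \<in> parcs \<Delta>" using assms(5)[of x y] by auto
qed (rule assms(4))

lemma connected_graph_image:
  assumes "connected_graph \<Gamma>" "pair_graph \<Delta>" "f ` pverts \<Gamma> = pverts \<Delta>"
    "\<And>u v. (u, v) \<in> parcs \<Gamma> \<Longrightarrow> f u = f v \<or> (f u, f v) \<in> parcs \<Delta>"
  shows "connected_graph \<Delta>"
  using tube_image[of \<Gamma> \<Delta> "pverts \<Gamma>" f] assms by (auto simp: connected_graph_iff_tube)

lemma connected_graph_induced:
  assumes "pair_graph \<Gamma>" "tube \<Gamma> G"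
  shows "connected_graph (induced \<Gamma> G)"
  using assms by (simp add: connected_graph_def pair_graph_induced tube_def)

section \<open>Induced graphs and the contraction of a tube\<close>

lemma induced_simps:
  "G \<subseteq> pverts \<Gamma> \<Longrightarrow> pverts (induced \<Gamma> G) = G"
  "(u, v) \<in> parcs (induced \<Gamma> G) \<longleftrightarrow> (u, v) \<in> parcs \<Gamma> \<and> u \<in> G \<and> v \<in> G"
  by (auto simp: induced_def)

lemma pverts_contract: "pverts (contract \<Gamma> G) = insert (Min G) (pverts \<Gamma> - G)"
  by (simp add: contract_def Let_def)

lemma parcs_contract:
  assumes "pair_graph \<Gamma>" "finite G" "G \<noteq> {}"
  shows "(u, v) \<in> parcs (contract \<Gamma> G) \<longleftrightarrow>
    u \<notin> G \<and> v \<notin> G \<and> (u, v) \<in> parcs \<Gamma> \<or>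
    u \<notin> G \<and> v = Min G \<and> (\<exists>g\<in>G. (u, g) \<in> parcs \<Gamma>) \<or>
    u = Min G \<and> v \<notin> G \<and> (\<exists>g\<in>G. (g, v) \<in> parcs \<Gamma>)"
proof -
  have "Min G \<in> G" using assms by simp
  moreover have "(v, g) \<in> parcs \<Gamma> \<longleftrightarrow> (g, v) \<in> parcs \<Gamma>" for g
    using arc_sym[OF assms(1)] by blast
  ultimately show ?thesis
    by (auto simp: contract_def Let_def dest: arc_in_verts[OF assms(1)])
qed

lemma pair_graph_contract:
  assumes "pair_graph \<Gamma>" "finite G" "G \<noteq> {}"
  shows "pair_graph (contract \<Gamma> G)"
proof -
  have "Min G \<in> G" using assms by simp
  then show ?thesis using assms(1) unfolding pair_graph_iff
    by (auto simp: contract_def Let_def sym_def)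
qed

lemma connected_graph_contract:
  assumes "connected_graph \<Gamma>" "tube \<Gamma> G"
  shows "connected_graph (contract \<Gamma> G)"
proof -
  have pg: "pair_graph \<Gamma>" using assms(1) by (rule connected_graphD)
  have G: "finite G" "G \<noteq> {}" "G \<subseteq> pverts \<Gamma>" using assms pg tube_finite by (auto simp: tube_def)
  show ?thesis
    by (rule connected_graph_image[where f = "\<lambda>v. if v \<in> G then Min G else v", OF assms(1)])
      (use G in \<open>auto simp: pverts_contract parcs_contract[OF pg] pair_graph_contract[OF pg]\<close>)
qed

section \<open>Partitions into tubes and their quotient graphs\<close>

lemma tube_partitionD:
  assumes "tube_partition \<Gamma> I"
  shows "\<Union> I = pverts \<Gamma>" "disjoint I" "\<And>G. G \<in> I \<Longrightarrow> tube \<Gamma> G"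
    "\<And>G. G \<in> I \<Longrightarrow> G \<noteq> {}" "\<And>G. G \<in> I \<Longrightarrow> G \<subseteq> pverts \<Gamma>"
  using assms by (auto simp: tube_partition_def partition_on_def tube_def)

lemma tube_partition_disjoint:
  "tube_partition \<Gamma> I \<Longrightarrow> A \<in> I \<Longrightarrow> B \<in> I \<Longrightarrow> A \<noteq> B \<Longrightarrow> A \<inter> B = {}"
  by (drule tube_partitionD(2)) (auto simp: disjoint_def)

lemma tube_partition_Min:
  assumes "pair_graph \<Gamma>" "tube_partition \<Gamma> I"
  shows "G \<in> I \<Longrightarrow> Min G \<in> G" "inj_on Min I"
proof -
  have *: "Min G \<in> G" if "G \<in> I" for G
    using that tube_partitionD(3,4)[OF assms(2)] tube_finite[OF assms(1)] by auto
  then show "G \<in> I \<Longrightarrow> Min G \<in> G" .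
  show "inj_on Min I"
    using * tube_partition_disjoint[OF assms(2)] by (fastforce intro!: inj_onI)
qed

lemma finite_tube_partitions:
  assumes "pair_graph \<Gamma>"
  shows "finite {I. tube_partition \<Gamma> I}" "tube_partition \<Gamma> I \<Longrightarrow> finite I"
proof -
  have f: "finite (Pow (pverts \<Gamma>))" using pair_graph_finite[OF assms] by simp
  have sub: "tube_partition \<Gamma> I \<Longrightarrow> I \<subseteq> Pow (pverts \<Gamma>)" for I using tube_partitionD(1)[of \<Gamma> I] by auto
  show "tube_partition \<Gamma> I \<Longrightarrow> finite I" using finite_subset[OF sub f] .
  have "{I. tube_partition \<Gamma> I} \<subseteq> Pow (Pow (pverts \<Gamma>))" using sub by blast
  then show "finite {I. tube_partition \<Gamma> I}" using f finite_subset by blast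
qed

lemma pverts_graph_quotient: "pverts (graph_quotient \<Gamma> I) = Min ` I"
  by (simp add: graph_quotient_def)

lemma parcs_graph_quotient:
  assumes "pair_graph \<Gamma>" "tube_partition \<Gamma> I" "A \<in> I" "B \<in> I"
  shows "(Min A, Min B) \<in> parcs (graph_quotient \<Gamma> I) \<longleftrightarrow>
    A \<noteq> B \<and> (\<exists>a\<in>A. \<exists>b\<in>B. (a, b) \<in> parcs \<Gamma>)"
proof -
  have "(Min A, Min B) \<in> parcs (graph_quotient \<Gamma> I) \<longleftrightarrow> A \<noteq> B \<and> tube \<Gamma> (A \<union> B)"
    using inj_onD[OF tube_partition_Min(2)[OF assms(1,2)]] assms(3,4)
    by (auto simp: graph_quotient_def)
  then show ?thesis
    using tube_union_iff[OF assms(1)] tube_partitionD(3)[OF assms(2)] tube_partition_disjoint[OF assms(2-4)]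
      assms(3,4) by blast
qed

lemma parcs_graph_quotientE:
  assumes "pair_graph \<Gamma>" "tube_partition \<Gamma> I" "(u, v) \<in> parcs (graph_quotient \<Gamma> I)"
  obtains A B where "A \<in> I" "B \<in> I" "u = Min A" "v = Min B" "A \<noteq> B" "\<exists>a\<in>A. \<exists>b\<in>B. (a, b) \<in> parcs \<Gamma>"
proof -
  obtain A B where *: "A \<in> I" "B \<in> I" "u = Min A" "v = Min B" "A \<noteq> B"
    using assms(3) by (auto simp: graph_quotient_def)
  show thesis using that[OF *] parcs_graph_quotient[OF assms(1,2) *(1,2)] assms(3) *(3,4) by blast
qed

lemma pair_graph_graph_quotient:
  assumes "pair_graph \<Gamma>" "tube_partition \<Gamma> I"
  shows "pair_graph (graph_quotient \<Gamma> I)"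
  unfolding pair_graph_iff
proof (intro conjI allI)
  show "finite (pverts (graph_quotient \<Gamma> I))"
    using finite_tube_partitions(2)[OF assms] by (simp add: pverts_graph_quotient)
  show "parcs (graph_quotient \<Gamma> I) \<subseteq> pverts (graph_quotient \<Gamma> I) \<times> pverts (graph_quotient \<Gamma> I)"
    by (auto simp: graph_quotient_def)
  show "sym (parcs (graph_quotient \<Gamma> I))"
    unfolding graph_quotient_def sym_def
    by (clarsimp, metis Un_commute)
  show "(v, v) \<notin> parcs (graph_quotient \<Gamma> I)" for v
    using tube_partition_Min(2)[OF assms] by (auto simp: graph_quotient_def dest: inj_onD)
qed

lemma connected_graph_quotient:
  assumes "connected_graph \<Gamma>" "tube_partition \<Gamma> I"
  shows "connected_graph (graph_quotient \<Gamma> I)"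
proof -
  have pg: "pair_graph \<Gamma>" using assms(1) by (rule connected_graphD)
  \<comment> \<open>The projection to the quotient, with each block named by its
    representative.\<close>
  define f where "f = (\<lambda>v. Min (THE G. G \<in> I \<and> v \<in> G))"
  have the: "(THE G. G \<in> I \<and> v \<in> G) = G" if "G \<in> I" "v \<in> G" for v G
    using that tube_partition_disjoint[OF assms(2)] by (intro the_equality) auto
  then have f: "f v = Min G" if "G \<in> I" "v \<in> G" for v G using that by (simp add: f_def)
  show ?thesis
  proof (rule connected_graph_image[where f = f, OF assms(1) pair_graph_graph_quotient[OF pg assms(2)]])
    have "\<exists>v\<in>pverts \<Gamma>. f v = Min G" if "G \<in> I" for G
      using that f tube_partitionD(1)[OF assms(2)] tube_partition_Min(1)[OF pg assms(2)] by blast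
    then show "f ` pverts \<Gamma> = pverts (graph_quotient \<Gamma> I)"
      unfolding pverts_graph_quotient using f tube_partitionD(1)[OF assms(2), symmetric]
      by (auto simp: image_iff) metis
    fix u v assume uv: "(u, v) \<in> parcs \<Gamma>"
    then obtain A B where "A \<in> I" "B \<in> I" "u \<in> A" "v \<in> B"
      using arc_in_verts[OF pg] tube_partitionD(1)[OF assms(2)] by blast
    then show "f u = f v \<or> (f u, f v) \<in> parcs (graph_quotient \<Gamma> I)"
      using f parcs_graph_quotient[OF pg assms(2)] uv by (cases "A = B") auto
  qed
qed

section \<open>Admissible trees\<close>

text \<open>By \<open>tube_union_iff\<close>, admissibility can be tested locally at the internal vertices.\<close>

fun edge_tree :: "('v \<times> 'v) set \<Rightarrow> 'v bintree \<Rightarrow> bool" where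
  "edge_tree E (Leaf v) = True"
| "edge_tree E (Node l r) \<longleftrightarrow> edge_tree E l \<and> edge_tree E r \<and>
     (\<exists>a\<in>set (leaves l). \<exists>b\<in>set (leaves r). (a, b) \<in> E)"

lemma leaves_not_Nil [simp]: "leaves T \<noteq> []"
  by (induction T) auto

lemma inner_conv_leaves: "Suc (inner T) = length (leaves T)"
  by (induction T) auto

lemma subtrees_self [simp]: "T \<in> subtrees T"
  by (cases T) auto

lemma leaves_subtree: "S \<in> subtrees T \<Longrightarrow> set (leaves S) \<subseteq> set (leaves T)"
  by (induction T) auto

lemma edge_tree_subtree: "S \<in> subtrees T \<Longrightarrow> edge_tree E T \<Longrightarrow> edge_tree E S"
proof (induction T)
  case (Node l r)
  then show ?case by (cases "S = Node l r") auto
qed simp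

lemma distinct_leaves_subtree: "S \<in> subtrees T \<Longrightarrow> distinct (leaves T) \<Longrightarrow> distinct (leaves S)"
  by (induction T) auto

lemma edge_tree_cong:
  "(\<And>a b. a \<in> set (leaves T) \<Longrightarrow> b \<in> set (leaves T) \<Longrightarrow> (a, b) \<in> E \<longleftrightarrow> (a, b) \<in> F) \<Longrightarrow>
   edge_tree E T \<longleftrightarrow> edge_tree F T"
  by (induction T) auto

lemma tube_subtrees_iff:
  assumes "pair_graph \<Gamma>" "distinct (leaves T)" "set (leaves T) \<subseteq> pverts \<Gamma>"
  shows "(\<forall>S\<in>subtrees T. tube \<Gamma> (set (leaves S))) \<longleftrightarrow> edge_tree (parcs \<Gamma>) T"
  using assms(2,3)
proof (induction T)
  case (Leaf v)
  then show ?case by (simp add: tube_singleton[OF assms(1)])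
next
  case (Node l r)
  have "tube \<Gamma> (set (leaves l) \<union> set (leaves r)) \<longleftrightarrow>
      (\<exists>a\<in>set (leaves l). \<exists>b\<in>set (leaves r). (a, b) \<in> parcs \<Gamma>)"
    if "\<forall>S\<in>subtrees l. tube \<Gamma> (set (leaves S))" "\<forall>S\<in>subtrees r. tube \<Gamma> (set (leaves S))"
    by (rule tube_union_iff[OF assms(1)]) (use that Node.prems in auto)
  with Node show ?case by auto
qed

lemma admissible_iff:
  assumes "pair_graph \<Gamma>"
  shows "admissible \<Gamma> T \<longleftrightarrow> distinct (leaves T) \<and> set (leaves T) = pverts \<Gamma> \<and> edge_tree (parcs \<Gamma>) T"
  using tube_subtrees_iff[OF assms, of T] by (auto simp: admissible_def)

lemma admissible_leaves:
  "admissible \<Gamma> T \<Longrightarrow> distinct (leaves T)" "admissible \<Gamma> T \<Longrightarrow> set (leaves T) = pverts \<Gamma>"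
  by (simp_all add: admissible_def)

lemma admissible_inner: "admissible \<Gamma> T \<Longrightarrow> Suc (inner T) = card (pverts \<Gamma>)"
  by (metis admissible_leaves distinct_card inner_conv_leaves)

subsection \<open>Grafting\<close>

lemma graft_id: "a \<notin> set (leaves T) \<Longrightarrow> graft T a S = T"
  by (induction T) auto

lemma leaves_graft: "leaves (graft T a S) = concat (map (\<lambda>x. if x = a then leaves S else [x]) (leaves T))"
  by (induction T) auto

lemma leaves_graft_append:
  assumes "leaves T = xs @ [a] @ ys" "distinct (leaves T)"
  shows "leaves (graft T a S) = xs @ leaves S @ ys"
proof -
  have "concat (map (\<lambda>x. if x = a then leaves S else [x]) zs) = zs" if "a \<notin> set zs" for zs
    using that by (induction zs) auto
  then show ?thesis using assms by (simp add: leaves_graft)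
qed

lemma set_leaves_graft:
  "set (leaves (graft T a S)) = (set (leaves T) - {a}) \<union> (if a \<in> set (leaves T) then set (leaves S) else {})"
  by (auto simp: leaves_graft)

text \<open>Here \<open>F\<close> stands for the edges of the contracted graph and \<open>m\<close>
  for the vertex that replaces \<open>G\<close>. At an internal vertex of \<open>T\<close> the side
  containing \<open>m\<close> receives all of \<open>G\<close> instead, and an \<open>F\<close>-edge
  at \<open>m\<close> is precisely an \<open>E\<close>-edge at some vertex of
  \<open>G\<close>.\<close>

lemma edge_tree_graft:
  assumes "set (leaves S) = G" "m \<in> G" "edge_tree E S" "distinct (leaves T)"
    "set (leaves T) \<inter> G \<subseteq> {m}"
    and F: "\<And>u v. u \<notin> G \<Longrightarrow> v \<notin> G \<Longrightarrow> (u, v) \<in> F \<longleftrightarrow> (u, v) \<in> E"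
      "\<And>u. u \<notin> G \<Longrightarrow> (u, m) \<in> F \<longleftrightarrow> (\<exists>g\<in>G. (u, g) \<in> E)"
      "\<And>u. u \<notin> G \<Longrightarrow> (m, u) \<in> F \<longleftrightarrow> (\<exists>g\<in>G. (g, u) \<in> E)"
  shows "edge_tree E (graft T m S) \<longleftrightarrow> edge_tree F T"
  using assms(4,5)
proof (induction T)
  case (Leaf v)
  then show ?case using assms(3) by auto
next
  case (Node l r)
  have IH: "edge_tree E (graft l m S) = edge_tree F l" "edge_tree E (graft r m S) = edge_tree F r"
    using Node by auto
  have dj: "set (leaves l) \<inter> set (leaves r) = {}" using Node.prems by auto
  have G: "g \<in> G \<Longrightarrow> g \<in> set (leaves l) \<Longrightarrow> g = m" "g \<in> G \<Longrightarrow> g \<in> set (leaves r) \<Longrightarrow> g = m" for g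
    using Node.prems by auto
  have "(\<exists>a\<in>set (leaves (graft l m S)). \<exists>b\<in>set (leaves (graft r m S)). (a, b) \<in> E) \<longleftrightarrow>
    (\<exists>a\<in>set (leaves l). \<exists>b\<in>set (leaves r). (a, b) \<in> F)" (is "?L \<longleftrightarrow> ?R")
  proof (cases "m \<in> set (leaves l)")
    case True
    then have mr: "m \<notin> set (leaves r)" using dj by auto
    then have "graft r m S = r" by (rule graft_id)
    have *: "b \<notin> G" if "b \<in> set (leaves r)" for b using that G mr by blast
    have "?L \<longleftrightarrow> (\<exists>b\<in>set (leaves r). (\<exists>g\<in>G. (g, b) \<in> E) \<or> (\<exists>a\<in>set (leaves l) - {m}. (a, b) \<in> E))"
      using True assms(1) mr by (auto simp: set_leaves_graft \<open>graft r m S = r\<close>)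
    also have "\<dots> \<longleftrightarrow> (\<exists>b\<in>set (leaves r). (m, b) \<in> F \<or> (\<exists>a\<in>set (leaves l) - {m}. (a, b) \<in> F))"
    proof (intro bex_cong refl disj_cong)
      show "((x, b) \<in> E) = ((x, b) \<in> F)" if "b \<in> set (leaves r)" "x \<in> set (leaves l) - {m}" for x b
        using that F(1)[of x b] * G(1) by blast
    qed (use * F(3) in blast)
    also have "\<dots> \<longleftrightarrow> ?R" using True by blast
    finally show ?thesis .
  next
    case ml: False
    then have "graft l m S = l" by (rule graft_id)
    have *: "b \<notin> G" if "b \<in> set (leaves l)" for b using that G ml by blast
    show ?thesis
    proof (cases "m \<in> set (leaves r)")
      case True
      have "?L \<longleftrightarrow> (\<exists>b\<in>set (leaves l). (\<exists>g\<in>G. (b, g) \<in> E) \<or> (\<exists>a\<in>set (leaves r) - {m}. (b, a) \<in> E))"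
        using True assms(1) ml by (auto simp: set_leaves_graft \<open>graft l m S = l\<close>)
      also have "\<dots> \<longleftrightarrow> (\<exists>b\<in>set (leaves l). (b, m) \<in> F \<or> (\<exists>a\<in>set (leaves r) - {m}. (b, a) \<in> F))"
      proof (intro bex_cong refl disj_cong)
        show "((b, x) \<in> E) = ((b, x) \<in> F)" if "b \<in> set (leaves l)" "x \<in> set (leaves r) - {m}" for x b
          using that F(1)[of b x] * G(2) by blast
      qed (use * F(2) in blast)
      also have "\<dots> \<longleftrightarrow> ?R" using True by blast
      finally show ?thesis .
    next
      case False
      then have "graft r m S = r" by (rule graft_id)
      then show ?thesis using \<open>graft l m S = l\<close> F(1) G False ml by metis
    qed
  qed
  with IH show ?case by simp
qed

lemma tubeD:
  fixes \<Gamma> :: "'v::linorder graph"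
  assumes "pair_graph \<Gamma>" "tube \<Gamma> G"
  shows "finite G" "G \<noteq> {}" "G \<subseteq> pverts \<Gamma>" "Min G \<in> G"
proof -
  show *: "finite G" "G \<noteq> {}" using tube_finite[OF assms] assms(2) by (auto simp: tube_def)
  show "G \<subseteq> pverts \<Gamma>" using assms(2) by (simp add: tube_def)
  show "Min G \<in> G" using * by simp
qed

text \<open>Both directions are used: one when trees of \<Gamma> are built by grafting, the other
  when a tree of \<Gamma> is cut.\<close>

lemma admissible_graft_iff:
  fixes \<Gamma> :: "'v::linorder graph"
  assumes "pair_graph \<Gamma>" "tube \<Gamma> G" "admissible (induced \<Gamma> G) S"
    "distinct (leaves T)" "set (leaves T) = pverts (contract \<Gamma> G)"
  shows "admissible \<Gamma> (graft T (Min G) S) \<longleftrightarrow> admissible (contract \<Gamma> G) T"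
proof -
  note G = tubeD[OF assms(1,2)]
  have S: "set (leaves S) = G" "distinct (leaves S)" "edge_tree (parcs \<Gamma>) S"
    using assms(3) G(3) edge_tree_cong[of S "parcs (induced \<Gamma> G)" "parcs \<Gamma>"]
    unfolding admissible_iff[OF pair_graph_induced[OF assms(1)]] by (auto simp: induced_simps)
  have lT: "set (leaves T) = insert (Min G) (pverts \<Gamma> - G)" using assms(5) by (simp add: pverts_contract)
  have "edge_tree (parcs \<Gamma>) (graft T (Min G) S) \<longleftrightarrow> edge_tree (parcs (contract \<Gamma> G)) T"
    by (rule edge_tree_graft[OF S(1) G(4) S(3) assms(4)])
      (use lT G(4) in \<open>auto simp: parcs_contract[OF assms(1) G(1,2)]\<close>)
  moreover have "distinct (leaves (graft T (Min G) S))"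
  proof -
    obtain xs ys where xy: "leaves T = xs @ [Min G] @ ys" using lT by (metis append.simps(1,2) insertI1 split_list)
    then have "leaves (graft T (Min G) S) = xs @ leaves S @ ys" using assms(4) by (rule leaves_graft_append)
    moreover have "x \<notin> G" if "x \<in> set xs \<union> set ys" for x
    proof -
      have "x \<in> insert (Min G) (pverts \<Gamma> - G)" using that lT xy by auto
      moreover have "x \<noteq> Min G" using that xy assms(4) by auto
      ultimately show ?thesis by blast
    qed
    ultimately show ?thesis using xy assms(4) S by auto
  qed
  moreover have "set (leaves (graft T (Min G) S)) = pverts \<Gamma>"
    using lT S(1) G by (auto simp: set_leaves_graft)
  ultimately show ?thesis
    using assms(4,5) by (simp add: admissible_iff[OF assms(1)]
      admissible_iff[OF pair_graph_contract[OF assms(1) G(1,2)]])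
qed

text \<open>The label \<open>a\<close> put in place of \<open>S\<close> may be one of the leaves of
  \<open>S\<close>, as the representative \<open>Min G\<close> will be.\<close>

lemma ex_graft:
  assumes "S \<in> subtrees T" "distinct (leaves T)" "a \<notin> set (leaves T) - set (leaves S)"
  shows "\<exists>T' xs ys. T = graft T' a S \<and> leaves T' = xs @ [a] @ ys \<and> leaves T = xs @ leaves S @ ys"
  using assms
proof (induction T)
  case (Leaf v)
  then show ?case by (intro exI[of _ "Leaf a"] exI[of _ "[]"]) auto
next
  case (Node l r)
  show ?case
  proof (cases "S = Node l r")
    case True
    then show ?thesis by (intro exI[of _ "Leaf a"] exI[of _ "[]"]) auto
  next
    case False
    then consider "S \<in> subtrees l" | "S \<in> subtrees r" using Node.prems by auto
    then show ?thesis
    proof cases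
      case 1
      then have "set (leaves S) \<subseteq> set (leaves l)" by (rule leaves_subtree)
      then have "a \<notin> set (leaves r)" using Node.prems by auto
      moreover obtain T' xs ys where "l = graft T' a S" "leaves T' = xs @ [a] @ ys" "leaves l = xs @ leaves S @ ys"
        using Node.IH(1)[OF 1] Node.prems by auto
      ultimately show ?thesis
        by (intro exI[of _ "Node T' r"] exI[of _ xs] exI[of _ "ys @ leaves r"]) (simp add: graft_id)
    next
      case 2
      then have "set (leaves S) \<subseteq> set (leaves r)" by (rule leaves_subtree)
      then have "a \<notin> set (leaves l)" using Node.prems by auto
      moreover obtain T' xs ys where "r = graft T' a S" "leaves T' = xs @ [a] @ ys" "leaves r = xs @ leaves S @ ys"
        using Node.IH(2)[OF 2] Node.prems by auto
      ultimately show ?thesis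
        by (intro exI[of _ "Node l T'"] exI[of _ "leaves l @ xs"] exI[of _ ys]) (simp add: graft_id)
    qed
  qed
qed

text \<open>The lists \<open>xs\<close> and \<open>ys\<close> record where the cut happens, so that
  the remainders of two trees with equal leaves, cut at subtrees with equal leaves, can be
  compared.\<close>

lemma admissible_subtree_cut:
  fixes \<Gamma> :: "'v::linorder graph"
  assumes "pair_graph \<Gamma>" "admissible \<Gamma> T" "S \<in> subtrees T"
  defines "G \<equiv> set (leaves S)"
  obtains T' xs ys where "T = graft T' (Min G) S" "leaves T' = xs @ [Min G] @ ys" "leaves T = xs @ leaves S @ ys"
    "admissible (contract \<Gamma> G) T'" "admissible (induced \<Gamma> G) S" "tube \<Gamma> G"
proof -
  have tube: "tube \<Gamma> G" using assms by (auto simp: admissible_def)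
  then have GV: "G \<subseteq> pverts \<Gamma>" by (simp add: tube_def)
  have S: "admissible (induced \<Gamma> G) S"
    using assms(2,3) GV edge_tree_cong[of S "parcs (induced \<Gamma> G)" "parcs \<Gamma>"]
      distinct_leaves_subtree[OF assms(3)] edge_tree_subtree[OF assms(3), of "parcs \<Gamma>"]
    unfolding admissible_iff[OF pair_graph_induced[OF assms(1)]] admissible_iff[OF assms(1)]
    by (auto simp: induced_simps G_def)
  have m: "Min G \<in> G" unfolding G_def by (intro Min_in) auto
  then obtain T' xs ys where T': "T = graft T' (Min G) S" "leaves T' = xs @ [Min G] @ ys" "leaves T = xs @ leaves S @ ys"
    using ex_graft[OF assms(3), of "Min G"] admissible_leaves(1)[OF assms(2)] G_def by blast
  have d: "distinct (xs @ leaves S @ ys)" using T'(3) admissible_leaves(1)[OF assms(2)] by simp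
  have "G \<inter> set xs = {}" "G \<inter> set ys = {}" using d by (auto simp: G_def)
  then have "Min G \<notin> set xs" "Min G \<notin> set ys" using m by blast+
  then have "distinct (leaves T')" using d T'(2) by auto
  moreover have "set (leaves T') = pverts (contract \<Gamma> G)"
    using d T'(2,3) admissible_leaves(2)[OF assms(2)] by (auto simp: pverts_contract G_def)
  ultimately have "admissible (contract \<Gamma> G) T'"
    using admissible_graft_iff[OF assms(1) tube S] assms(2) T'(1) by simp
  with that T' S tube show thesis by blast
qed


subsection \<open>Cherries and rotations\<close>

abbreviation cherry :: "'v \<Rightarrow> 'v \<Rightarrow> 'v bintree" where
  "cherry a b \<equiv> Node (Leaf a) (Leaf b)"

text \<open>Rotating at the vertex where \<open>a\<close> and \<open>b\<close> meet pushes this vertex down until it is a cherry;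
  the edge \<open>(a, b)\<close> keeps every intermediate tree admissible.\<close>

lemma ex_cherry_tree:
  assumes "edge_tree E T" "leaves T = xs @ [a, b] @ ys" "(a, b) \<in> E"
  shows "\<exists>T'. edge_tree E T' \<and> leaves T' = leaves T \<and> cherry a b \<in> subtrees T'"
  using assms(1,2)
proof (induction "size T" arbitrary: T xs ys rule: less_induct)
  case less
  obtain l r where T: "T = Node l r" using less.prems(2) by (cases T) auto
  have lr: "leaves l @ leaves r = xs @ [a, b] @ ys" using less.prems(2) T by simp
  consider us where "leaves l = xs @ [a, b] @ us" | us where "leaves r = us @ [a, b] @ ys"
    | "leaves l = xs @ [a]" "leaves r = b # ys"
    using lr by (auto simp: append_eq_append_conv2 append_eq_Cons_conv Cons_eq_append_conv)
  then show ?case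
  proof cases
    case 1
    have "\<exists>T'. edge_tree E T' \<and> leaves T' = leaves l \<and> cherry a b \<in> subtrees T'"
      by (rule less.hyps[OF _ _ 1]) (use less.prems T in auto)
    then obtain T' where "edge_tree E T'" "leaves T' = leaves l" "cherry a b \<in> subtrees T'" by blast
    then show ?thesis using less.prems T by (intro exI[of _ "Node T' r"]) auto
  next
    case 2
    have "\<exists>T'. edge_tree E T' \<and> leaves T' = leaves r \<and> cherry a b \<in> subtrees T'"
      by (rule less.hyps[OF _ _ 2]) (use less.prems T in auto)
    then obtain T' where "edge_tree E T'" "leaves T' = leaves r" "cherry a b \<in> subtrees T'" by blast
    then show ?thesis using less.prems T by (intro exI[of _ "Node l T'"]) auto
  next
    case 3
    show ?thesis
    proof (cases r)
      case (Node r1 r2)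
      then obtain zs where zs: "leaves r1 = b # zs" using 3 by (cases "leaves r1") auto
      \<comment> \<open>The rotation from \<open>Node l (Node r1 r2)\<close> to
        \<open>Node (Node l r1) r2\<close>: the new vertex is supported by the edge
        \<open>(a, b)\<close>, the root by the edge that joined \<open>r1\<close> to
        \<open>r2\<close>.\<close>
      have "\<exists>T'. edge_tree E T' \<and> leaves T' = leaves (Node l r1) \<and> cherry a b \<in> subtrees T'"
        by (rule less.hyps[of _ xs zs]) (use less.prems T Node 3 zs assms(3) in auto)
      then obtain T' where T': "edge_tree E T'" "leaves T' = leaves (Node l r1)" "cherry a b \<in> subtrees T'" by blast
      then show ?thesis using less.prems T Node by (intro exI[of _ "Node T' r2"]) auto
    next
      case r: (Leaf b')
      show ?thesis
      proof (cases l)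
        case (Node l1 l2)
        then obtain zs where zs: "leaves l2 = zs @ [a]" using 3 by (cases "leaves l2" rule: rev_cases) auto
        have "\<exists>T'. edge_tree E T' \<and> leaves T' = leaves (Node l2 r) \<and> cherry a b \<in> subtrees T'"
          by (rule less.hyps[of _ zs ys]) (use less.prems T Node 3 zs assms(3) in auto)
        then obtain T' where T': "edge_tree E T'" "leaves T' = leaves (Node l2 r)" "cherry a b \<in> subtrees T'" by blast
        then show ?thesis using less.prems T Node by (intro exI[of _ "Node l1 T'"]) auto
      next
        case (Leaf a')
        then show ?thesis using less.prems T r 3 by (intro exI[of _ T]) auto
      qed
    qed
  qed
qed

lemma ex_cherry: "0 < inner T \<Longrightarrow> \<exists>a b. cherry a b \<in> subtrees T"
proof (induction T)
  case (Node l r)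
  show ?case
  proof (cases "0 < inner l \<or> 0 < inner r")
    case True
    then show ?thesis using Node.IH by auto
  next
    case False
    then obtain a b where "l = Leaf a" "r = Leaf b" by (cases l; cases r) auto
    then show ?thesis by auto
  qed
qed simp

section \<open>The Koszul dual\<close>

text \<open>The sign with which a tree occurs in the Koszul dual of the associative operad.\<close>

fun tree_sign :: "'v bintree \<Rightarrow> 'k::field" where
  "tree_sign (Leaf v) = 1"
| "tree_sign (Node l r) = (-1) ^ inner l * tree_sign l * tree_sign r"

text \<open>The counterpart of \<open>inner_after\<close> that depends on the order of leaves alone.
  Both counts appear in the sign of a graft; the Koszul sign of the decomposition cancels the one
  taken in preorder, and this one survives.\<close>

definition entries_after :: "'v \<Rightarrow> 'v list \<Rightarrow> nat" where
  "entries_after a xs = length (tl (dropWhile (\<lambda>x. x \<noteq> a) xs))"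

lemma entries_after_append:
  "entries_after a (xs @ ys) = (if a \<in> set xs then entries_after a xs + length ys else entries_after a ys)"
proof (cases "a \<in> set xs")
  case True
  then have "dropWhile (\<lambda>x. x \<noteq> a) (xs @ ys) = dropWhile (\<lambda>x. x \<noteq> a) xs @ ys"
    by (induction xs) auto
  moreover have "dropWhile (\<lambda>x. x \<noteq> a) xs \<noteq> []" using True by auto
  ultimately show ?thesis using True by (simp add: entries_after_def)
next
  case False
  then have "dropWhile (\<lambda>x. x \<noteq> a) (xs @ ys) = dropWhile (\<lambda>x. x \<noteq> a) ys"
    by (induction xs) auto
  then show ?thesis using False by (simp add: entries_after_def)
qed

lemma power_neg_one_sq: "(-1::'k::field) ^ n * (-1) ^ n = 1"
  by (simp flip: power_add mult_2)

lemma power_neg_one_cancel: "(-1::'k::field) ^ n * ((-1) ^ n * x) = x"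
  by (simp add: power_neg_one_sq flip: mult.assoc)

lemma tree_sign_sq: "tree_sign T * (tree_sign T :: 'k::field) = 1"
proof (induction T)
  case (Node l r)
  have "tree_sign (Node l r) * (tree_sign (Node l r) :: 'k) =
     ((-1) ^ inner l * (-1) ^ inner l) * (tree_sign l * tree_sign l) * (tree_sign r * tree_sign r)"
    by (simp add: algebra_simps)
  then show ?case using Node by (simp add: power_neg_one_sq)
qed simp

lemma tree_sign_cancel: "tree_sign T * (tree_sign T * x) = (x :: 'k::field)"
  by (simp add: tree_sign_sq flip: mult.assoc)

lemma inner_graft:
  "distinct (leaves T) \<Longrightarrow> a \<in> set (leaves T) \<Longrightarrow> inner (graft T a S) = inner T + inner S"
proof (induction T)
  case (Node l r)
  show ?case
  proof (cases "a \<in> set (leaves l)")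
    case True
    then have "a \<notin> set (leaves r)" using Node.prems by auto
    then show ?thesis using Node True by (simp add: graft_id)
  qed (use Node in \<open>auto simp: graft_id\<close>)
qed simp

text \<open>When \<open>a\<close> lies in \<open>l\<close>, grafting enlarges \<open>inner l\<close>
  by \<open>inner S\<close>, while passing from \<open>l\<close> to the whole tree adds
  \<open>inner r\<close> to \<open>inner_after\<close> and the \<open>Suc (inner r)\<close> leaves
  of \<open>r\<close> to \<open>entries_after\<close>. The surplus of one matches the factor
  \<open>(-1) ^ inner S\<close>. When \<open>a\<close> lies in \<open>r\<close>, no count
  changes.\<close>

lemma tree_sign_graft_aux:
  "distinct (leaves T) \<Longrightarrow> a \<in> set (leaves T) \<Longrightarrow>
   tree_sign (graft T a S) * (-1) ^ (inner S * inner_after a T) =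
   (-1) ^ (inner S * entries_after a (leaves T)) * tree_sign T * (tree_sign S :: 'k::field)"
proof (induction T)
  case (Leaf v)
  then show ?case by (simp add: entries_after_def)
next
  case (Node l r)
  show ?case
  proof (cases "a \<in> set (leaves l)")
    case True
    then have "a \<notin> set (leaves r)" using Node.prems by auto
    then have "tree_sign (graft (Node l r) a S) * (-1) ^ (inner S * inner_after a (Node l r)) =
      (-1) ^ (inner l + inner S) * tree_sign r * (-1) ^ (inner S * inner r) *
      (tree_sign (graft l a S) * (-1) ^ (inner S * inner_after a l) :: 'k)"
      using True Node.prems by (simp add: graft_id inner_graft power_add algebra_simps)
    also have "tree_sign (graft l a S) * (-1) ^ (inner S * inner_after a l) =
       (-1) ^ (inner S * entries_after a (leaves l)) * tree_sign l * (tree_sign S :: 'k)"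
      using Node True by simp
    finally show ?thesis using True
      by (simp add: entries_after_append power_add algebra_simps flip: inner_conv_leaves)
  next
    case False
    then have "tree_sign (graft (Node l r) a S) * (-1) ^ (inner S * inner_after a (Node l r)) =
      (-1) ^ inner l * tree_sign l * (tree_sign (graft r a S) * (-1) ^ (inner S * inner_after a r) :: 'k)"
      by (simp add: graft_id)
    also have "tree_sign (graft r a S) * (-1) ^ (inner S * inner_after a r) =
       (-1) ^ (inner S * entries_after a (leaves r)) * tree_sign r * (tree_sign S :: 'k)"
      using Node False by simp
    finally show ?thesis using False by (simp add: entries_after_append algebra_simps)
  qed
qed

lemma tree_sign_graft:
  assumes "distinct (leaves T)" "a \<in> set (leaves T)"
  shows "tree_sign (graft T a S) = (-1) ^ (inner S * inner_after a T) *
    ((-1) ^ (inner S * entries_after a (leaves T)) * tree_sign T * (tree_sign S :: 'k::field))"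
  unfolding tree_sign_graft_aux[OF assms, symmetric]
  by (simp add: power_neg_one_cancel mult.commute[of "tree_sign _"])

section \<open>Coherent functions, the explicit form of the Koszul dual\<close>

definition coherent :: "'v graph \<Rightarrow> ('v bintree \<Rightarrow> 'k::field) set" where
  "coherent \<Gamma> = {c \<in> BiPlan \<Gamma>. \<forall>T T'. admissible \<Gamma> T \<longrightarrow> admissible \<Gamma> T' \<longrightarrow> leaves T = leaves T' \<longrightarrow>
     tree_sign T * c T = tree_sign T' * c T'}"

text \<open>Over the orders \<open>u\<close> that carry an admissible tree, these form a basis of
  \<open>coherent \<Gamma>\<close> for finite \<Gamma>; decompositions are expanded in products of
  them.\<close>

definition signed_trees :: "'v graph \<Rightarrow> 'v list \<Rightarrow> 'v bintree \<Rightarrow> 'k::field" where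
  "signed_trees \<Gamma> u = (\<lambda>T. if admissible \<Gamma> T \<and> leaves T = u then tree_sign T else 0)"

lemma signed_trees_coherent: "signed_trees \<Gamma> u \<in> coherent \<Gamma>"
  by (auto simp: coherent_def signed_trees_def BiPlan_def free_space_def tree_sign_sq)

lemma coherent_support: "c \<in> coherent \<Gamma> \<Longrightarrow> \<not> admissible \<Gamma> T \<Longrightarrow> c T = 0"
  by (auto simp: coherent_def BiPlan_def free_space_def)

lemma coherent_agree:
  "c \<in> coherent \<Gamma> \<Longrightarrow> admissible \<Gamma> T \<Longrightarrow> admissible \<Gamma> T' \<Longrightarrow> leaves T = leaves T' \<Longrightarrow>
   tree_sign T * c T = tree_sign T' * c T'"
  unfolding coherent_def by blast

lemma coherentI:
  assumes "\<And>T. \<not> admissible \<Gamma> T \<Longrightarrow> c T = 0"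
    "\<And>T T'. admissible \<Gamma> T \<Longrightarrow> admissible \<Gamma> T' \<Longrightarrow> leaves T = leaves T' \<Longrightarrow>
      tree_sign T * c T = tree_sign T' * c T'"
  shows "c \<in> coherent \<Gamma>"
  using assms unfolding coherent_def BiPlan_def free_space_def by blast

lemma subspace_coherent:
  fixes \<Gamma> :: "'v graph"
  shows "fun_vs.subspace (coherent \<Gamma> :: ('v bintree \<Rightarrow> 'k::field) set)"
  unfolding fun_vs.subspace_def
proof (intro conjI ballI allI)
  fix x y :: "'v bintree \<Rightarrow> 'k" and a
  assume x: "x \<in> coherent \<Gamma>" and y: "y \<in> coherent \<Gamma>"
  show "x + y \<in> coherent \<Gamma>"
  proof (rule coherentI)
    fix T T' assume *: "admissible \<Gamma> T" "admissible \<Gamma> T'" "leaves T = leaves T'"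
    show "tree_sign T * (x + y) T = tree_sign T' * (x + y) T'"
      using coherent_agree[OF x *] coherent_agree[OF y *] by (simp add: distrib_left)
  qed (simp add: coherent_support[OF x] coherent_support[OF y])
next
  fix x :: "'v bintree \<Rightarrow> 'k" and a
  assume x: "x \<in> coherent \<Gamma>"
  show "fscale a x \<in> coherent \<Gamma>"
  proof (rule coherentI)
    fix T T' assume *: "admissible \<Gamma> T" "admissible \<Gamma> T'" "leaves T = leaves T'"
    show "tree_sign T * fscale a x T = tree_sign T' * fscale a x T'"
      using coherent_agree[OF x *] by (simp add: fscale_def mult.left_commute[of _ a])
  qed (simp add: coherent_support[OF x] fscale_def)
qed (auto intro: coherentI)

text \<open>Fixing one coordinate of a pure tensor leaves a multiple of the other factor. In this
  way one part of a cut tree can be frozen while the other part varies inside its own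
  component.\<close>

lemma tensor_space_slice:
  assumes "h \<in> tensor_space C D" "fun_vs.subspace C" "fun_vs.subspace D"
  shows "(\<lambda>c. h (b, c)) \<in> D" "(\<lambda>b. h (b, c)) \<in> C"
proof -
  have "(\<lambda>c. h (b, c)) \<in> D \<and> (\<lambda>b. h (b, c)) \<in> C"
    using assms(1) unfolding tensor_space_def
  proof (induction rule: fun_vs.span_induct_alt)
    case base
    show ?case using fun_vs.subspace_0[OF assms(2)] fun_vs.subspace_0[OF assms(3)]
      by (simp add: zero_fun_def)
  next
    case (step a x y)
    then obtain f g where x: "x = (\<lambda>(b, c). f b * g c)" "f \<in> C" "g \<in> D" by blast
    have "(\<lambda>c. (fscale a x + y) (b, c)) = fscale (a * f b) g + (\<lambda>c. y (b, c))"
      "(\<lambda>b. (fscale a x + y) (b, c)) = fscale (a * g c) f + (\<lambda>b. y (b, c))"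
      by (auto simp: x fscale_def fun_eq_iff algebra_simps)
    then show ?case using step.IH x fun_vs.subspace_add fun_vs.subspace_scale assms(2,3) by metis
  qed
  then show "(\<lambda>c. h (b, c)) \<in> D" "(\<lambda>b. h (b, c)) \<in> C" by auto
qed

lemma finite_distinct_lists: "finite V \<Longrightarrow> finite {xs. distinct xs \<and> set xs = V}"
  by (rule finite_subset[OF _ finite_subset_distinct]) auto

lemma fun_vs_sum_apply: "(\<Sum>i\<in>A. f i) x = (\<Sum>i\<in>A. (f i x :: 'k::field))"
  by (induction A rule: infinite_finite_induct) auto

text \<open>There are finitely many orders of the vertices, so such a function is a finite sum of
  products of \<open>signed_trees\<close>, with the values of \<open>z\<close> as
  coefficients.\<close>

lemma tensor_space_coherentI:
  fixes z :: "'v list \<Rightarrow> 'v list \<Rightarrow> 'k::field"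
  assumes fin: "finite (pverts \<Gamma>)" "finite (pverts \<Delta>)"
    and h: "\<And>T S. h (T, S) = (if admissible \<Gamma> T \<and> admissible \<Delta> S
       then tree_sign T * tree_sign S * z (leaves T) (leaves S) else 0)"
  shows "h \<in> tensor_space (coherent \<Gamma>) (coherent \<Delta>)"
proof -
  define U where "U = {xs. distinct xs \<and> set xs = pverts \<Gamma>}"
  define W where "W = {xs. distinct xs \<and> set xs = pverts \<Delta>}"
  have fUW: "finite U" "finite W" using finite_distinct_lists fin by (auto simp: U_def W_def)
  have "h = (\<Sum>(u, w)\<in>U \<times> W. fscale (z u w) (\<lambda>(b, c). signed_trees \<Gamma> u b * signed_trees \<Delta> w c))"
  proof
    fix p :: "'v bintree \<times> 'v bintree"
    obtain T S where p: "p = (T, S)" by (cases p)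
    have "(\<Sum>(u, w)\<in>U \<times> W. fscale (z u w) (\<lambda>(b, c). signed_trees \<Gamma> u b * signed_trees \<Delta> w c)) (T, S) =
      (\<Sum>u\<in>U. \<Sum>w\<in>W. z u w * (signed_trees \<Gamma> u T * signed_trees \<Delta> w S))"
      by (simp add: fun_vs_sum_apply sum.cartesian_product fscale_def case_prod_unfold)
    also have "\<dots> = h (T, S)"
    proof (cases "admissible \<Gamma> T \<and> admissible \<Delta> S")
      case True
      then have "leaves T \<in> U" "leaves S \<in> W" using admissible_leaves[of \<Gamma> T] admissible_leaves[of \<Delta> S]
        by (simp_all add: U_def W_def)
      have "(\<Sum>u\<in>U. \<Sum>w\<in>W. z u w * (signed_trees \<Gamma> u T * signed_trees \<Delta> w S)) =
        (\<Sum>u\<in>U. \<Sum>w\<in>W. if w = leaves S then (if u = leaves T then z u w * (tree_sign T * tree_sign S) else 0) else 0)"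
        using True by (intro sum.cong refl) (auto simp: signed_trees_def)
      also have "\<dots> = z (leaves T) (leaves S) * (tree_sign T * tree_sign S)"
        using fUW \<open>leaves T \<in> U\<close> \<open>leaves S \<in> W\<close> by (simp add: sum.delta)
      finally show ?thesis using True by (simp add: h algebra_simps)
    qed (auto simp: h signed_trees_def intro!: sum.neutral)
    finally show "h p = (\<Sum>(u, w)\<in>U \<times> W. fscale (z u w) (\<lambda>(b, c). signed_trees \<Gamma> u b * signed_trees \<Delta> w c)) p"
      by (simp add: p)
  qed
  also have "\<dots> \<in> tensor_space (coherent \<Gamma>) (coherent \<Delta>)"
    unfolding tensor_space_def
    by (intro fun_vs.span_sum)
      (force intro: fun_vs.span_scale[OF fun_vs.span_base] signed_trees_coherent)
  finally show ?thesis .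
qed

text \<open>By \<open>tree_sign_graft\<close> the Koszul sign cancels, and what remains of the
  signed coefficient depends only on the leaf orders of the two parts.\<close>

lemma coherent_decomposition:
  fixes c :: "'v::linorder bintree \<Rightarrow> 'k::field"
  assumes \<Gamma>: "connected_graph \<Gamma>" "tube \<Gamma> G" and c: "c \<in> coherent \<Gamma>"
  shows "infinitesimal_decomposition \<Gamma> G c \<in> tensor_space (coherent (contract \<Gamma> G)) (coherent (induced \<Gamma> G))"
proof -
  note pg = connected_graphD(1)[OF \<Gamma>(1)] and G = tubeD[OF connected_graphD(1)[OF \<Gamma>(1)] \<Gamma>(2)]
  \<comment> \<open>Some tree with the composite order of leaves; coherence makes the signed
    coefficient independent of the choice.\<close>
  define t where "t u w = (SOME T. admissible \<Gamma> T \<and>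
     leaves T = concat (map (\<lambda>x. if x = Min G then w else [x]) u))" for u w
  \<comment> \<open>A tree with leaves \<open>w\<close> has \<open>length w - 1\<close> internal
    vertices, so this is the factor of \<open>tree_sign_graft\<close> that is visible from the leaf
    orders.\<close>
  define z where "z u w = (-1) ^ ((length w - 1) * entries_after (Min G) u) * (tree_sign (t u w) * c (t u w))" for u w
  show ?thesis
  proof (rule tensor_space_coherentI[where z = z])
    show "finite (pverts (contract \<Gamma> G))" "finite (pverts (induced \<Gamma> G))"
      using pair_graph_finite pair_graph_contract[OF pg G(1,2)] pair_graph_induced[OF pg] by blast+
    fix T S
    show "infinitesimal_decomposition \<Gamma> G c (T, S) =
      (if admissible (contract \<Gamma> G) T \<and> admissible (induced \<Gamma> G) S
       then tree_sign T * tree_sign S * z (leaves T) (leaves S) else 0)"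
    proof (cases "admissible (contract \<Gamma> G) T \<and> admissible (induced \<Gamma> G) S")
      case True
      note T = admissible_leaves[OF conjunct1[OF True]]
      have m: "Min G \<in> set (leaves T)" using T by (simp add: pverts_contract)
      have "admissible \<Gamma> (graft T (Min G) S)"
        using admissible_graft_iff[OF pg \<Gamma>(2) conjunct2[OF True] T] True by simp
      then have "\<exists>X. admissible \<Gamma> X \<and> leaves X = concat (map (\<lambda>x. if x = Min G then leaves S else [x]) (leaves T))"
        by (intro exI[of _ "graft T (Min G) S"]) (simp add: leaves_graft)
      then have "admissible \<Gamma> (t (leaves T) (leaves S)) \<and>
         leaves (t (leaves T) (leaves S)) = concat (map (\<lambda>x. if x = Min G then leaves S else [x]) (leaves T))"
        unfolding t_def by (rule someI_ex)
      then have "tree_sign (t (leaves T) (leaves S)) * c (t (leaves T) (leaves S)) =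
         tree_sign (graft T (Min G) S) * c (graft T (Min G) S)"
        by (intro coherent_agree[OF c] \<open>admissible \<Gamma> (graft T (Min G) S)\<close>) (simp_all add: leaves_graft)
      moreover have "length (leaves S) - 1 = inner S" by (simp flip: inner_conv_leaves)
      moreover have *: "p * q * (e * (f * (e * p * q) * x)) = f * x"
        if "e * e = 1" "p * p = 1" "q * q = 1" for e f p q x :: 'k
      proof -
        have "p * q * (e * (f * (e * p * q) * x)) = (e * e) * (p * p) * (q * q) * (f * x)"
          by (simp only: ac_simps)
        then show ?thesis using that by simp
      qed
      ultimately show ?thesis using True
        by (simp add: power_neg_one_sq tree_sign_sq infinitesimal_decomposition_def z_def tree_sign_graft[OF T(1) m] *)
    qed (auto simp: infinitesimal_decomposition_def)
  qed
qed

lemma leaves_map_bintree: "leaves (map_bintree f T) = map f (leaves T)"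
  by (induction T) auto

lemma inner_map_bintree: "inner (map_bintree f T) = inner T"
  by (induction T) auto

lemma tree_sign_map_bintree: "tree_sign (map_bintree f T) = tree_sign T"
  by (induction T) (auto simp: inner_map_bintree)

lemma edge_tree_map_bintree:
  "(\<And>u v. u \<in> set (leaves T) \<Longrightarrow> v \<in> set (leaves T) \<Longrightarrow> (u, v) \<in> E \<longleftrightarrow> (f u, f v) \<in> F) \<Longrightarrow>
   edge_tree F (map_bintree f T) \<longleftrightarrow> edge_tree E T"
  by (induction T) (auto simp: leaves_map_bintree)

lemma admissible_map_bintree:
  assumes "pair_graph \<Gamma>" "pair_graph \<Gamma>'" "graph_iso f \<Gamma> \<Gamma>'" "admissible \<Gamma> T"
  shows "admissible \<Gamma>' (map_bintree f T)"
proof -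
  have T: "set (leaves T) = pverts \<Gamma>" using assms(4) by (rule admissible_leaves)
  then have "edge_tree (parcs \<Gamma>') (map_bintree f T) \<longleftrightarrow> edge_tree (parcs \<Gamma>) T"
    using assms(3) by (intro edge_tree_map_bintree) (auto simp: graph_iso_def)
  then show ?thesis
    using assms T unfolding admissible_iff[OF assms(1)] admissible_iff[OF assms(2)]
    by (auto simp: leaves_map_bintree graph_iso_def bij_betw_def distinct_map)
qed

lemma sub_cocontractad_coherent:
  "sub_cocontractad (coherent :: 'v::linorder graph \<Rightarrow> ('v bintree \<Rightarrow> 'k::field) set)"
  unfolding sub_cocontractad_def
proof (intro conjI allI impI ballI)
  fix \<Gamma> \<Gamma>' :: "'v graph" and f and c :: "'v bintree \<Rightarrow> 'k"
  assume *: "connected_graph \<Gamma>" "connected_graph \<Gamma>'" "graph_iso f \<Gamma> \<Gamma>'" and c: "c \<in> coherent \<Gamma>'"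
  have adm: "admissible \<Gamma> T \<Longrightarrow> admissible \<Gamma>' (map_bintree f T)" for T
    using admissible_map_bintree * connected_graphD(1) by blast
  have "tree_sign T * c (map_bintree f T) = tree_sign T' * c (map_bintree f T')"
    if "admissible \<Gamma> T" "admissible \<Gamma> T'" "leaves T = leaves T'" for T T'
    using coherent_agree[OF c adm[OF that(1)] adm[OF that(2)]] that(3)
    by (simp add: leaves_map_bintree tree_sign_map_bintree)
  then have "tree_sign T * pullback f \<Gamma> c T = tree_sign T' * pullback f \<Gamma> c T'"
    if "admissible \<Gamma> T" "admissible \<Gamma> T'" "leaves T = leaves T'" for T T'
    unfolding pullback_def if_P[OF that(1)] if_P[OF that(2)] using that by blast
  then show "pullback f \<Gamma> c \<in> coherent \<Gamma>"
    by (rule coherentI[rotated]) (simp_all add: pullback_def)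
qed (use subspace_coherent coherent_decomposition in \<open>simp_all add: coherent_def subset_iff\<close>)

lemma leaves_1_iff: "leaves T = [a] \<longleftrightarrow> T = Leaf a"
  by (cases T) (auto simp: append_eq_Cons_conv)

lemma leaves_2_iff: "leaves T = [a, b] \<longleftrightarrow> T = cherry a b"
proof
  assume *: "leaves T = [a, b]"
  show "T = cherry a b"
  proof (cases T)
    case (Node l r)
    obtain x xs y ys where "leaves l = x # xs" "leaves r = y # ys" by (metis leaves_not_Nil neq_Nil_conv)
    then show ?thesis using * Node by (auto simp: append_eq_Cons_conv leaves_1_iff)
  qed (use * in simp)
qed simp

lemma leaves_3_iff:
  "leaves T = [a, b, c] \<longleftrightarrow> T = Node (cherry a b) (Leaf c) \<or> T = Node (Leaf a) (cherry b c)"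
proof
  assume *: "leaves T = [a, b, c]"
  show "T = Node (cherry a b) (Leaf c) \<or> T = Node (Leaf a) (cherry b c)"
  proof (cases T)
    case (Node l r)
    obtain x xs y ys where "leaves l = x # xs" "leaves r = y # ys" by (metis leaves_not_Nil neq_Nil_conv)
    then show ?thesis using * Node by (auto simp: append_eq_Cons_conv leaves_1_iff leaves_2_iff)
  qed (use * in simp)
qed auto

text \<open>The two trees with these leaves have opposite \<open>tree_sign\<close>, so if both are
  admissible their coefficients are opposite, as in the associativity relator. If an edge is
  missing, the tree with that cherry is inadmissible; the other one is a relator by itself or is
  inadmissible too.\<close>

lemma coherent_3_relations:
  fixes c :: "'v::linorder bintree \<Rightarrow> 'k::field"
  assumes pg: "pair_graph \<Gamma>" and c: "c \<in> coherent \<Gamma>"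
    and u: "distinct [v1, v2, v3]" "pverts \<Gamma> = {v1, v2, v3}"
  shows "(\<lambda>T. if leaves T = [v1, v2, v3] then c T else 0) \<in> relations \<Gamma>" (is "?r \<in> _")
proof -
  let ?T1 = "Node (cherry v1 v2) (Leaf v3)" and ?T2 = "Node (Leaf v1) (cherry v2 v3)"
  have r: "?r = fscale (c ?T1) (basis_vector ?T1) + fscale (c ?T2) (basis_vector ?T2)"
    by (auto simp: fun_eq_iff leaves_3_iff fscale_def basis_vector_def)
  have adm1: "c ?T1 = 0" if "(v1, v2) \<notin> parcs \<Gamma>"
    using that by (intro coherent_support[OF c]) (auto simp: admissible_iff[OF pg])
  have adm2: "c ?T2 = 0" if "(v2, v3) \<notin> parcs \<Gamma>"
    using that by (intro coherent_support[OF c]) (auto simp: admissible_iff[OF pg])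
  have span: "fscale a x \<in> relations \<Gamma>" if "x \<in> relators \<Gamma>" for a and x :: "'v bintree \<Rightarrow> 'k"
    unfolding relations_def by (intro fun_vs.span_scale fun_vs.span_base that)
  consider "(v1, v2) \<in> parcs \<Gamma>" "(v2, v3) \<in> parcs \<Gamma>" | "(v1, v2) \<in> parcs \<Gamma>" "(v2, v3) \<notin> parcs \<Gamma>"
    | "(v1, v2) \<notin> parcs \<Gamma>" "(v2, v3) \<in> parcs \<Gamma>" | "(v1, v2) \<notin> parcs \<Gamma>" "(v2, v3) \<notin> parcs \<Gamma>"
    by blast
  then show ?thesis
  proof cases
    case 1
    then have "admissible \<Gamma> ?T1" "admissible \<Gamma> ?T2" using u by (auto simp: admissible_iff[OF pg])
    then have "tree_sign ?T1 * c ?T1 = tree_sign ?T2 * c ?T2" by (rule coherent_agree[OF c]) simp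
    then have "?r = fscale (c ?T1) (basis_vector ?T1 - basis_vector ?T2)"
      unfolding r by (auto simp: fun_eq_iff fscale_def basis_vector_def)
    moreover have "basis_vector ?T1 - basis_vector ?T2 \<in> relators \<Gamma>"
      unfolding relators_def using u 1 by blast
    ultimately show ?thesis using span by metis
  next
    case 2
    then have "?r = fscale (c ?T1) (basis_vector ?T1)"
      unfolding r adm2[OF 2(2)] by (auto simp: fun_eq_iff fscale_def)
    moreover have "basis_vector ?T1 \<in> relators \<Gamma>"
      unfolding relators_def using u 2 by blast
    ultimately show ?thesis using span by metis
  next
    case 3
    then have "?r = fscale (c ?T2) (basis_vector ?T2)"
      unfolding r adm1[OF 3(1)] by (auto simp: fun_eq_iff fscale_def)
    moreover have "basis_vector ?T2 \<in> relators \<Gamma>"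
      unfolding relators_def using u 3 by blast
    ultimately show ?thesis using span by metis
  next
    case 4
    have "?r = 0" unfolding r adm1[OF 4(1)] adm2[OF 4(2)] by (auto simp: fun_eq_iff fscale_def)
    then show ?thesis by (simp only: relations_def fun_vs.span_zero)
  qed
qed

text \<open>All admissible trees of one graph have equally many internal vertices, so the part of
  weight 2 is everything on three vertices and zero on any other number. On three vertices it is
  sorted by the order of leaves.\<close>

lemma projection_vanishes_coherent:
  "projection_vanishes (coherent :: 'v::linorder graph \<Rightarrow> ('v bintree \<Rightarrow> 'k::field) set)"
  unfolding projection_vanishes_def
proof (intro allI impI ballI)
  fix \<Gamma> :: "'v graph" and c :: "'v bintree \<Rightarrow> 'k"
  assume \<Gamma>: "connected_graph \<Gamma>" and c: "c \<in> coherent \<Gamma>"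
  have inner: "Suc (inner T) = card (pverts \<Gamma>)" if "c T \<noteq> 0" for T
    using that coherent_support[OF c] admissible_inner by blast
  show "weight_part 2 c \<in> relations \<Gamma>"
  proof (cases "card (pverts \<Gamma>) = 3")
    case False
    have "weight_part 2 c T = 0" for T
      using False inner[of T] by (cases "c T = 0") (auto simp: weight_part_def)
    then have "weight_part 2 c = 0" by (simp add: fun_eq_iff)
    then show ?thesis by (simp only: relations_def fun_vs.span_zero)
  next
    case True
    let ?U = "{u. distinct u \<and> set u = pverts \<Gamma>}"
    have U: "finite ?U" using finite_distinct_lists connected_graphD(3)[OF \<Gamma>] by blast
    have "weight_part 2 c = (\<Sum>u\<in>?U. (\<lambda>T. if leaves T = u then c T else 0))"
    proof
      fix T
      have "(\<Sum>u\<in>?U. (if leaves T = u then c T else 0)) = (if leaves T \<in> ?U then c T else 0)"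
        by (rule sum.delta'[OF U])
      also have "\<dots> = c T" using coherent_support[OF c, of T] admissible_leaves[of \<Gamma> T] by auto
      also have "\<dots> = weight_part 2 c T"
        using inner[of T] True by (cases "c T = 0") (auto simp: weight_part_def)
      finally show "weight_part 2 c T = (\<Sum>u\<in>?U. (\<lambda>T. if leaves T = u then c T else 0)) T"
        by (simp add: fun_vs_sum_apply)
    qed
    also have "\<dots> \<in> relations \<Gamma>"
      unfolding relations_def
    proof (rule fun_vs.span_sum)
      fix u assume u: "u \<in> ?U"
      then have "length u = 3" using True distinct_card by fastforce
      then obtain v1 v2 v3 where "u = [v1, v2, v3]"
        by (auto simp: numeral_3_eq_3 length_Suc_conv)
      then show "(\<lambda>T. if leaves T = u then c T else 0) \<in> fun_vs.span (relators \<Gamma>)"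
        using coherent_3_relations[OF connected_graphD(1)[OF \<Gamma>] c, of v1 v2 v3] u
        unfolding relations_def by auto
    qed
    finally show ?thesis .
  qed
qed

text \<open>Admissibility of both trees provides both edges, which rules out the one-tree relators
  for this order of leaves. Each relator then has opposite values, possibly zero, at the two
  trees.\<close>

lemma relations_agree:
  fixes r :: "'v::linorder bintree \<Rightarrow> 'k::field"
  assumes pg: "pair_graph \<Gamma>" and "r \<in> relations \<Gamma>"
    and adm: "admissible \<Gamma> (Node (cherry a b) (Leaf c))" "admissible \<Gamma> (Node (Leaf a) (cherry b c))"
  shows "r (Node (cherry a b) (Leaf c)) = - r (Node (Leaf a) (cherry b c))"
  using assms(2) unfolding relations_def
proof (induction rule: fun_vs.span_induct_alt)
  case (step k x y)
  have "(a, b) \<in> parcs \<Gamma>" "(b, c) \<in> parcs \<Gamma>" using adm by (auto simp: admissible_iff[OF pg])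
  then have "x (Node (cherry a b) (Leaf c)) = - x (Node (Leaf a) (cherry b c))"
    using step.hyps unfolding relators_def by (auto simp: basis_vector_def)
  then show ?case using step.IH by (simp add: fscale_def)
qed simp

lemma append_distinct_cancel:
  assumes "xs @ w @ ys = xs' @ w @ ys'" "w \<noteq> []" "distinct (xs @ w @ ys)"
  shows "xs = xs' \<and> ys = ys'"
proof -
  obtain x w' where w: "w = x # w'" using assms(2) by (cases w) auto
  then have "x \<notin> set xs" "x \<notin> set (w' @ ys)" using assms(3) by auto
  then have "xs = xs' \<and> w' @ ys = w' @ ys'"
    using append_Cons_eq_iff[of x xs "w' @ ys" xs' "w' @ ys'"] assms(1) by (simp add: w)
  then show ?thesis by simp
qed

section \<open>Sub-cocontractads with vanishing projection consist of coherent functions\<close>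

locale vanishing_sub_cocontractad =
  fixes C :: "'v::linorder graph \<Rightarrow> ('v bintree \<Rightarrow> 'k::field) set"
  assumes sub: "sub_cocontractad C" and vanishing: "projection_vanishes C"
begin

lemma subspace: "connected_graph \<Gamma> \<Longrightarrow> fun_vs.subspace (C \<Gamma>)"
  using sub by (auto simp: sub_cocontractad_def)

lemma slice:
  assumes \<Gamma>: "connected_graph \<Gamma>" "tube \<Gamma> G" and c: "c \<in> C \<Gamma>"
  shows "(\<lambda>S. infinitesimal_decomposition \<Gamma> G c (T, S)) \<in> C (induced \<Gamma> G)"
    "(\<lambda>T. infinitesimal_decomposition \<Gamma> G c (T, S)) \<in> C (contract \<Gamma> G)"
proof -
  have "infinitesimal_decomposition \<Gamma> G c \<in> tensor_space (C (contract \<Gamma> G)) (C (induced \<Gamma> G))"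
    using sub \<Gamma> c by (auto simp: sub_cocontractad_def)
  note * = tensor_space_slice[OF this subspace[OF connected_graph_contract[OF \<Gamma>]]
      subspace[OF connected_graph_induced[OF connected_graphD(1)[OF \<Gamma>(1)] \<Gamma>(2)]]]
  show "(\<lambda>S. infinitesimal_decomposition \<Gamma> G c (T, S)) \<in> C (induced \<Gamma> G)"
    "(\<lambda>T. infinitesimal_decomposition \<Gamma> G c (T, S)) \<in> C (contract \<Gamma> G)"
    by (rule *)+
qed

definition agree :: "('v bintree \<Rightarrow> 'k) \<Rightarrow> 'v bintree \<Rightarrow> 'v bintree \<Rightarrow> bool" where
  "agree c T T' \<longleftrightarrow> tree_sign T * c T = tree_sign T' * c T'"

lemma agree_trans: "agree c T T' \<Longrightarrow> agree c T' T'' \<Longrightarrow> agree c T T''"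
  and agree_sym: "agree c T T' \<Longrightarrow> agree c T' T"
  by (simp_all add: agree_def)

text \<open>The induction hypothesis. It ranges over all graphs because a cut leads to an induced
  graph and to a contracted one.\<close>

definition coherent_below :: "nat \<Rightarrow> bool" where
  "coherent_below n \<longleftrightarrow> (\<forall>\<Gamma> c T T'. connected_graph \<Gamma> \<longrightarrow> card (pverts \<Gamma>) < n \<longrightarrow> c \<in> C \<Gamma> \<longrightarrow>
     admissible \<Gamma> T \<longrightarrow> admissible \<Gamma> T' \<longrightarrow> leaves T = leaves T' \<longrightarrow> agree c T T')"

text \<open>Cut both trees at the common leaf set \<open>G\<close>. First \<open>S\<close> is
  exchanged for \<open>S'\<close> with the remainder \<open>T0\<close> frozen, inside \<Gamma>|G;
  then \<open>T0\<close> is exchanged for \<open>T0'\<close> with \<open>S'\<close> frozen, inside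
  \<Gamma>/G. Both graphs are smaller, since \<open>S\<close> is neither a leaf nor the whole tree.
  The order of leaves makes the remaining sign factor the same for both trees.\<close>

lemma agree_common_subtree:
  assumes \<Gamma>: "connected_graph \<Gamma>" and IH: "coherent_below (card (pverts \<Gamma>))" and c: "c \<in> C \<Gamma>"
    and T: "admissible \<Gamma> T" "admissible \<Gamma> T'" "leaves T = leaves T'"
    and S: "S \<in> subtrees T" "S' \<in> subtrees T'" "leaves S = leaves S'" "0 < inner S" "inner S < inner T"
  shows "agree c T T'"
proof -
  note pg = connected_graphD(1)[OF \<Gamma>]
  define G where "G = set (leaves S)"
  have G': "G = set (leaves S')" by (simp add: G_def S(3))
  obtain T0 xs ys where T0: "T = graft T0 (Min G) S" "leaves T0 = xs @ [Min G] @ ys" "leaves T = xs @ leaves S @ ys"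
    "admissible (contract \<Gamma> G) T0" and GS: "admissible (induced \<Gamma> G) S" and G: "tube \<Gamma> G"
    using admissible_subtree_cut[OF pg T(1) S(1)] unfolding G_def by blast
  obtain T0' xs' ys' where T0': "T' = graft T0' (Min G) S'" "leaves T0' = xs' @ [Min G] @ ys'"
      "leaves T' = xs' @ leaves S' @ ys'" "admissible (contract \<Gamma> G) T0'"
    and GS': "admissible (induced \<Gamma> G) S'"
    using admissible_subtree_cut[OF pg T(2) S(2)] unfolding G' by blast
  have "xs = xs' \<and> ys = ys'"
    using T0(3) T0'(3) T(3) S(3) admissible_leaves(1)[OF T(1)]
    by (intro append_distinct_cancel[of _ "leaves S"]) auto
  then have lT0: "leaves T0 = leaves T0'" using T0 T0' by simp
  have iS: "inner S' = inner S" using S(3) inner_conv_leaves by (metis nat.inject)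
  have cards: "Suc (inner T) = card (pverts \<Gamma>)" "Suc (inner S) = card (pverts (induced \<Gamma> G))"
    "Suc (inner T0) = card (pverts (contract \<Gamma> G))"
    using admissible_inner T(1) GS T0(4) by blast+
  have m: "distinct (leaves T0)" "Min G \<in> set (leaves T0)" "distinct (leaves T0')" "Min G \<in> set (leaves T0')"
    using admissible_leaves(1)[OF T0(4)] T0(2) lT0 by auto
  have "inner T = inner T0 + inner S" using inner_graft[OF m(1,2)] T0(1) by simp
  then have small: "card (pverts (induced \<Gamma> G)) < card (pverts \<Gamma>)" "card (pverts (contract \<Gamma> G)) < card (pverts \<Gamma>)"
    using S(4,5) cards by linarith+
  let ?D = "infinitesimal_decomposition \<Gamma> G c"
  let ?e = "(-1::'k) ^ (inner S * inner_after (Min G) T0)" and ?e' = "(-1::'k) ^ (inner S * inner_after (Min G) T0')"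
  let ?f = "(-1::'k) ^ (inner S * entries_after (Min G) (leaves T0))"
  have "agree (\<lambda>S. ?D (T0, S)) S S'"
    using IH connected_graph_induced[OF pg G] small(1) slice(1)[OF \<Gamma> G c] GS GS' S(3)
    unfolding coherent_below_def by blast
  then have 1: "tree_sign S * (?e * c (graft T0 (Min G) S)) = tree_sign S' * (?e * c (graft T0 (Min G) S'))"
    using T0(4) GS GS' by (simp add: agree_def infinitesimal_decomposition_def iS)
  have "agree (\<lambda>T. ?D (T, S')) T0 T0'"
    using IH connected_graph_contract[OF \<Gamma> G] small(2) slice(2)[OF \<Gamma> G c] T0(4) T0'(4) lT0
    unfolding coherent_below_def by blast
  then have 2: "tree_sign T0 * (?e * c (graft T0 (Min G) S')) = tree_sign T0' * (?e' * c (graft T0' (Min G) S'))"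
    using T0(4) T0'(4) GS' by (simp add: agree_def infinitesimal_decomposition_def iS)
  have "tree_sign T * c T = ?f * tree_sign T0 * (tree_sign S * (?e * c (graft T0 (Min G) S)))"
    by (simp add: T0(1) tree_sign_graft[OF m(1,2)] ac_simps)
  also have "\<dots> = ?f * tree_sign S' * (tree_sign T0 * (?e * c (graft T0 (Min G) S')))"
    unfolding 1 by (simp add: ac_simps)
  also have "\<dots> = tree_sign T' * c T'"
    unfolding 2 by (simp add: T0'(1) tree_sign_graft[OF m(3,4)] iS lT0 ac_simps)
  finally show ?thesis by (simp add: agree_def)
qed

text \<open>With at least four leaves, the two trees of a rotation share a nontrivial proper subtree, so a
  rotation at the root reduces to smaller graphs as well.\<close>

lemma agree_cherry:
  assumes \<Gamma>: "connected_graph \<Gamma>" and IH: "coherent_below (card (pverts \<Gamma>))" and c: "c \<in> C \<Gamma>"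
    and n: "4 \<le> card (pverts \<Gamma>)"
    and T: "admissible \<Gamma> T" "leaves T = xs @ [a, b] @ ys" and ab: "(a, b) \<in> parcs \<Gamma>"
  shows "\<exists>T'. admissible \<Gamma> T' \<and> leaves T' = leaves T \<and> cherry a b \<in> subtrees T' \<and> agree c T T'"
proof -
  note pg = connected_graphD(1)[OF \<Gamma>]
  note share = agree_common_subtree[OF \<Gamma> IH c]
  \<comment> \<open>A rearrangement within one child of the root keeps the leaves of that child, so
    the old and the new child serve as the subtrees at which both trees are cut.\<close>
  have inside: "\<exists>T'. admissible \<Gamma> T' \<and> leaves T' = leaves T \<and> cherry a b \<in> subtrees T' \<and> agree c T T'"
    if A: "admissible \<Gamma> T" "T = Node l r"
      "(\<exists>us vs. leaves l = us @ [a, b] @ vs) \<or> (\<exists>us vs. leaves r = us @ [a, b] @ vs)" for T l r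
    using A(3)
  proof
    assume "\<exists>us vs. leaves l = us @ [a, b] @ vs"
    then obtain us vs where l: "leaves l = us @ [a, b] @ vs" by blast
    obtain l' where l': "edge_tree (parcs \<Gamma>) l'" "leaves l' = leaves l" "cherry a b \<in> subtrees l'"
      using ex_cherry_tree[OF _ l ab] A(1,2) by (auto simp: admissible_iff[OF pg])
    have adm: "admissible \<Gamma> (Node l' r)" using A(1,2) l' by (auto simp: admissible_iff[OF pg])
    have "0 < inner l" using l inner_conv_leaves[of l] by (cases "inner l") auto
    then have "agree c T (Node l' r)"
      using l' by (intro share[OF A(1) adm, of l l']) (auto simp: A(2))
    then show ?thesis using adm l' A(2) by (intro exI[of _ "Node l' r"]) auto
  next
    assume "\<exists>us vs. leaves r = us @ [a, b] @ vs"
    then obtain us vs where r: "leaves r = us @ [a, b] @ vs" by blast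
    obtain r' where r': "edge_tree (parcs \<Gamma>) r'" "leaves r' = leaves r" "cherry a b \<in> subtrees r'"
      using ex_cherry_tree[OF _ r ab] A(1,2) by (auto simp: admissible_iff[OF pg])
    have adm: "admissible \<Gamma> (Node l r')" using A(1,2) r' by (auto simp: admissible_iff[OF pg])
    have "0 < inner r" using r inner_conv_leaves[of r] by (cases "inner r") auto
    then have "agree c T (Node l r')"
      using r' by (intro share[OF A(1) adm, of r r']) (auto simp: A(2))
    then show ?thesis using adm r' A(2) by (intro exI[of _ "Node l r'"]) auto
  qed
  have via: ?thesis if "admissible \<Gamma> T2" "T2 = Node l r" "leaves T2 = leaves T" "agree c T T2"
      "(\<exists>us vs. leaves l = us @ [a, b] @ vs) \<or> (\<exists>us vs. leaves r = us @ [a, b] @ vs)" for T2 l r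
    using inside[OF that(1,2,5)] that(3,4) agree_trans by metis
  obtain l r where Tlr: "T = Node l r" using T(2) by (cases T) auto
  have lr: "leaves l @ leaves r = xs @ [a, b] @ ys" using T(2) Tlr by simp
  consider us where "leaves l = xs @ [a, b] @ us" | us where "leaves r = us @ [a, b] @ ys"
    | "leaves l = xs @ [a]" "leaves r = b # ys"
    using lr by (auto simp: append_eq_append_conv2 append_eq_Cons_conv Cons_eq_append_conv)
  then show ?thesis
  proof cases
    case 3
    have iT: "3 \<le> inner T" using admissible_inner[OF T(1)] n by simp
    show ?thesis
    proof (cases r)
      case (Node r1 r2)
      then obtain zs where zs: "leaves r1 = b # zs" using 3 by (cases "leaves r1") auto
      let ?T2 = "Node (Node l r1) r2"
      have adm: "admissible \<Gamma> ?T2" using T(1) 3 zs ab unfolding Tlr Node by (auto simp: admissible_iff[OF pg])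
      \<comment> \<open>Only two of the at least three internal vertices take part in the rotation;
        another one lies in \<open>l\<close>, \<open>r1\<close> or \<open>r2\<close>, which both
        trees contain unchanged.\<close>
      have "0 < inner l \<or> 0 < inner r1 \<or> 0 < inner r2" using iT by (auto simp: Tlr Node)
      then obtain S where "S \<in> {l, r1, r2}" "0 < inner S" by blast
      then have "agree c T ?T2"
        by (intro share[OF T(1) adm, of S S]) (auto simp: Tlr Node)
      then show ?thesis using 3 zs by (intro via[OF adm refl]) (auto simp: Tlr Node)
    next
      case r: (Leaf b')
      then have "0 < inner l" using iT Tlr by auto
      then obtain l1 l2 where Node: "l = Node l1 l2" by (cases l) auto
      then obtain zs where zs: "leaves l2 = zs @ [a]" using 3 by (cases "leaves l2" rule: rev_cases) auto
      let ?T2 = "Node l1 (Node l2 r)"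
      have adm: "admissible \<Gamma> ?T2" using T(1) 3 zs ab unfolding Tlr Node by (auto simp: admissible_iff[OF pg])
      have "0 < inner l1 \<or> 0 < inner l2" using iT by (auto simp: Tlr Node r)
      then obtain S where "S \<in> {l1, l2}" "0 < inner S" by blast
      then have "agree c T ?T2"
        by (intro share[OF T(1) adm, of S S]) (auto simp: Tlr Node)
      then show ?thesis using 3 zs by (intro via[OF adm refl]) (auto simp: Tlr Node)
    qed
  qed (use inside[OF T(1) Tlr] in blast)+
qed

text \<open>The relations are used for three vertices only. With four or more, a cherry of
  \<open>T\<close> is first produced in \<open>T'\<close> by \<open>agree_cherry\<close>; the
  resulting tree and \<open>T\<close> share this cherry and can be cut there.\<close>

lemma agree_same_leaves:
  "connected_graph \<Gamma> \<Longrightarrow> c \<in> C \<Gamma> \<Longrightarrow> admissible \<Gamma> T \<Longrightarrow> admissible \<Gamma> T' \<Longrightarrow> leaves T = leaves T' \<Longrightarrow>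
   agree c T T'"
proof (induction "card (pverts \<Gamma>)" arbitrary: \<Gamma> c T T' rule: less_induct)
  case less
  note \<Gamma> = less.prems(1) and c = less.prems(2) and T = less.prems(3-5)
  note pg = connected_graphD(1)[OF \<Gamma>]
  have IH: "coherent_below (card (pverts \<Gamma>))" using less.hyps unfolding coherent_below_def by blast
  have len: "length (leaves T) = card (pverts \<Gamma>)"
    using admissible_inner[OF T(1)] inner_conv_leaves[of T] by simp
  consider "card (pverts \<Gamma>) = 0" | "card (pverts \<Gamma>) = 1" | "card (pverts \<Gamma>) = 2"
    | "card (pverts \<Gamma>) = 3" | "4 \<le> card (pverts \<Gamma>)" by linarith
  then show ?case
  proof cases
    case 1
    then show ?thesis using len by simp
  next
    case 2
    then obtain a where "leaves T = [a]" using len by (auto simp: length_Suc_conv)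
    then have "T = T'" using T(3) leaves_1_iff by metis
    then show ?thesis by (simp add: agree_def)
  next
    case 3
    then obtain a b where "leaves T = [a, b]" using len by (auto simp: numeral_2_eq_2 length_Suc_conv)
    then have "T = T'" using T(3) leaves_2_iff by metis
    then show ?thesis by (simp add: agree_def)
  next
    case 4
    then obtain a b d where l: "leaves T = [a, b, d]" using len by (auto simp: numeral_3_eq_3 length_Suc_conv)
    have "weight_part 2 c \<in> relations \<Gamma>" using vanishing \<Gamma> c by (auto simp: projection_vanishes_def)
    note * = relations_agree[OF pg this, of a b d]
    have "agree c (Node (cherry a b) (Leaf d)) (Node (Leaf a) (cherry b d))"
      if "admissible \<Gamma> (Node (cherry a b) (Leaf d))" "admissible \<Gamma> (Node (Leaf a) (cherry b d))"
      using *[OF that] by (simp add: agree_def weight_part_def)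
    moreover have "T = Node (cherry a b) (Leaf d) \<or> T = Node (Leaf a) (cherry b d)"
      "T' = Node (cherry a b) (Leaf d) \<or> T' = Node (Leaf a) (cherry b d)"
      using l T(3) leaves_3_iff by metis+
    ultimately show ?thesis using T(1,2) agree_sym by (metis agree_def)
  next
    case 5
    have iT: "3 \<le> inner T" using admissible_inner[OF T(1)] 5 by simp
    then obtain a b where ab: "cherry a b \<in> subtrees T" using ex_cherry[of T] by auto
    have "edge_tree (parcs \<Gamma>) (cherry a b)"
      using edge_tree_subtree[OF ab] T(1) by (simp add: admissible_iff[OF pg])
    then have E: "(a, b) \<in> parcs \<Gamma>" by simp
    obtain xs ys where "leaves T = xs @ leaves (cherry a b) @ ys"
      using admissible_subtree_cut[OF pg T(1) ab] by metis
    then have "leaves T' = xs @ [a, b] @ ys" using T(3) by simp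
    then obtain T'' where T'': "admissible \<Gamma> T''" "leaves T'' = leaves T'" "cherry a b \<in> subtrees T''" "agree c T' T''"
      using agree_cherry[OF \<Gamma> IH c 5 T(2) _ E] by blast
    have "agree c T T''"
      by (rule agree_common_subtree[OF \<Gamma> IH c T(1) T''(1) _ ab T''(3)]) (use T(3) T''(2) iT in auto)
    then show ?thesis using T''(4) agree_sym agree_trans by blast
  qed
qed

lemma subset_coherent: "connected_graph \<Gamma> \<Longrightarrow> C \<Gamma> \<subseteq> coherent \<Gamma>"
proof
  fix c assume \<Gamma>: "connected_graph \<Gamma>" and c: "c \<in> C \<Gamma>"
  have "c \<in> BiPlan \<Gamma>" using sub \<Gamma> c by (auto simp: sub_cocontractad_def)
  then show "c \<in> coherent \<Gamma>"
    using agree_same_leaves[OF \<Gamma> c] unfolding coherent_def agree_def by blast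
qed

end

text \<open>Coherent functions form one of the summands that define \<open>Ham_dual\<close>.
  Conversely \<open>Ham_dual\<close> is itself a sub-cocontractad with vanishing projection, so the
  result of the locale applies to it.\<close>

theorem Ham_dual_eq_coherent:
  fixes \<Gamma> :: "'v::linorder graph"
  assumes "connected_graph \<Gamma>"
  shows "Ham_dual \<Gamma> = (coherent \<Gamma> :: ('v bintree \<Rightarrow> 'k::field) set)"
proof
  show "coherent \<Gamma> \<subseteq> (Ham_dual \<Gamma> :: ('v bintree \<Rightarrow> 'k) set)"
    by (rule Ham_dual_upper[OF sub_cocontractad_coherent projection_vanishes_coherent])
  interpret vanishing_sub_cocontractad "Ham_dual :: 'v graph \<Rightarrow> ('v bintree \<Rightarrow> 'k) set"
    by unfold_locales (rule Ham_dual_sub_cocontractad, rule Ham_dual_projection_vanishes)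
  show "Ham_dual \<Gamma> \<subseteq> (coherent \<Gamma> :: ('v bintree \<Rightarrow> 'k) set)"
    using assms by (rule subset_coherent)
qed

section \<open>The Koszul complex in coordinates\<close>

text \<open>A basis element \<open>(I, T, p)\<close> of the Koszul complex is recorded, up to the choice of \<open>T\<close> with a
  given order of leaves, by listing the paths of the blocks in the order of the leaves of \<open>T\<close>.\<close>

definition path_list :: "'v graph \<Rightarrow> 'v list list \<Rightarrow> bool" where
  "path_list \<Gamma> ws \<longleftrightarrow> distinct (concat ws) \<and> set (concat ws) = pverts \<Gamma> \<and>
     (\<forall>w\<in>set ws. w \<noteq> [] \<and> successively (\<lambda>u v. (u, v) \<in> parcs \<Gamma>) w)"

definition blocks :: "'v list list \<Rightarrow> 'v set set" where
  "blocks ws = set ` set ws"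

text \<open>For a \<open>path_list\<close> the choice is unique, as its entries are nonempty and
  pairwise disjoint. The restriction makes the family extensional, as membership in
  \<open>path_families\<close> demands.\<close>

definition block_path :: "'v list list \<Rightarrow> 'v set \<Rightarrow> 'v list" where
  "block_path ws = restrict (\<lambda>G. THE w. w \<in> set ws \<and> set w = G) (blocks ws)"

definition block_with_Min :: "'v::linorder set set \<Rightarrow> 'v \<Rightarrow> 'v set" where
  "block_with_Min I m = (THE G. G \<in> I \<and> Min G = m)"

definition list_of :: "'v::linorder set set \<Rightarrow> 'v bintree \<Rightarrow> ('v set \<Rightarrow> 'v list) \<Rightarrow> 'v list list" where
  "list_of I T p = map (\<lambda>m. p (block_with_Min I m)) (leaves T)"

definition koszul_index :: "'v::linorder graph \<Rightarrow> 'v set set \<Rightarrow> 'v bintree \<Rightarrow> ('v set \<Rightarrow> 'v list) \<Rightarrow> bool" where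
  "koszul_index \<Gamma> I T p \<longleftrightarrow>
     tube_partition \<Gamma> I \<and> admissible (graph_quotient \<Gamma> I) T \<and> p \<in> path_families \<Gamma> I"

text \<open>The element with coordinates \<open>y\<close>. It sees \<open>y\<close> only at lists
  that carry an admissible tree, so an identity between elements is an identity of coordinates at
  those lists.\<close>

definition koszul_element ::
  "'v::linorder graph \<Rightarrow> ('v list list \<Rightarrow> 'k) \<Rightarrow> 'v set set \<times> 'v bintree \<times> ('v set \<Rightarrow> 'v list) \<Rightarrow> 'k::field" where
  "koszul_element \<Gamma> y = (\<lambda>(I, T, p). if koszul_index \<Gamma> I T p then tree_sign T * y (list_of I T p) else 0)"

lemma path_families_iff:
  "p \<in> path_families \<Gamma> I \<longleftrightarrow> p \<in> extensional I \<and> (\<forall>G\<in>I. p G \<in> ham_paths (induced \<Gamma> G))"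
  by (auto simp: path_families_def PiE_iff)

lemma ham_paths_induced:
  assumes "G \<subseteq> pverts \<Gamma>"
  shows "w \<in> ham_paths (induced \<Gamma> G) \<longleftrightarrow>
    distinct w \<and> set w = G \<and> successively (\<lambda>u v. (u, v) \<in> parcs \<Gamma>) w"
proof -
  have "successively (\<lambda>u v. (u, v) \<in> parcs (induced \<Gamma> G)) w \<longleftrightarrow> successively (\<lambda>u v. (u, v) \<in> parcs \<Gamma>) w"
    if "set w = G"
    by (rule successively_cong) (use that in \<open>auto simp: induced_simps\<close>)
  then show ?thesis using assms by (auto simp: ham_paths_def induced_simps)
qed

lemma tube_path:
  assumes "pair_graph \<Gamma>"
  shows "w \<noteq> [] \<Longrightarrow> set w \<subseteq> pverts \<Gamma> \<Longrightarrow> successively (\<lambda>u v. (u, v) \<in> parcs \<Gamma>) w \<Longrightarrow> tube \<Gamma> (set w)"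
proof (induction w rule: induct_list012)
  case (2 x)
  then show ?case by (simp add: tube_singleton[OF assms])
next
  case (3 x y zs)
  then have "tube \<Gamma> ({x} \<union> set (y # zs))"
    by (intro tube_union[OF assms]) (auto simp: tube_singleton[OF assms])
  then show ?case by (simp add: insert_commute)
qed simp

lemma path_families_D:
  assumes "tube_partition \<Gamma> I" "p \<in> path_families \<Gamma> I" "G \<in> I"
  shows "distinct (p G)" "set (p G) = G" "successively (\<lambda>u v. (u, v) \<in> parcs \<Gamma>) (p G)" "p G \<noteq> []"
  using assms(2,3) ham_paths_induced[OF tube_partitionD(5)[OF assms(1,3)], of "p G"]
    tube_partitionD(4)[OF assms(1,3)] by (auto simp: path_families_iff)

lemma finite_path_families:
  assumes "pair_graph \<Gamma>" "tube_partition \<Gamma> I"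
  shows "finite (path_families \<Gamma> I)"
  unfolding path_families_def
proof (rule finite_PiE[OF finite_tube_partitions(2)[OF assms]])
  fix G
  have "finite (pverts (induced \<Gamma> G))" using pair_graph_finite[OF pair_graph_induced[OF assms(1)]] .
  from finite_distinct_lists[OF this] show "finite (ham_paths (induced \<Gamma> G))"
    by (rule rev_finite_subset) (auto simp: ham_paths_def)
qed

lemma block_with_Min:
  assumes "pair_graph \<Gamma>" "tube_partition \<Gamma> I" "G \<in> I"
  shows "block_with_Min I (Min G) = G"
  unfolding block_with_Min_def
  using assms(3) inj_onD[OF tube_partition_Min(2)[OF assms(1,2)]] by (intro the_equality) auto

text \<open>Passing to the list forgets the shape of \<open>T\<close> and nothing else: blocks,
  paths and the order of leaves can all be recovered.\<close>

lemma koszul_index_list_of: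
  assumes "pair_graph \<Gamma>" "koszul_index \<Gamma> I T p"
  shows "blocks (list_of I T p) = I" "map (\<lambda>w. Min (set w)) (list_of I T p) = leaves T"
    "path_list \<Gamma> (list_of I T p)" "set (list_of I T p) = p ` I"
    "length (list_of I T p) = Suc (inner T)"
proof -
  have I: "tube_partition \<Gamma> I" and T: "admissible (graph_quotient \<Gamma> I) T" and p: "p \<in> path_families \<Gamma> I"
    using assms(2) by (auto simp: koszul_index_def)
  note pD = path_families_D[OF I p] and b = block_with_Min[OF assms(1) I]
  have lT: "set (leaves T) = Min ` I" "distinct (leaves T)"
    using admissible_leaves[OF T] by (auto simp: pverts_graph_quotient)
  show set: "set (list_of I T p) = p ` I"
  proof -
    have "set (list_of I T p) = (\<lambda>G. p (block_with_Min I (Min G))) ` I"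
      by (simp add: list_of_def lT image_image)
    also have "\<dots> = p ` I" using b by (intro image_cong) auto
    finally show ?thesis .
  qed
  have "set ` p ` I = (\<lambda>G. G) ` I" unfolding image_image by (intro image_cong refl pD(2))
  then show "blocks (list_of I T p) = I" by (simp add: blocks_def set)
  show "map (\<lambda>w. Min (set w)) (list_of I T p) = leaves T"
    unfolding list_of_def map_map
  proof (rule map_idI)
    fix m assume "m \<in> set (leaves T)"
    then obtain G where "G \<in> I" "m = Min G" using lT by auto
    then show "((\<lambda>w. Min (set w)) \<circ> (\<lambda>m. p (block_with_Min I m))) m = m"
      by (simp add: b pD(2))
  qed
  show "length (list_of I T p) = Suc (inner T)" by (simp add: list_of_def inner_conv_leaves)
  have "distinct (concat (list_of I T p))"
    unfolding distinct_concat_iff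
  proof (intro conjI allI impI)
    have "inj_on (\<lambda>m. p (block_with_Min I m)) (set (leaves T))"
    proof (rule inj_onI)
      fix m m' assume *: "m \<in> set (leaves T)" "m' \<in> set (leaves T)" "p (block_with_Min I m) = p (block_with_Min I m')"
      then obtain G G' where "G \<in> I" "G' \<in> I" "m = Min G" "m' = Min G'" using lT(1) by auto
      then have "set (p G) = set (p G')" using *(3) by (simp add: b)
      then show "m = m'" using \<open>G \<in> I\<close> \<open>G' \<in> I\<close> \<open>m = Min G\<close> \<open>m' = Min G'\<close> by (simp add: pD(2))
    qed
    then have "distinct (list_of I T p)" by (simp add: list_of_def distinct_map lT)
    then show "distinct (removeAll [] (list_of I T p))" by (rule distinct_removeAll)
    show "distinct ys" if "ys \<in> set (list_of I T p)" for ys using that by (auto simp: set pD(1))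
    show "set ys \<inter> set zs = {}"
      if "ys \<in> set (list_of I T p) \<and> zs \<in> set (list_of I T p) \<and> ys \<noteq> zs" for ys zs
    proof -
      obtain G G' where "G \<in> I" "G' \<in> I" "ys = p G" "zs = p G'" "G \<noteq> G'" using \<open>ys \<in> _ \<and> _\<close> by (auto simp: set)
      then show ?thesis using tube_partition_disjoint[OF I, of G G'] by (simp add: pD(2))
    qed
  qed
  moreover have "set (concat (list_of I T p)) = pverts \<Gamma>"
    using tube_partitionD(1)[OF I] by (simp add: set pD(2))
  ultimately show "path_list \<Gamma> (list_of I T p)"
    by (auto simp: path_list_def set pD(3,4))
qed

lemma path_list_distinct_sets:
  assumes "path_list \<Gamma> ws" "v \<in> set ws" "w \<in> set ws" "set v \<inter> set w \<noteq> {}"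
  shows "v = w"
  using assms unfolding path_list_def distinct_concat_iff by auto

lemma path_list_distinct: "path_list \<Gamma> ws \<Longrightarrow> distinct ws"
  unfolding path_list_def distinct_concat_iff by (metis removeAll_id)

lemma block_path_eq:
  assumes "path_list \<Gamma> ws" "w \<in> set ws"
  shows "block_path ws (set w) = w"
proof -
  have "w \<noteq> []" using assms by (auto simp: path_list_def)
  then have "(THE v. v \<in> set ws \<and> set v = set w) = w"
    using assms path_list_distinct_sets[OF assms(1)] by (intro the_equality) auto
  then show ?thesis using assms(2) by (simp add: block_path_def blocks_def)
qed

lemma block_path_list_of:
  assumes "pair_graph \<Gamma>" "koszul_index \<Gamma> I T p"
  shows "block_path (list_of I T p) = p"
proof (rule extensionalityI[where A = I])
  note ws = koszul_index_list_of[OF assms]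
  have I: "tube_partition \<Gamma> I" and p: "p \<in> path_families \<Gamma> I"
    using assms(2) by (auto simp: koszul_index_def)
  show "block_path (list_of I T p) \<in> extensional I" using ws(1) by (simp add: block_path_def)
  show "p \<in> extensional I" using p by (simp add: path_families_iff)
  fix G assume "G \<in> I"
  then show "block_path (list_of I T p) G = p G"
    using block_path_eq[OF ws(3), of "p G"] ws(4) path_families_D(2)[OF I p] by simp
qed

lemma path_list_index:
  assumes "pair_graph \<Gamma>" "path_list \<Gamma> ws"
  shows "tube_partition \<Gamma> (blocks ws)" "block_path ws \<in> path_families \<Gamma> (blocks ws)"
proof -
  have w: "w \<noteq> []" "distinct w" "set w \<subseteq> pverts \<Gamma>" "successively (\<lambda>u v. (u, v) \<in> parcs \<Gamma>) w"
    if "w \<in> set ws" for w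
    using assms(2) that by (auto simp: path_list_def distinct_concat_iff)
  have "disjoint (blocks ws)"
    unfolding disjoint_def blocks_def using path_list_distinct_sets[OF assms(2)] by blast
  moreover have "\<Union> (blocks ws) = pverts \<Gamma>" using assms(2) by (auto simp: blocks_def path_list_def)
  moreover have "{} \<notin> blocks ws" using w(1) by (auto simp: blocks_def)
  moreover have "\<forall>G\<in>blocks ws. tube \<Gamma> G" using tube_path[OF assms(1)] w by (auto simp: blocks_def)
  ultimately show "tube_partition \<Gamma> (blocks ws)" by (simp add: tube_partition_def partition_on_def)
  show "block_path ws \<in> path_families \<Gamma> (blocks ws)"
    unfolding path_families_iff
  proof (intro conjI ballI)
    show "block_path ws \<in> extensional (blocks ws)" by (simp add: block_path_def)
    fix G assume "G \<in> blocks ws"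
    then obtain v where "v \<in> set ws" "G = set v" by (auto simp: blocks_def)
    then show "block_path ws G \<in> ham_paths (induced \<Gamma> G)"
      using ham_paths_induced[of G \<Gamma> v] w block_path_eq[OF assms(2)] by simp
  qed
qed

lemma list_of_path_list:
  assumes "pair_graph \<Gamma>" "path_list \<Gamma> ws" "leaves T = map (\<lambda>w. Min (set w)) ws"
  shows "list_of (blocks ws) T (block_path ws) = ws"
proof -
  have "block_path ws (block_with_Min (blocks ws) (Min (set w))) = w" if "w \<in> set ws" for w
    using block_with_Min[OF assms(1) path_list_index(1)[OF assms(1,2)], of "set w"] that
      block_path_eq[OF assms(2)] by (simp add: blocks_def)
  then show ?thesis unfolding list_of_def assms(3) map_map by (intro map_idI) simp
qed

lemma koszul_element_cong:
  assumes "pair_graph \<Gamma>"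
    "\<And>ws T. path_list \<Gamma> ws \<Longrightarrow> admissible (graph_quotient \<Gamma> (blocks ws)) T \<Longrightarrow>
       leaves T = map (\<lambda>w. Min (set w)) ws \<Longrightarrow> y ws = y' ws"
  shows "koszul_element \<Gamma> y = koszul_element \<Gamma> y'"
proof
  fix x :: "'a set set \<times> 'a bintree \<times> ('a set \<Rightarrow> 'a list)"
  obtain I T p where x: "x = (I, T, p)" by (cases x)
  show "koszul_element \<Gamma> y x = koszul_element \<Gamma> y' x"
  proof (cases "koszul_index \<Gamma> I T p")
    case True
    note ws = koszul_index_list_of[OF assms(1) True]
    have "y (list_of I T p) = y' (list_of I T p)"
      by (rule assms(2)[OF ws(3)]) (use True in \<open>auto simp: ws koszul_index_def\<close>)
    then show ?thesis by (simp add: koszul_element_def x)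
  qed (simp add: koszul_element_def x)
qed

lemma koszul_element_eqD:
  assumes "pair_graph \<Gamma>" "koszul_element \<Gamma> y = koszul_element \<Gamma> y'"
    and ws: "path_list \<Gamma> ws" "admissible (graph_quotient \<Gamma> (blocks ws)) T" "leaves T = map (\<lambda>w. Min (set w)) ws"
  shows "y ws = (y' ws :: 'k::field)"
proof -
  have "koszul_index \<Gamma> (blocks ws) T (block_path ws)"
    using path_list_index[OF assms(1) ws(1)] ws(2) by (simp add: koszul_index_def)
  then have "tree_sign T * y ws = tree_sign T * y' ws"
    using fun_cong[OF assms(2), of "(blocks ws, T, block_path ws)"] list_of_path_list[OF assms(1) ws(1,3)]
    by (simp add: koszul_element_def)
  then show ?thesis using tree_sign_cancel by metis
qed

section \<open>The spaces of the Koszul complex as ranges of \<open>koszul_element\<close>\<close>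

lemma pure_tensor_basis:
  fixes f :: "'b \<Rightarrow> 'k::field"
  assumes "finite I" "p \<in> extensional I"
  shows "pure_tensor I f (\<lambda>G. basis_vector (p G)) (J, b, q) = (if J = I \<and> q = p then f b else 0)"
proof (cases "J = I \<and> q \<in> extensional I")
  case True
  have "(\<Prod>G\<in>I. basis_vector (p G) (q G)) = (if q = p then 1 else 0 :: 'k)"
  proof (cases "q = p")
    case False
    then obtain G where "G \<in> I" "q G \<noteq> p G" using True assms(2) extensionalityI by blast
    then have "(\<Prod>G\<in>I. basis_vector (p G) (q G)) = (0 :: 'k)"
      using assms(1) by (intro prod_zero) (auto simp: basis_vector_def)
    then show ?thesis using False by simp
  qed (simp add: basis_vector_def)
  then show ?thesis using True by (simp add: pure_tensor_def)
qed (use assms in \<open>auto simp: pure_tensor_def\<close>)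

text \<open>Expand in the pure tensors of a sum \<open>signed_trees\<close> with a family of paths.
  Their indices are partitions, path families and leaf orders, of which there are finitely
  many.\<close>

lemma koszul_element_in_product:
  fixes \<Gamma> :: "'v::linorder graph" and y :: "'v list list \<Rightarrow> 'k::field"
  assumes \<Gamma>: "connected_graph \<Gamma>"
  shows "koszul_element \<Gamma> y \<in> contraction_product Ham_dual Ham \<Gamma>"
proof -
  note pg = connected_graphD(1)[OF \<Gamma>]
  define U where "U I = {u. distinct u \<and> set u = pverts (graph_quotient \<Gamma> I)}" for I
  define \<Omega> where "\<Omega> = (SIGMA I:{I. tube_partition \<Gamma> I}. path_families \<Gamma> I \<times> U I)"
  have fin: "finite \<Omega>"
    unfolding \<Omega>_def U_def
    using finite_tube_partitions[OF pg] finite_path_families[OF pg]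
    by (auto intro!: finite_SigmaI finite_distinct_lists simp: pverts_graph_quotient)
  define t :: "'v set set \<times> ('v set \<Rightarrow> 'v list) \<times> 'v list \<Rightarrow> _ \<Rightarrow> 'k" where
    "t = (\<lambda>(I, p, u). fscale (y (map (\<lambda>m. p (block_with_Min I m)) u))
       (pure_tensor I (signed_trees (graph_quotient \<Gamma> I) u) (\<lambda>G. basis_vector (p G))))"
  have "koszul_element \<Gamma> y = (\<Sum>\<omega>\<in>\<Omega>. t \<omega>)"
  proof
    fix x :: "'v set set \<times> 'v bintree \<times> ('v set \<Rightarrow> 'v list)"
    obtain J T q where x: "x = (J, T, q)" by (cases x)
    have "(\<Sum>\<omega>\<in>\<Omega>. t \<omega>) x = (\<Sum>\<omega>\<in>\<Omega>. t \<omega> x)" by (rule fun_vs_sum_apply)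
    also have "\<dots> = (\<Sum>\<omega>\<in>\<Omega>. if \<omega> = (J, q, leaves T) then
        (if admissible (graph_quotient \<Gamma> J) T then tree_sign T * y (list_of J T q) else 0) else 0)"
    proof (rule sum.cong[OF refl])
      fix \<omega> assume "\<omega> \<in> \<Omega>"
      then obtain I p u where \<omega>: "\<omega> = (I, p, u)" "tube_partition \<Gamma> I" "p \<in> path_families \<Gamma> I"
        by (auto simp: \<Omega>_def)
      then have "p \<in> extensional I" by (simp add: path_families_iff)
      note basis = pure_tensor_basis[OF finite_tube_partitions(2)[OF pg \<omega>(2)] this,
          of "signed_trees (graph_quotient \<Gamma> I) u" J T q]
      show "t \<omega> x = (if \<omega> = (J, q, leaves T) then
        (if admissible (graph_quotient \<Gamma> J) T then tree_sign T * y (list_of J T q) else 0) else 0)"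
        unfolding t_def \<omega>(1) prod.case x fscale_def basis
        by (auto simp: signed_trees_def list_of_def)
    qed
    also have "\<dots> = (if (J, q, leaves T) \<in> \<Omega> then
        (if admissible (graph_quotient \<Gamma> J) T then tree_sign T * y (list_of J T q) else 0) else 0)"
      by (rule sum.delta[OF fin])
    also have "\<dots> = koszul_element \<Gamma> y x"
      using admissible_leaves[of "graph_quotient \<Gamma> J" T]
      by (auto simp: koszul_element_def x \<Omega>_def U_def koszul_index_def)
    finally show "koszul_element \<Gamma> y x = (\<Sum>\<omega>\<in>\<Omega>. t \<omega>) x" by simp
  qed
  also have "\<dots> \<in> contraction_product Ham_dual Ham \<Gamma>"
    unfolding contraction_product_def
  proof (rule fun_vs.span_sum)
    fix \<omega> assume "\<omega> \<in> \<Omega>"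
    then obtain I p u where \<omega>: "\<omega> = (I, p, u)" "tube_partition \<Gamma> I" "p \<in> path_families \<Gamma> I"
      by (auto simp: \<Omega>_def)
    have "signed_trees (graph_quotient \<Gamma> I) u \<in> Ham_dual (graph_quotient \<Gamma> I)"
      unfolding Ham_dual_eq_coherent[OF connected_graph_quotient[OF \<Gamma> \<omega>(2)]] by (rule signed_trees_coherent)
    moreover have "basis_vector (p G) \<in> Ham (induced \<Gamma> G)" if "G \<in> I" for G
      using \<omega>(3) that by (auto simp: path_families_iff Ham_def free_space_def basis_vector_def)
    ultimately show "t \<omega> \<in> fun_vs.span {pure_tensor I f g | I f g. tube_partition \<Gamma> I \<and>
        f \<in> Ham_dual (graph_quotient \<Gamma> I) \<and> (\<forall>G\<in>I. g G \<in> Ham (induced \<Gamma> G))}"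
      unfolding t_def \<omega>(1) prod.case
      by (intro fun_vs.span_scale fun_vs.span_base) (use \<omega>(2) in blast)
  qed
  finally show ?thesis .
qed

text \<open>Both properties hold for pure tensors and survive linear combinations. They are what is
  needed to read off coordinates: correct support, and dependence on \<open>T\<close> through its
  leaves only, up to sign.\<close>

lemma contraction_product_props:
  fixes x :: "'v::linorder set set \<times> 'v bintree \<times> ('v set \<Rightarrow> 'v list) \<Rightarrow> 'k::field"
  assumes \<Gamma>: "connected_graph \<Gamma>" and "x \<in> contraction_product Ham_dual Ham \<Gamma>"
  shows "(\<forall>I T p. \<not> koszul_index \<Gamma> I T p \<longrightarrow> x (I, T, p) = 0) \<and>
    (\<forall>I T T' p. koszul_index \<Gamma> I T p \<longrightarrow> koszul_index \<Gamma> I T' p \<longrightarrow> leaves T = leaves T' \<longrightarrow>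
       tree_sign T * x (I, T, p) = tree_sign T' * x (I, T', p))"
    (is "?P x \<and> ?Q x")
  using assms(2) unfolding contraction_product_def
proof (induction rule: fun_vs.span_induct_alt)
  case base
  show ?case by simp
next
  case (step a x y)
  then obtain J f g where x: "x = pure_tensor J f g" and J: "tube_partition \<Gamma> J"
    and f: "f \<in> coherent (graph_quotient \<Gamma> J)" and g: "\<forall>G\<in>J. g G \<in> Ham (induced \<Gamma> G)"
    using Ham_dual_eq_coherent connected_graph_quotient[OF \<Gamma>] by blast
  have fin: "finite J" using finite_tube_partitions(2)[OF connected_graphD(1)[OF \<Gamma>] J] .
  have P: "x (I, T, p) = 0" if "\<not> koszul_index \<Gamma> I T p" for I T p
  proof (rule ccontr)
    assume "x (I, T, p) \<noteq> 0"
    then have *: "I = J" "p \<in> extensional J" "f T \<noteq> 0" "(\<Prod>G\<in>J. g G (p G)) \<noteq> 0"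
      by (auto simp: x pure_tensor_def split: if_splits)
    have "p G \<in> ham_paths (induced \<Gamma> G)" if "G \<in> J" for G
    proof -
      have "g G (p G) \<noteq> 0" using *(4) that fin by (auto simp: prod_zero_iff)
      then show ?thesis using g that by (auto simp: Ham_def free_space_def)
    qed
    moreover have "admissible (graph_quotient \<Gamma> J) T" using *(3) coherent_support[OF f] by blast
    ultimately show False using that * J by (auto simp: koszul_index_def path_families_iff)
  qed
  have Q: "tree_sign T * x (I, T, p) = tree_sign T' * x (I, T', p)"
    if "koszul_index \<Gamma> I T p" "koszul_index \<Gamma> I T' p" "leaves T = leaves T'" for I T T' p
  proof (cases "I = J")
    case True
    then have "tree_sign T * f T = tree_sign T' * f T'"
      using that by (intro coherent_agree[OF f]) (auto simp: koszul_index_def)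
    then show ?thesis by (simp add: x pure_tensor_def flip: mult.assoc)
  qed (simp add: x pure_tensor_def)
  show ?case
  proof (intro conjI allI impI)
    fix I T p assume "\<not> koszul_index \<Gamma> I T p"
    then show "(fscale a x + y) (I, T, p) = 0" using P step.IH by (simp add: fscale_def)
  next
    fix I T T' p assume *: "koszul_index \<Gamma> I T p" "koszul_index \<Gamma> I T' p" "leaves T = leaves T'"
    have "tree_sign T * y (I, T, p) = tree_sign T' * y (I, T', p)" using step.IH * by blast
    then show "tree_sign T * (fscale a x + y) (I, T, p) = tree_sign T' * (fscale a x + y) (I, T', p)"
      using Q[OF *] by (simp add: fscale_def distrib_left mult.left_commute[of _ a])
  qed
qed

lemma contraction_product_eq_range:
  fixes \<Gamma> :: "'v::linorder graph"
  assumes \<Gamma>: "connected_graph \<Gamma>"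
  shows "contraction_product Ham_dual Ham \<Gamma> = range (koszul_element \<Gamma> :: _ \<Rightarrow> _ \<Rightarrow> 'k::field)"
proof (intro equalityI subsetI)
  note pg = connected_graphD(1)[OF \<Gamma>]
  fix x :: "'v set set \<times> 'v bintree \<times> ('v set \<Rightarrow> 'v list) \<Rightarrow> 'k"
  assume "x \<in> contraction_product Ham_dual Ham \<Gamma>"
  note x = contraction_product_props[OF \<Gamma> this]
  \<comment> \<open>Any tree with these leaves will do; by \<open>x\<close> the signed coefficient
    is the same for all of them.\<close>
  define T where "T ws = (SOME T. koszul_index \<Gamma> (blocks ws) T (block_path ws) \<and>
    leaves T = map (\<lambda>w. Min (set w)) ws)" for ws
  define y where "y ws = tree_sign (T ws) * x (blocks ws, T ws, block_path ws)" for ws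
  have "x i = koszul_element \<Gamma> y i" for i
  proof -
    obtain I S p where i: "i = (I, S, p)" by (cases i)
    show ?thesis
    proof (cases "koszul_index \<Gamma> I S p")
      case True
      let ?ws = "list_of I S p"
      note ws = koszul_index_list_of[OF pg True] block_path_list_of[OF pg True]
      have "koszul_index \<Gamma> (blocks ?ws) S (block_path ?ws) \<and> leaves S = map (\<lambda>w. Min (set w)) ?ws"
        using True by (simp add: ws)
      then have "koszul_index \<Gamma> I (T ?ws) p \<and> leaves (T ?ws) = leaves S"
        unfolding T_def by (rule someI2) (simp add: ws)
      then have "tree_sign S * x (I, S, p) = tree_sign (T ?ws) * x (I, T ?ws, p)"
        using x True by metis
      then have "x (I, S, p) = tree_sign S * y ?ws"
        unfolding y_def ws by (metis tree_sign_cancel)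
      then show ?thesis using True by (simp add: koszul_element_def i)
    qed (use x in \<open>auto simp: koszul_element_def i\<close>)
  qed
  then show "x \<in> range (koszul_element \<Gamma>)" by blast
qed (use koszul_element_in_product[OF \<Gamma>] in blast)

section \<open>The differential in coordinates\<close>

lemma tube_partition_merge:
  assumes "tube_partition \<Gamma> I" "A \<in> I" "B \<in> I" "tube \<Gamma> (A \<union> B)"
  shows "tube_partition \<Gamma> (insert (A \<union> B) (I - {A, B}))"
proof -
  have "\<Union> (insert (A \<union> B) (I - {A, B})) = pverts \<Gamma>"
    using tube_partitionD(1)[OF assms(1)] assms(2,3) by blast
  moreover have "disjoint (insert (A \<union> B) (I - {A, B}))"
    using tube_partition_disjoint[OF assms(1)] assms(2,3)
    by (intro disjointI) (auto; blast)
  ultimately show ?thesis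
    using tube_partitionD(3,4)[OF assms(1)] assms(4)
    by (auto simp: tube_partition_def partition_on_def tube_def)
qed

lemma pair_graph_eqI:
  assumes "pair_graph \<Gamma>" "pair_graph \<Delta>" "pverts \<Gamma> = pverts \<Delta>"
    "\<And>u v. u \<in> pverts \<Delta> \<Longrightarrow> v \<in> pverts \<Delta> \<Longrightarrow> (u, v) \<in> parcs \<Gamma> \<longleftrightarrow> (u, v) \<in> parcs \<Delta>"
  shows "\<Gamma> = (\<Delta> :: 'v graph)"
proof -
  have "(u, v) \<in> parcs \<Gamma> \<longleftrightarrow> (u, v) \<in> parcs \<Delta>" for u v
    using assms(3) assms(4)[of u v] arc_in_verts[OF assms(1), of u v] arc_in_verts[OF assms(2), of u v]
    by blast
  then have "parcs \<Gamma> = parcs \<Delta>" by auto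
  then show ?thesis using assms(3) by (cases \<Gamma>; cases \<Delta>) simp
qed

text \<open>Merging two blocks is contracting a two-vertex tube of the quotient. Since
  representatives are minima, the two graphs are equal and not just isomorphic, and trees pass
  between them without relabelling.\<close>

lemma contract_graph_quotient:
  fixes \<Gamma> :: "'v::linorder graph"
  assumes pg: "pair_graph \<Gamma>" and I: "tube_partition \<Gamma> I" and AB: "A \<in> I" "B \<in> I" "A \<noteq> B" "tube \<Gamma> (A \<union> B)"
  defines "J \<equiv> insert (A \<union> B) (I - {A, B})"
  shows "Min {Min A, Min B} = Min (A \<union> B)" "contract (graph_quotient \<Gamma> I) {Min A, Min B} = graph_quotient \<Gamma> J"
proof -
  have J: "tube_partition \<Gamma> J" unfolding J_def by (rule tube_partition_merge[OF I AB(1,2,4)])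
  have "finite A" "finite B" "A \<noteq> {}" "B \<noteq> {}"
    using tubeD[OF pg tube_partitionD(3)[OF I]] AB by blast+
  then show M: "Min {Min A, Min B} = Min (A \<union> B)" by (simp add: Min_Un)
  have inj: "Min G = Min H \<longleftrightarrow> G = H" if "G \<in> I" "H \<in> I" for G H
    using inj_onD[OF tube_partition_Min(2)[OF pg I]] that by blast
  note pgI = pair_graph_graph_quotient[OF pg I]
  show "contract (graph_quotient \<Gamma> I) {Min A, Min B} = graph_quotient \<Gamma> J"
  proof (rule pair_graph_eqI)
    show "pair_graph (contract (graph_quotient \<Gamma> I) {Min A, Min B})"
      by (rule pair_graph_contract[OF pgI]) auto
    show "pair_graph (graph_quotient \<Gamma> J)" by (rule pair_graph_graph_quotient[OF pg J])
    show "pverts (contract (graph_quotient \<Gamma> I) {Min A, Min B}) = pverts (graph_quotient \<Gamma> J)"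
      using inj AB by (auto simp: pverts_contract pverts_graph_quotient M J_def)
    fix u v assume "u \<in> pverts (graph_quotient \<Gamma> J)" "v \<in> pverts (graph_quotient \<Gamma> J)"
    then obtain G H where GH: "G \<in> J" "H \<in> J" "u = Min G" "v = Min H"
      by (auto simp: pverts_graph_quotient)
    have out: "Min K \<notin> {Min A, Min B}" if "K \<in> I - {A, B}" for K using inj that AB by auto
    have m: "Min (A \<union> B) \<in> {Min A, Min B}" by (simp flip: M add: min_def)
    note pc = parcs_contract[OF pgI, of "{Min A, Min B}", unfolded M, simplified]
    note qI = parcs_graph_quotient[OF pg I] and qJ = parcs_graph_quotient[OF pg J GH(1,2)]
    consider "G \<in> I - {A, B}" "H \<in> I - {A, B}" | "G = A \<union> B" "H \<in> I - {A, B}"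
      | "G \<in> I - {A, B}" "H = A \<union> B" | "G = A \<union> B" "H = A \<union> B"
      using GH(1,2) by (auto simp: J_def)
    then show "(u, v) \<in> parcs (contract (graph_quotient \<Gamma> I) {Min A, Min B}) \<longleftrightarrow> (u, v) \<in> parcs (graph_quotient \<Gamma> J)"
    proof cases
      case 1
      then have "(u, v) \<in> parcs (contract (graph_quotient \<Gamma> I) {Min A, Min B}) \<longleftrightarrow> (u, v) \<in> parcs (graph_quotient \<Gamma> I)"
        using out[of G] out[of H] m unfolding GH(3,4) pc by auto
      then show ?thesis using 1 qI[of G H] qJ by (simp add: GH)
    next
      case 2
      then have H: "H \<in> I" "A \<noteq> H" "B \<noteq> H" by auto
      have "G \<noteq> H" using tube_partition_disjoint[OF I AB(1) H(1,2)] tube_partitionD(4)[OF I AB(1)] 2(1) by blast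
      then have "(u, v) \<in> parcs (graph_quotient \<Gamma> J) \<longleftrightarrow> (\<exists>a\<in>A \<union> B. \<exists>b\<in>H. (a, b) \<in> parcs \<Gamma>)"
        using qJ unfolding GH(3,4) 2(1) by simp
      also have "\<dots> \<longleftrightarrow> (Min A, v) \<in> parcs (graph_quotient \<Gamma> I) \<or> (Min B, v) \<in> parcs (graph_quotient \<Gamma> I)"
        unfolding GH(4) qI[OF AB(1) H(1)] qI[OF AB(2) H(1)] using H(2,3) by blast
      also have "\<dots> \<longleftrightarrow> (u, v) \<in> parcs (contract (graph_quotient \<Gamma> I) {Min A, Min B})"
        using out[OF 2(2)] m unfolding GH(3,4) pc 2(1) by auto
      finally show ?thesis by simp
    next
      case 3
      then have G: "G \<in> I" "G \<noteq> A" "G \<noteq> B" by auto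
      have "G \<noteq> H" using tube_partition_disjoint[OF I G(1) AB(1) G(2)] tube_partitionD(4)[OF I AB(1)] 3(2) by blast
      then have "(u, v) \<in> parcs (graph_quotient \<Gamma> J) \<longleftrightarrow> (\<exists>a\<in>G. \<exists>b\<in>A \<union> B. (a, b) \<in> parcs \<Gamma>)"
        using qJ unfolding GH(3,4) 3(2) by simp
      also have "\<dots> \<longleftrightarrow> (u, Min A) \<in> parcs (graph_quotient \<Gamma> I) \<or> (u, Min B) \<in> parcs (graph_quotient \<Gamma> I)"
        unfolding GH(3) qI[OF G(1) AB(1)] qI[OF G(1) AB(2)] using G(2,3) by blast
      also have "\<dots> \<longleftrightarrow> (u, v) \<in> parcs (contract (graph_quotient \<Gamma> I) {Min A, Min B})"
        using out[OF 3(1)] m unfolding GH(3,4) pc 3(2) by auto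
      finally show ?thesis by simp
    next
      case 4
      then show ?thesis using m qJ unfolding GH(3,4) pc by auto
    qed
  qed
qed

text \<open>The first of the two compositions asks for an edge from \<open>Min A\<close> to
  \<open>hd w\<close> in the contracted graph. The edge from \<open>last v\<close> to
  \<open>hd w\<close> that the second one asks for implies it, so a single condition
  remains.\<close>

lemma generator_comp_eq:
  fixes \<Gamma> :: "'v::linorder graph"
  assumes pg: "pair_graph \<Gamma>" and AB: "A \<subseteq> pverts \<Gamma>" "B \<subseteq> pverts \<Gamma>" "A \<inter> B = {}"
    and v: "set v = A" "v \<noteq> []" and w: "set w = B" "w \<noteq> []"
  shows "generator_comp \<Gamma> A B v w = (if (last v, hd w) \<in> parcs \<Gamma> then Some (v @ w) else None)"
proof -
  define \<Delta> where "\<Delta> = induced \<Gamma> (A \<union> B)"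
  have fin: "finite A" "A \<noteq> {}" "finite B" "B \<noteq> {}" using v w by auto
  have mA: "Min A \<in> A" "Min B \<in> B" using fin by auto
  then have ne: "Min A \<noteq> Min B" using AB(3) by auto
  have pgD: "pair_graph \<Delta>" unfolding \<Delta>_def by (rule pair_graph_induced[OF pg])
  have lh: "last v \<in> A" "hd w \<in> B" using v w by auto
  have e1: "ham_comp (contract \<Delta> A) B [Min A, Min B] w =
    (if (Min A, hd w) \<in> parcs (contract \<Delta> A) then Some (Min A # w) else None)"
    using ne by (simp add: ham_comp_def)
  have e2: "ham_comp \<Delta> A (Min A # w) v = (if (last v, hd w) \<in> parcs \<Delta> then Some (v @ w) else None)"
    using w(2) by (simp add: ham_comp_def)
  have e3: "(last v, hd w) \<in> parcs \<Delta> \<longleftrightarrow> (last v, hd w) \<in> parcs \<Gamma>"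
    using lh by (auto simp: \<Delta>_def induced_simps)
  have "(Min A, hd w) \<in> parcs (contract \<Delta> A)" if "(last v, hd w) \<in> parcs \<Gamma>"
    using that e3 lh AB(3) unfolding parcs_contract[OF pgD fin(1,2)] by auto
  then show ?thesis
    unfolding generator_comp_def Let_def \<Delta>_def[symmetric] e1 by (auto simp: e2 e3)
qed

section \<open>Splitting one path of a list into two\<close>

definition split_entry :: "nat \<Rightarrow> nat \<Rightarrow> 'a list list \<Rightarrow> 'a list list" where
  "split_entry i j ws = take i ws @ [take j (ws ! i), drop j (ws ! i)] @ drop (Suc i) ws"

text \<open>On the lists with one fixed concatenation, each encoded by its set \<open>F\<close> of
  gaps inside blocks, this is the simplicial coboundary: \<open>y\<close> is evaluated at
  \<open>F\<close> with one gap removed. The sign counts the gaps outside \<open>F\<close> before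
  the removed one, which are as many as the blocks before block \<open>i\<close>.\<close>

definition splitting :: "('a list list \<Rightarrow> 'k) \<Rightarrow> 'a list list \<Rightarrow> 'k::comm_ring_1" where
  "splitting y ws = (\<Sum>i<length ws. \<Sum>j\<in>{1..<length (ws ! i)}. (-1) ^ i * y (split_entry i j ws))"

lemma splitting_Nil [simp]: "splitting y [] = 0"
  by (simp add: splitting_def)

lemma splitting_Cons:
  "splitting y (w # ws) = (\<Sum>j\<in>{1..<length w}. y (take j w # drop j w # ws)) - splitting (\<lambda>us. y (w # us)) ws"
proof -
  have "splitting y (w # ws) = (\<Sum>j\<in>{1..<length w}. y (split_entry 0 j (w # ws))) +
    (\<Sum>i<length ws. \<Sum>j\<in>{1..<length (ws ! i)}. (-1) ^ Suc i * y (split_entry (Suc i) j (w # ws)))"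
    unfolding splitting_def length_Cons sum.lessThan_Suc_shift by simp
  also have "(\<Sum>i<length ws. \<Sum>j\<in>{1..<length (ws ! i)}. (-1) ^ Suc i * y (split_entry (Suc i) j (w # ws))) =
    - splitting (\<lambda>us. y (w # us)) ws"
    unfolding splitting_def by (simp add: split_entry_def sum_negf)
  finally show ?thesis by (simp add: split_entry_def)
qed

lemma split_entry_props:
  assumes ws: "path_list \<Gamma> ws" and i: "i < length ws" and j: "0 < j" "j < length (ws ! i)"
  defines "a \<equiv> take j (ws ! i)" and "b \<equiv> drop j (ws ! i)"
  shows "path_list \<Gamma> (split_entry i j ws)" "a \<noteq> b" "set a \<noteq> set b" "a \<noteq> []" "b \<noteq> []" "a @ b = ws ! i"
    "(last a, hd b) \<in> parcs \<Gamma>" "a \<in> set (split_entry i j ws)" "b \<in> set (split_entry i j ws)"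
    "set (split_entry i j ws) = (set ws - {ws ! i}) \<union> {a, b}"
proof -
  have wsi: "ws = take i ws @ [ws ! i] @ drop (Suc i) ws" using i by (simp add: id_take_nth_drop[symmetric])
  show ab: "a @ b = ws ! i" by (simp add: a_def b_def)
  show ne: "a \<noteq> []" "b \<noteq> []" using j by (auto simp: a_def b_def)
  have sp: "split_entry i j ws = take i ws @ [a, b] @ drop (Suc i) ws" by (simp add: split_entry_def a_def b_def)
  have conc: "concat (split_entry i j ws) = concat ws"
    by (subst (2) wsi) (simp add: sp flip: ab)
  have wi: "ws ! i \<in> set ws" using i by simp
  have "distinct (a @ b)" using ws wi unfolding ab path_list_def distinct_concat_iff by blast
  then show d: "set a \<noteq> set b" using ne by (cases a) auto
  then show "a \<noteq> b" by auto
  have suc: "successively (\<lambda>u v. (u, v) \<in> parcs \<Gamma>) (a @ b)" using ws wi unfolding ab path_list_def by blast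
  then show "(last a, hd b) \<in> parcs \<Gamma>" using ne by (simp add: successively_append_iff)
  have "distinct ws" using path_list_distinct[OF ws] .
  then have "ws ! i \<notin> set (take i ws)" "ws ! i \<notin> set (drop (Suc i) ws)"
    by (subst (asm) wsi, simp)+
  then have "set ws - {ws ! i} = set (take i ws) \<union> set (drop (Suc i) ws)"
    by (subst wsi) auto
  then show S: "set (split_entry i j ws) = (set ws - {ws ! i}) \<union> {a, b}" by (auto simp: sp)
  then show "a \<in> set (split_entry i j ws)" "b \<in> set (split_entry i j ws)" by auto
  show "path_list \<Gamma> (split_entry i j ws)"
    using ws suc ne unfolding path_list_def conc S by (auto simp: successively_append_iff)
qed

lemma path_list_disjoint_entry:
  assumes "path_list \<Gamma> ws" "w \<in> set ws"
  shows "set ` (set ws - {w}) = blocks ws - {set w}"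
proof -
  have "inj_on set (set ws)"
    using path_list_distinct_sets[OF assms(1)] assms(1) unfolding path_list_def
    by (intro inj_onI) (metis Int_absorb set_empty)
  then show ?thesis using assms(2) by (simp add: blocks_def inj_on_image_set_diff[of set "set ws"])
qed

lemma blocks_split_entry:
  assumes ws: "path_list \<Gamma> ws" and i: "i < length ws" and j: "0 < j" "j < length (ws ! i)"
  defines "A \<equiv> set (take j (ws ! i))" and "B \<equiv> set (drop j (ws ! i))"
  shows "blocks (split_entry i j ws) = (blocks ws - {set (ws ! i)}) \<union> {A, B}" "set (ws ! i) = A \<union> B"
    "blocks ws = insert (A \<union> B) (blocks (split_entry i j ws) - {A, B})"
proof -
  note sp = split_entry_props[OF ws i j]
  show *: "blocks (split_entry i j ws) = (blocks ws - {set (ws ! i)}) \<union> {A, B}"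
    using path_list_disjoint_entry[OF ws, of "ws ! i"] i
    by (simp add: blocks_def[of "split_entry i j ws"] sp(10) A_def B_def image_Un)
  show AB: "set (ws ! i) = A \<union> B" using sp(6) by (metis A_def B_def set_append)
  have "A \<noteq> {}" "B \<noteq> {}" using sp(4,5) by (auto simp: A_def B_def)
  have "G \<noteq> A \<and> G \<noteq> B" if G: "G \<in> blocks ws - {set (ws ! i)}" for G
  proof -
    obtain w where "w \<in> set ws" "G = set w" "w \<noteq> ws ! i" using G by (auto simp: blocks_def)
    then have "G \<inter> (A \<union> B) = {}" using path_list_distinct_sets[OF ws, of w "ws ! i"] i unfolding AB[symmetric] by auto
    then show ?thesis using \<open>A \<noteq> {}\<close> \<open>B \<noteq> {}\<close> by blast
  qed
  moreover have "set (ws ! i) \<in> blocks ws" using i by (simp add: blocks_def)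
  ultimately show "blocks ws = insert (A \<union> B) (blocks (split_entry i j ws) - {A, B})"
    unfolding * AB by blast
qed


lemma leaves_graft_nth:
  assumes "distinct (leaves T)" "i < length (leaves T)"
  shows "leaves (graft T (leaves T ! i) S) = take i (leaves T) @ leaves S @ drop (Suc i) (leaves T)"
  using assms by (intro leaves_graft_append) (simp_all add: id_take_nth_drop[symmetric])

lemma entries_after_nth:
  assumes "distinct xs" "i < length xs"
  shows "entries_after (xs ! i) xs = length xs - Suc i"
proof -
  have xs: "xs = take i xs @ [xs ! i] @ drop (Suc i) xs" using assms(2) by (simp add: id_take_nth_drop[symmetric])
  have "xs ! i \<notin> set (take i xs)" using assms(1) by (subst (asm) xs) simp
  then have "entries_after (xs ! i) (take i xs @ [xs ! i] @ drop (Suc i) xs) = length xs - Suc i"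
    by (simp add: entries_after_append) (simp add: entries_after_def)
  then show ?thesis using xs by simp
qed

section \<open>Matching the summands of the differential with splittings\<close>

definition differential_term ::
  "'v::linorder graph \<Rightarrow> ('v set set \<times> 'v bintree \<times> ('v set \<Rightarrow> 'v list) \<Rightarrow> 'k::field) \<Rightarrow>
   'v set set \<Rightarrow> 'v bintree \<Rightarrow> ('v set \<Rightarrow> 'v list) \<Rightarrow> 'v set set \<Rightarrow> ('v set \<Rightarrow> 'v list) \<Rightarrow> 'v set \<Rightarrow> 'v set \<Rightarrow> 'k" where
  "differential_term \<Gamma> x J T' q I p A B =
     (case generator_comp \<Gamma> A B (p A) (p B) of None \<Rightarrow> 0
      | Some w \<Rightarrow>
          if J = insert (A \<union> B) (I - {A, B}) \<and> q = restrict (p(A \<union> B := w)) J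
          then (-1) ^ inner T' *
            infinitesimal_decomposition (graph_quotient \<Gamma> I) {Min A, Min B}
              (\<lambda>T. x (I, T, p)) (T', cherry (Min A) (Min B))
          else 0)"

definition differential_index :: "'v graph \<Rightarrow> 'v set set \<Rightarrow> ('v set \<Rightarrow> 'v list) \<Rightarrow> 'v set \<Rightarrow> 'v set \<Rightarrow> bool" where
  "differential_index \<Gamma> I p A B \<longleftrightarrow> tube_partition \<Gamma> I \<and> p \<in> path_families \<Gamma> I \<and>
     A \<in> I \<and> B \<in> I \<and> A \<noteq> B \<and> tube \<Gamma> (A \<union> B)"

text \<open>With the three nested sums flattened to one, its index set can be compared with the
  pairs of a block and a position at which to cut it.\<close>

lemma koszul_differential_eq_sum:
  fixes \<Gamma> :: "'v::linorder graph"
  assumes "pair_graph \<Gamma>"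
  shows "finite {(I, p, A, B). differential_index \<Gamma> I p A B}"
    "koszul_differential \<Gamma> x (J, T', q) =
      (\<Sum>(I, p, A, B) | differential_index \<Gamma> I p A B. differential_term \<Gamma> x J T' q I p A B)"
proof -
  define P where "P I = {(A, B). A \<in> I \<and> B \<in> I \<and> A \<noteq> B \<and> tube \<Gamma> (A \<union> B)}" for I
  define \<Omega> where "\<Omega> = (SIGMA I:{I. tube_partition \<Gamma> I}. SIGMA p:path_families \<Gamma> I. P I)"
  have \<Omega>: "{(I, p, A, B). differential_index \<Gamma> I p A B} = \<Omega>"
    by (auto simp: \<Omega>_def P_def differential_index_def)
  have finP: "finite (P I)" if "tube_partition \<Gamma> I" for I
  proof -
    have "P I \<subseteq> I \<times> I" by (auto simp: P_def)
    then show ?thesis by (rule finite_subset) (simp add: finite_tube_partitions(2)[OF assms that])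
  qed
  show "finite {(I, p, A, B). differential_index \<Gamma> I p A B}"
    unfolding \<Omega> \<Omega>_def using finite_tube_partitions[OF assms] finite_path_families[OF assms] finP
    by (intro finite_SigmaI) auto
  have "koszul_differential \<Gamma> x (J, T', q) = (\<Sum>I\<in>{I. tube_partition \<Gamma> I}. \<Sum>p\<in>path_families \<Gamma> I.
     \<Sum>(A, B)\<in>P I. differential_term \<Gamma> x J T' q I p A B)"
    unfolding koszul_differential_def P_def differential_term_def prod.case by (rule refl)
  also have "\<dots> = (\<Sum>I\<in>{I. tube_partition \<Gamma> I}. \<Sum>(p, A, B)\<in>Sigma (path_families \<Gamma> I) (\<lambda>_. P I).
     differential_term \<Gamma> x J T' q I p A B)"
    using finite_path_families[OF assms] finP by (intro sum.cong refl sum.Sigma) auto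
  also have "\<dots> = (\<Sum>(I, p, A, B)\<in>\<Omega>. differential_term \<Gamma> x J T' q I p A B)"
    unfolding \<Omega>_def using finite_tube_partitions(1)[OF assms] finite_path_families[OF assms] finP
    by (intro sum.Sigma ballI finite_SigmaI) auto
  finally show "koszul_differential \<Gamma> x (J, T', q) =
      (\<Sum>(I, p, A, B) | differential_index \<Gamma> I p A B. differential_term \<Gamma> x J T' q I p A B)"
    unfolding \<Omega> .
qed

lemma differential_index_disjoint:
  assumes "pair_graph \<Gamma>" "differential_index \<Gamma> I p A B"
  shows "A \<inter> B = {}" "set (p A) = A" "set (p B) = B" "p A \<noteq> []" "p B \<noteq> []" "A \<noteq> {}" "B \<noteq> {}"
    "generator_comp \<Gamma> A B (p A) (p B) = (if (last (p A), hd (p B)) \<in> parcs \<Gamma> then Some (p A @ p B) else None)"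
proof -
  have I: "tube_partition \<Gamma> I" "p \<in> path_families \<Gamma> I" and AB: "A \<in> I" "B \<in> I" "A \<noteq> B"
    using assms(2) by (auto simp: differential_index_def)
  show 1: "A \<inter> B = {}" by (rule tube_partition_disjoint[OF I(1) AB])
  show 2: "set (p A) = A" "set (p B) = B" "p A \<noteq> []" "p B \<noteq> []"
    using path_families_D[OF I AB(1)] path_families_D[OF I AB(2)] by auto
  show "A \<noteq> {}" "B \<noteq> {}" using tube_partitionD(4)[OF I(1)] AB by auto
  show "generator_comp \<Gamma> A B (p A) (p B) = (if (last (p A), hd (p B)) \<in> parcs \<Gamma> then Some (p A @ p B) else None)"
    by (rule generator_comp_eq[OF assms(1) tube_partitionD(5)[OF I(1) AB(1)] tube_partitionD(5)[OF I(1) AB(2)] 1 2(1,3,2,4)])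
qed

text \<open>This confines the differential to genuine indices: the edge makes
  \<open>p A @ p B\<close> a path, and the remaining tree is admissible for the quotient by the
  merged partition.\<close>

lemma differential_term_nonzero:
  fixes \<Gamma> :: "'v::linorder graph"
  assumes pg: "pair_graph \<Gamma>" and ind: "differential_index \<Gamma> I p A B"
    and nz: "differential_term \<Gamma> x J T' q I p A B \<noteq> 0"
  shows "(last (p A), hd (p B)) \<in> parcs \<Gamma>" "J = insert (A \<union> B) (I - {A, B})"
    "q = restrict (p(A \<union> B := p A @ p B)) J" "koszul_index \<Gamma> J T' q"
proof -
  note d = differential_index_disjoint[OF pg ind]
  have I: "tube_partition \<Gamma> I" "p \<in> path_families \<Gamma> I" and AB: "A \<in> I" "B \<in> I" "A \<noteq> B" "tube \<Gamma> (A \<union> B)"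
    using ind by (auto simp: differential_index_def)
  show 1: "(last (p A), hd (p B)) \<in> parcs \<Gamma>" "J = insert (A \<union> B) (I - {A, B})"
    "q = restrict (p(A \<union> B := p A @ p B)) J"
    using nz by (auto simp: differential_term_def d(8) split: if_splits)
  have "admissible (contract (graph_quotient \<Gamma> I) {Min A, Min B}) T'"
    using nz by (auto simp: differential_term_def d(8) infinitesimal_decomposition_def split: if_splits)
  then have T': "admissible (graph_quotient \<Gamma> J) T'"
    unfolding contract_graph_quotient(2)[OF pg I(1) AB] 1(2) .
  have J: "tube_partition \<Gamma> J" unfolding 1(2) by (rule tube_partition_merge[OF I(1) AB(1,2,4)])
  have "q G \<in> ham_paths (induced \<Gamma> G)" if G: "G \<in> J" for G
  proof (cases "G = A \<union> B")
    case True
    have "distinct (p A @ p B)" "successively (\<lambda>u v. (u, v) \<in> parcs \<Gamma>) (p A @ p B)"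
      using path_families_D[OF I AB(1)] path_families_D[OF I AB(2)] 1(1) d by (auto simp: successively_append_iff)
    moreover have "A \<union> B \<subseteq> pverts \<Gamma>" using AB(4) by (simp add: tube_def)
    ultimately show ?thesis using G d by (simp add: True ham_paths_induced 1(3))
  next
    case False
    then have "G \<in> I" using G 1(2) by auto
    then show ?thesis using I(2) G False by (simp add: 1(3) path_families_iff)
  qed
  then show "koszul_index \<Gamma> J T' q"
    using J T' by (simp add: koszul_index_def path_families_iff 1(3))
qed

text \<open>The Koszul sign of the decomposition cancels the preorder factor of
  \<open>tree_sign_graft\<close>. What remains is \<open>(-1) ^ (inner T' - i)\<close>, from the
  leaves after the one that is replaced by a cherry; together with the sign
  \<open>(-1) ^ inner T'\<close> of the desuspension this gives \<open>(-1) ^ i\<close>.\<close>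

lemma differential_term_split_entry:
  fixes \<Gamma> :: "'v::linorder graph"
  assumes pg: "pair_graph \<Gamma>" and JTq: "koszul_index \<Gamma> J T' q"
  defines "vs \<equiv> list_of J T' q"
  assumes i: "i < length vs" and j: "0 < j" "j < length (vs ! i)"
  defines "ws \<equiv> split_entry i j vs" and "A \<equiv> set (take j (vs ! i))" and "B \<equiv> set (drop j (vs ! i))"
  shows "differential_index \<Gamma> (blocks ws) (block_path ws) A B"
    "differential_term \<Gamma> (koszul_element \<Gamma> y) J T' q (blocks ws) (block_path ws) A B =
      (tree_sign T' * ((-1) ^ i * y ws) :: 'k::field)"
proof -
  note vs = koszul_index_list_of[OF pg JTq, folded vs_def] block_path_list_of[OF pg JTq, folded vs_def]
  note sp = split_entry_props[OF vs(3) i j, folded ws_def]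
  note bl = blocks_split_entry[OF vs(3) i j, folded ws_def A_def B_def]
  let ?I = "blocks ws" and ?p = "block_path ws"
  note I = path_list_index[OF pg sp(1)]
  have vi: "vs ! i \<in> set vs" using i by simp
  have pA: "?p A = take j (vs ! i)" and pB: "?p B = drop j (vs ! i)"
    unfolding A_def B_def by (rule block_path_eq[OF sp(1)], rule sp)+
  have AB: "A \<in> ?I" "B \<in> ?I" "A \<noteq> B" using sp(3) unfolding bl(1) A_def B_def by blast+
  have "set (vs ! i) \<in> J" using vs(1) vi by (auto simp: blocks_def)
  then have tAB: "tube \<Gamma> (A \<union> B)"
    using tube_partitionD(3)[of \<Gamma> J] JTq unfolding bl(2) by (simp add: koszul_index_def)
  show ind: "differential_index \<Gamma> ?I ?p A B"
    using I AB tAB by (simp add: differential_index_def)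
  note d = differential_index_disjoint[OF pg ind]
  have J: "J = insert (A \<union> B) (?I - {A, B})" by (rule bl(3)[unfolded vs(1)])
  have edge: "(last (?p A), hd (?p B)) \<in> parcs \<Gamma>" and AB_path: "?p A @ ?p B = vs ! i"
    using sp(6,7) by (simp_all add: pA pB)
  have q: "q = restrict (?p(A \<union> B := ?p A @ ?p B)) J"
  proof (rule extensionalityI[where A = J])
    show "q \<in> extensional J" using JTq by (simp add: koszul_index_def path_families_iff)
    fix G assume G: "G \<in> J"
    then obtain w where w: "w \<in> set vs" "G = set w" using vs(1) by (auto simp: blocks_def)
    have qw: "q G = w" using block_path_eq[OF vs(3) w(1)] by (simp add: w(2) vs(6))
    show "q G = restrict (?p(A \<union> B := ?p A @ ?p B)) J G"
    proof (cases "G = A \<union> B")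
      case True
      have "q G = vs ! i" using block_path_eq[OF vs(3) vi] unfolding True bl(2) vs(6) .
      then show ?thesis using G by (simp add: True AB_path)
    next
      case False
      then have "w \<noteq> vs ! i" using bl(2) w(2) by auto
      then have "w \<in> set ws" using w(1) by (simp add: sp(10))
      then have "?p G = w" using block_path_eq[OF sp(1)] w(2) by simp
      then show ?thesis using G False qw by simp
    qed
  qed simp
  define m where "m = Min (A \<union> B)"
  note cq = contract_graph_quotient[OF pg I(1) AB tAB, folded J m_def]
  have lT: "leaves T' = map (\<lambda>w. Min (set w)) vs" using vs(2) by simp
  have m: "m = leaves T' ! i" using i by (simp add: lT m_def bl(2))
  have T': "admissible (graph_quotient \<Gamma> J) T'" using JTq by (simp add: koszul_index_def)
  note dT' = admissible_leaves[OF T']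
  have il: "i < length (leaves T')" using i by (simp add: lT)
  note pgI = pair_graph_graph_quotient[OF pg I(1)]
  have E: "(Min A, Min B) \<in> parcs (graph_quotient \<Gamma> ?I)"
    unfolding parcs_graph_quotient[OF pg I(1) AB(1,2)]
    using AB(3) edge d(2-5) by (metis hd_in_set last_in_set)
  then have "Min A \<in> pverts (graph_quotient \<Gamma> ?I)" "Min B \<in> pverts (graph_quotient \<Gamma> ?I)"
    using arc_in_verts[OF pgI] by blast+
  then have "tube (graph_quotient \<Gamma> ?I) ({Min A} \<union> {Min B})"
    by (intro tube_union[OF pgI _ _ E]) (auto simp: tube_singleton[OF pgI])
  then have tI: "tube (graph_quotient \<Gamma> ?I) {Min A, Min B}" by (simp only: insert_is_Un[of "Min A" "{Min B}"])
  then have sub: "{Min A, Min B} \<subseteq> pverts (graph_quotient \<Gamma> ?I)" by (simp add: tube_def)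
  have neq: "Min A \<noteq> Min B" using E arc_irrefl[OF pgI] by metis
  have ch: "admissible (induced (graph_quotient \<Gamma> ?I) {Min A, Min B}) (cherry (Min A) (Min B))"
    using E neq sub by (simp add: admissible_iff[OF pair_graph_induced[OF pgI]] induced_simps insert_commute)
  have gr: "admissible (graph_quotient \<Gamma> ?I) (graft T' m (cherry (Min A) (Min B)))"
    using admissible_graft_iff[OF pgI tI ch dT'(1)] T' dT'(2) by (simp only: cq)
  have lgr: "leaves (graft T' m (cherry (Min A) (Min B))) = map (\<lambda>w. Min (set w)) ws"
    unfolding m leaves_graft_nth[OF dT'(1) il]
    by (simp add: lT ws_def split_entry_def A_def B_def take_map drop_map)
  have xval: "koszul_element \<Gamma> y (?I, graft T' m (cherry (Min A) (Min B)), ?p) =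
     tree_sign (graft T' m (cherry (Min A) (Min B))) * y ws"
    using I gr list_of_path_list[OF pg sp(1) lgr] by (simp add: koszul_element_def koszul_index_def)
  have ea: "entries_after m (leaves T') = inner T' - i"
    unfolding m entries_after_nth[OF dT'(1) il] by (simp flip: inner_conv_leaves)
  have sgn: "tree_sign (graft T' m (cherry (Min A) (Min B))) =
     (-1) ^ inner_after m T' * ((-1) ^ (inner T' - i) * tree_sign T' :: 'k)"
    using tree_sign_graft[OF dT'(1), of m "cherry (Min A) (Min B)"] il by (simp add: m ea[unfolded m])
  have "i \<le> inner T'" using il by (simp flip: inner_conv_leaves)
  then obtain k where "inner T' = i + k" using le_Suc_ex by blast
  then have pw: "(-1 :: 'k) ^ inner T' * (-1) ^ (inner T' - i) = (-1) ^ i"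
    by (simp add: power_add mult.assoc power_neg_one_sq)
  have "differential_term \<Gamma> (koszul_element \<Gamma> y) J T' q ?I ?p A B =
     (-1) ^ inner T' * ((-1) ^ inner_after m T' * koszul_element \<Gamma> y (?I, graft T' m (cherry (Min A) (Min B)), ?p))"
    using T' ch edge q J unfolding differential_term_def d(8) infinitesimal_decomposition_def
    by (simp add: cq)
  also have "\<dots> = (-1) ^ inner T' * (-1) ^ (inner T' - i) * (tree_sign T' * y ws)"
    by (simp add: xval sgn power_neg_one_cancel mult.assoc)
  also have "\<dots> = tree_sign T' * ((-1) ^ i * y ws)" unfolding pw by simp
  finally show "differential_term \<Gamma> (koszul_element \<Gamma> y) J T' q ?I ?p A B = tree_sign T' * ((-1) ^ i * y ws)" .
qed

text \<open>The cut is forced: \<open>i\<close> is the position of the path that \<open>q\<close>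
  assigns to \<open>A \<union> B\<close>, and \<open>j\<close> is the length of
  \<open>p A\<close>.\<close>

lemma differential_term_nonzero_split_entry:
  fixes \<Gamma> :: "'v::linorder graph"
  assumes pg: "pair_graph \<Gamma>" and ind: "differential_index \<Gamma> I p A B"
    and nz: "differential_term \<Gamma> x J T' q I p A B \<noteq> 0"
  defines "vs \<equiv> list_of J T' q"
  shows "\<exists>i<length vs. \<exists>j\<in>{1..<length (vs ! i)}. I = blocks (split_entry i j vs) \<and> p = block_path (split_entry i j vs) \<and>
    A = set (take j (vs ! i)) \<and> B = set (drop j (vs ! i))"
proof -
  note nzD = differential_term_nonzero[OF pg ind nz] and d = differential_index_disjoint[OF pg ind]
  note vs = koszul_index_list_of[OF pg nzD(4), folded vs_def] block_path_list_of[OF pg nzD(4), folded vs_def]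
  have I: "tube_partition \<Gamma> I" "p \<in> path_families \<Gamma> I" and AB: "A \<in> I" "B \<in> I" "A \<noteq> B"
    using ind by (auto simp: differential_index_def)
  have qAB: "q (A \<union> B) = p A @ p B" "A \<union> B \<in> J" by (simp_all add: nzD(2,3))
  then have "p A @ p B \<in> set vs" unfolding vs(4) by force
  then obtain i where i: "i < length vs" "vs ! i = p A @ p B" by (metis in_set_conv_nth)
  define j where "j = length (p A)"
  have j: "j \<in> {1..<length (vs ! i)}" using d(4,5) by (simp add: j_def i(2) Suc_le_eq)
  then have j': "0 < j" "j < length (vs ! i)" by auto
  have tk: "take j (vs ! i) = p A" "drop j (vs ! i) = p B" by (simp_all add: i(2) j_def)
  note sp = split_entry_props[OF vs(3) i(1) j', unfolded tk]
  note bl = blocks_split_entry[OF vs(3) i(1) j', unfolded tk d(2,3)]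
  \<comment> \<open>The merged block is new, so removing it from \<open>J\<close> and putting back
    \<open>A\<close> and \<open>B\<close> recovers \<open>I\<close>.\<close>
  have "A \<union> B \<notin> I - {A, B}"
  proof
    assume *: "A \<union> B \<in> I - {A, B}"
    then have "(A \<union> B) \<inter> A = {}" using tube_partition_disjoint[OF I(1) _ AB(1), of "A \<union> B"] by blast
    then show False using d(6) by blast
  qed
  then have Ieq: "I = blocks (split_entry i j vs)" unfolding bl(1,2) vs(1) nzD(2) using AB by blast
  have "p = block_path (split_entry i j vs)"
  proof (rule extensionalityI[where A = I])
    show "p \<in> extensional I" using I(2) by (simp add: path_families_iff)
    show "block_path (split_entry i j vs) \<in> extensional I" by (simp add: Ieq block_path_def)
    fix G assume G: "G \<in> I"
    have "p G \<in> set (split_entry i j vs)"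
    proof (cases "G = A \<or> G = B")
      case False
      then have "G \<in> J" "G \<noteq> A \<union> B" using G nzD(2) \<open>A \<union> B \<notin> I - {A, B}\<close> by auto
      then have "q G = p G" by (simp add: nzD(3))
      then have "p G \<in> set vs" using vs(4) \<open>G \<in> J\<close> by force
      moreover have "p G \<noteq> vs ! i"
        using path_families_D(2)[OF I G] \<open>G \<noteq> A \<union> B\<close> bl(2) by auto
      ultimately show ?thesis by (simp add: sp(10))
    qed (use sp(8,9) in auto)
    then show "p G = block_path (split_entry i j vs) G"
      using block_path_eq[OF sp(1)] path_families_D(2)[OF I G] by metis
  qed
  moreover have "A = set (take j (vs ! i))" "B = set (drop j (vs ! i))" by (simp_all add: tk d(2,3))
  ultimately show ?thesis using i(1) j Ieq by (intro exI[of _ i] conjI bexI[of _ j])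
qed

text \<open>The flattened sum reduces to the image of \<open>\<phi>\<close>, which sends each cut of
  an entry of \<open>vs\<close> to the summand it produces; outside this image all summands
  vanish.\<close>

lemma koszul_differential_element:
  fixes \<Gamma> :: "'v::linorder graph" and y :: "'v list list \<Rightarrow> 'k::field"
  assumes pg: "pair_graph \<Gamma>"
  shows "koszul_differential \<Gamma> (koszul_element \<Gamma> y) = koszul_element \<Gamma> (splitting y)"
proof
  fix z :: "'v set set \<times> 'v bintree \<times> ('v set \<Rightarrow> 'v list)"
  obtain J T' q where z: "z = (J, T', q)" by (cases z)
  define \<Omega> where "\<Omega> = {(I, p, A, B). differential_index \<Gamma> I p A B}"
  define t where "t = (\<lambda>(I, p, A, B). differential_term \<Gamma> (koszul_element \<Gamma> y) J T' q I p A B)"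
  note sum = koszul_differential_eq_sum[OF pg, folded \<Omega>_def]
  have d: "koszul_differential \<Gamma> (koszul_element \<Gamma> y) z = sum t \<Omega>"
    by (simp add: z sum(2) t_def)
  show "koszul_differential \<Gamma> (koszul_element \<Gamma> y) z = koszul_element \<Gamma> (splitting y) z"
  proof (cases "koszul_index \<Gamma> J T' q")
    case False
    have "sum t \<Omega> = 0"
    proof (rule sum.neutral, clarify)
      fix I p A B assume "(I, p, A, B) \<in> \<Omega>"
      then have "differential_index \<Gamma> I p A B" by (simp add: \<Omega>_def)
      then show "t (I, p, A, B) = 0"
        using differential_term_nonzero(4)[OF pg] False unfolding t_def prod.case by blast
    qed
    then show ?thesis unfolding d using False by (simp add: z koszul_element_def)
  next
    case True
    define vs where "vs = list_of J T' q"
    note vs = koszul_index_list_of[OF pg True, folded vs_def]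
    define X where "X = (SIGMA i:{..<length vs}. {1..<length (vs ! i)})"
    define \<phi> where "\<phi> = (\<lambda>(i, j). (blocks (split_entry i j vs), block_path (split_entry i j vs),
       set (take j (vs ! i)), set (drop j (vs ! i))))"
    \<comment> \<open>The set \<open>A\<close> alone determines the cut: it meets exactly one entry
      of \<open>vs\<close>, and its cardinality is \<open>j\<close>.\<close>
    have inj: "inj_on \<phi> X"
    proof (rule inj_onI, clarify)
      fix i j i' j' assume a: "(i, j) \<in> X" "(i', j') \<in> X" "\<phi> (i, j) = \<phi> (i', j')"
      have e: "set (take j (vs ! i)) = set (take j' (vs ! i'))" using a(3) by (simp add: \<phi>_def)
      have ij: "i < length vs" "0 < j" "j < length (vs ! i)" "i' < length vs" "0 < j'" "j' < length (vs ! i')"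
        using a(1,2) by (auto simp: X_def)
      have "take j (vs ! i) \<noteq> []" using ij by auto
      then obtain v where v: "v \<in> set (take j (vs ! i))" by (meson hd_in_set)
      then have "v \<in> set (take j' (vs ! i'))" unfolding e .
      then have "set (vs ! i) \<inter> set (vs ! i') \<noteq> {}" using v by (auto dest: in_set_takeD)
      then have "vs ! i = vs ! i'" using path_list_distinct_sets[OF vs(3)] ij by simp
      then have "i = i'" using path_list_distinct[OF vs(3)] ij nth_eq_iff_index_eq by blast
      have "distinct (vs ! i)" using vs(3) ij(1) unfolding path_list_def distinct_concat_iff by simp
      then have "card (set (take j (vs ! i))) = j" "card (set (take j' (vs ! i'))) = j'"
        using ij \<open>i = i'\<close> by (simp_all add: distinct_card)
      then show "i = i' \<and> j = j'" using \<open>i = i'\<close> unfolding e by metis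
    qed
    have im: "\<phi> ` X \<subseteq> \<Omega>"
      using differential_term_split_entry(1)[OF pg True, folded vs_def]
      by (auto simp: \<Omega>_def \<phi>_def X_def)
    have out: "t \<omega> = 0" if "\<omega> \<in> \<Omega> - \<phi> ` X" for \<omega>
    proof (rule ccontr)
      assume nz: "t \<omega> \<noteq> 0"
      obtain I p A B where \<omega>: "\<omega> = (I, p, A, B)" by (cases \<omega>)
      have di: "differential_index \<Gamma> I p A B" using that by (simp add: \<Omega>_def \<omega>)
      have "differential_term \<Gamma> (koszul_element \<Gamma> y) J T' q I p A B \<noteq> 0"
        using nz unfolding \<omega> t_def prod.case .
      from differential_term_nonzero_split_entry[OF pg di this, folded vs_def]
      obtain i j where ij: "i < length vs" "j \<in> {1..<length (vs ! i)}"
        "I = blocks (split_entry i j vs)" "p = block_path (split_entry i j vs)"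
        "A = set (take j (vs ! i))" "B = set (drop j (vs ! i))"
        by (elim exE conjE bexE)
      have "\<omega> = \<phi> (i, j)" unfolding \<omega> \<phi>_def prod.case ij(3-6) by (rule refl)
      moreover have "(i, j) \<in> X" using ij(1,2) by (simp add: X_def)
      ultimately show False using that by blast
    qed
    have "sum t \<Omega> = sum t (\<phi> ` X)"
      by (rule sum.mono_neutral_right[OF sum(1) im]) (blast intro: out)
    also have "\<dots> = (\<Sum>(i, j)\<in>X. t (\<phi> (i, j)))"
      by (simp add: sum.reindex[OF inj] case_prod_unfold)
    also have "\<dots> = (\<Sum>(i, j)\<in>X. tree_sign T' * ((-1) ^ i * y (split_entry i j vs)))"
      by (rule sum.cong[OF refl])
        (use differential_term_split_entry(2)[OF pg True, folded vs_def] in \<open>auto simp: X_def t_def \<phi>_def Suc_le_eq\<close>)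
    also have "\<dots> = tree_sign T' * splitting y vs"
      unfolding X_def splitting_def sum_distrib_left by (simp add: sum.Sigma)
    finally show ?thesis unfolding d using True by (simp add: z koszul_element_def vs_def)
  qed
qed

lemma distinct_set_singleton:
  assumes "distinct w" "set w = {v}"
  shows "w = [v]"
proof (cases w)
  case (Cons x xs)
  then have "x = v" "set xs \<subseteq> {v}" "v \<notin> set xs" using assms by auto
  then have "set xs = {}" using subset_singletonD by fastforce
  then show ?thesis using Cons \<open>x = v\<close> by simp
qed (use assms in simp)

section \<open>Formal properties of the splitting operator\<close>

lemma concat_split_entry:
  assumes "i < length ws" "j < length (ws ! i)"
  shows "concat (split_entry i j ws) = concat ws" "length (split_entry i j ws) = Suc (length ws)"
    "0 < j \<Longrightarrow> [] \<notin> set ws \<Longrightarrow> [] \<notin> set (split_entry i j ws)"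
proof -
  have ws: "ws = take i ws @ [ws ! i] @ drop (Suc i) ws" using assms(1) by (simp add: id_take_nth_drop[symmetric])
  have "concat ws = concat (take i ws @ [ws ! i] @ drop (Suc i) ws)" using ws by simp
  then show "concat (split_entry i j ws) = concat ws" by (simp add: split_entry_def)
  show "length (split_entry i j ws) = Suc (length ws)" using assms(1) by (simp add: split_entry_def)
  assume "0 < j" "[] \<notin> set ws"
  then show "[] \<notin> set (split_entry i j ws)"
    using assms by (auto simp: split_entry_def dest: in_set_takeD in_set_dropD)
qed

lemma splitting_cong:
  assumes "[] \<notin> set ws"
    "\<And>vs. concat vs = concat ws \<Longrightarrow> [] \<notin> set vs \<Longrightarrow> length vs = Suc (length ws) \<Longrightarrow> y vs = y' vs"
  shows "splitting y ws = splitting y' ws"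
proof -
  have "y (split_entry i j ws) = y' (split_entry i j ws)" if "i < length ws" "j \<in> {1..<length (ws ! i)}" for i j
    using that by (intro assms(2) concat_split_entry assms(1)) auto
  then show ?thesis unfolding splitting_def by (intro sum.cong refl arg_cong2[where f = "(*)"]) auto
qed

lemma splitting_length:
  assumes "\<And>vs. length vs = Suc (length ws) \<Longrightarrow> y vs = 0"
  shows "splitting y ws = 0"
  unfolding splitting_def by (intro sum.neutral ballI) (simp add: assms concat_split_entry)

lemma splitting_diff: "splitting (\<lambda>us. f us - g us) ws = splitting f ws - splitting g ws"
  by (simp add: splitting_def sum_subtractf right_diff_distrib)

lemma splitting_zero: "splitting (\<lambda>us. 0) ws = 0"
  by (simp add: splitting_def)

lemma splitting_uminus: "splitting (\<lambda>us. - f us) ws = - splitting f ws"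
  using splitting_diff[of "\<lambda>_. 0" f ws] by (simp add: splitting_zero)

lemma splitting_sum: "splitting (\<lambda>us. \<Sum>j\<in>A. f j us) ws = (\<Sum>j\<in>A. splitting (f j) ws)"
proof (induction A rule: infinite_finite_induct)
  case (insert j A)
  have "splitting (\<lambda>us. f j us + (\<Sum>j\<in>A. f j us)) ws = splitting (f j) ws + splitting (\<lambda>us. \<Sum>j\<in>A. f j us) ws"
    by (simp add: splitting_def sum.distrib distrib_left)
  then show ?case using insert by simp
qed (simp_all add: splitting_zero)

text \<open>Two cuts of the first block can be made in either order. If the left one is made first,
  the right one then hits the second block, so the signs are opposite. A cut of the first block also
  moves later blocks by one place, hence mixed terms cancel too; two cuts further right are covered
  by induction.\<close>

lemma splitting_splitting: "splitting (splitting y) ws = 0"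
proof (induction ws arbitrary: y)
  case (Cons w ws)
  let ?n = "length w"
  define F where "F a b = y (take a w # drop a (take b w) # drop b w # ws)" for a b
  have first: "splitting y (take j w # drop j w # ws) =
      (\<Sum>i\<in>{1..<j}. F i j) - (\<Sum>i\<in>{1..<?n - j}. F j (j + i)) + splitting (\<lambda>us. y (take j w # drop j w # us)) ws"
    if "j \<in> {1..<?n}" for j
  proof -
    have "(\<Sum>i\<in>{1..<length (take j w)}. y (take i (take j w) # drop i (take j w) # drop j w # ws)) = (\<Sum>i\<in>{1..<j}. F i j)"
      using that by (intro sum.cong) (auto simp: F_def min_def)
    moreover have "(\<Sum>i\<in>{1..<length (drop j w)}. y (take j w # take i (drop j w) # drop i (drop j w) # ws)) =
        (\<Sum>i\<in>{1..<?n - j}. F j (j + i))"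
      by (intro sum.cong) (auto simp: F_def take_drop add.commute)
    ultimately show ?thesis by (simp add: splitting_Cons)
  qed
  have "(\<Sum>j\<in>{1..<?n}. \<Sum>i\<in>{1..<j}. F i j) = (\<Sum>(j, i)\<in>(SIGMA j:{1..<?n}. {1..<j}). F i j)"
    by (simp add: sum.Sigma)
  also have "\<dots> = (\<Sum>(j, i)\<in>(SIGMA j:{1..<?n}. {1..<?n - j}). F j (j + i))"
    by (rule sum.reindex_bij_witness[of _ "\<lambda>(a, c). (a + c, a)" "\<lambda>(j, i). (i, j - i)"]) auto
  also have "\<dots> = (\<Sum>j\<in>{1..<?n}. \<Sum>i\<in>{1..<?n - j}. F j (j + i))"
    by (simp add: sum.Sigma)
  finally have cancel: "(\<Sum>j\<in>{1..<?n}. \<Sum>i\<in>{1..<j}. F i j) = (\<Sum>j\<in>{1..<?n}. \<Sum>i\<in>{1..<?n - j}. F j (j + i))" .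
  have "splitting (splitting y) (w # ws) =
     (\<Sum>j\<in>{1..<?n}. splitting y (take j w # drop j w # ws)) - splitting (\<lambda>us. splitting y (w # us)) ws"
    by (rule splitting_Cons)
  also have "(\<Sum>j\<in>{1..<?n}. splitting y (take j w # drop j w # ws)) =
     (\<Sum>j\<in>{1..<?n}. splitting (\<lambda>us. y (take j w # drop j w # us)) ws)"
  proof -
    have "(\<Sum>j\<in>{1..<?n}. splitting y (take j w # drop j w # ws)) =
      (\<Sum>j\<in>{1..<?n}. (\<Sum>i\<in>{1..<j}. F i j) - (\<Sum>i\<in>{1..<?n - j}. F j (j + i)) +
        splitting (\<lambda>us. y (take j w # drop j w # us)) ws)"
      by (intro sum.cong refl first)
    then show ?thesis unfolding sum.distrib sum_subtractf cancel by simp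
  qed
  also have "splitting (\<lambda>us. splitting y (w # us)) ws =
     (\<Sum>j\<in>{1..<?n}. splitting (\<lambda>us. y (take j w # drop j w # us)) ws)"
    unfolding splitting_Cons[of y] splitting_diff splitting_sum Cons.IH by simp
  finally show ?case by simp
qed simp


section \<open>The contracting homotopy\<close>

text \<open>The homotopy contracts the first pair of consecutive vertices that is an edge, unless it
  already lies in a block; all earlier blocks are then singletons.\<close>

fun joining :: "('v \<times> 'v) set \<Rightarrow> ('v list list \<Rightarrow> 'k::comm_ring_1) \<Rightarrow> 'v list list \<Rightarrow> 'k" where
  "joining E y ([a] # (b # w) # ws) =
     (if (a, b) \<in> E then y ((a # b # w) # ws) else - joining E (\<lambda>vs. y ([a] # vs)) ((b # w) # ws))"
| "joining E y _ = 0"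

lemma joining_uminus: "joining E (\<lambda>vs. - f vs) ws = - joining E f ws"
  by (induction E f ws rule: joining.induct) auto

text \<open>\<open>joining\<close> reads \<open>y\<close> at most once, at a list obtained by
  prepending a singleton block to the next block along an edge. Only the values at such lists have
  to be controlled.\<close>

lemma joining_eq_0:
  assumes "\<And>us a b w vs. ws = us @ [a] # (b # w) # vs \<Longrightarrow> (a, b) \<in> E \<Longrightarrow> y (us @ (a # b # w) # vs) = 0"
  shows "joining E y ws = 0"
  using assms
proof (induction E y ws rule: joining.induct)
  case (1 E y a b w ws)
  have "joining E (\<lambda>vs. y ([a] # vs)) ((b # w) # ws) = 0" if "(a, b) \<notin> E"
  proof (rule "1.IH"[OF that])
    fix us c d v vs assume "(b # w) # ws = us @ [c] # (d # v) # vs" "(c, d) \<in> E"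
    then show "y ([a] # us @ (c # d # v) # vs) = 0" using "1.prems"[of "[a] # us" c d v vs] by simp
  qed
  moreover have "y ((a # b # w) # ws) = 0" if "(a, b) \<in> E" using "1.prems"[of "[]" a b w ws] that by simp
  ultimately show ?case by simp
qed auto

text \<open>The recursion passes over leading singletons until it meets the first edge of the
  concatenation, which the last hypothesis guarantees. That edge lies inside a block or between two
  blocks, and accordingly \<open>y ws\<close> is produced by joining after a cut or by cutting after
  a join.\<close>

lemma splitting_joining:
  assumes "[] \<notin> set ws" "\<And>w. w \<in> set ws \<Longrightarrow> successively (\<lambda>a b. (a, b) \<in> E) w"
    "\<not> successively (\<lambda>a b. (a, b) \<notin> E) (concat ws)"
  shows "splitting (joining E y) ws + joining E (splitting y) ws = y ws"
  using assms
proof (induction ws arbitrary: y)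
  case (Cons w ws)
  obtain a w' where w: "w = a # w'" using Cons.prems(1) by (cases w) auto
  show ?case
  proof (cases w')
    case w': (Cons a' w'')
    \<comment> \<open>The first edge lies inside \<open>w\<close>. After a cut of another block, or
      of \<open>w\<close> beyond its first vertex, the first block is still not a singleton and
      \<open>joining\<close> gives zero. Only the cut right after \<open>a\<close> is undone by
      it.\<close>
    have "splitting (\<lambda>us. joining E y (w # us)) ws = 0" by (simp add: w w' splitting_zero)
    moreover have "(\<Sum>j\<in>{1..<length w}. joining E y (take j w # drop j w # ws)) = y (w # ws)"
    proof -
      have "(a, a') \<in> E" using Cons.prems(2)[of w] by (simp add: w w')
      have "joining E y (take j w # drop j w # ws) = 0" if "j \<in> {2..<length w}" for j
      proof -
        obtain k where "j = Suc (Suc k)" using \<open>j \<in> _\<close> by (metis atLeastLessThan_iff numeral_2_eq_2 Suc_le_D Suc_le_mono)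
        then show ?thesis by (simp add: w w')
      qed
      then have "(\<Sum>j\<in>{2..<length w}. joining E y (take j w # drop j w # ws)) = 0" by (rule sum.neutral[OF ballI])
      moreover have "{1..<length w} = insert 1 {2..<length w}" by (auto simp: w w')
      ultimately show ?thesis using \<open>(a, a') \<in> E\<close> by (simp add: w w')
    qed
    ultimately show ?thesis by (simp add: splitting_Cons) (simp add: w w')
  next
    case Nil
    then have wa: "w = [a]" using w by simp
    obtain v ws' where ws: "ws = v # ws'" using Cons.prems(3) by (cases ws) (auto simp: wa)
    obtain b v' where v: "v = b # v'" using Cons.prems(1) by (cases v) (auto simp: ws)
    have ne: "[] \<notin> set (v # ws')" using Cons.prems(1) by (simp add: ws)
    let ?y = "\<lambda>us. y ([a] # us)"
    have sj: "splitting (joining E y) (w # ws) = - splitting (\<lambda>us. joining E y ([a] # us)) (v # ws')"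
      by (simp add: splitting_Cons wa ws)
    have js: "joining E (splitting y) (w # ws) = (if (a, b) \<in> E then splitting y ((a # v) # ws')
        else joining E (splitting ?y) (v # ws'))"
    proof -
      have "splitting y ([a] # us) = - splitting ?y us" for us by (simp add: splitting_Cons)
      then show ?thesis by (simp add: wa ws v joining_uminus)
    qed
    show ?thesis
    proof (cases "(a, b) \<in> E")
      case True
      \<comment> \<open>The first edge runs from \<open>a\<close> to \<open>v\<close>. Among the
        terms of \<open>splitting y ((a # v) # ws')\<close>, the cut right after \<open>a\<close>
        gives back \<open>y ws\<close>; each other term occurs in \<open>sj\<close> with the
        opposite sign.\<close>
      let ?n = "length v"
      have "splitting (\<lambda>us. joining E y ([a] # us)) (v # ws') =
        (\<Sum>j\<in>{1..<?n}. joining E y ([a] # take j v # drop j v # ws')) - splitting (\<lambda>us. joining E y ([a] # v # us)) ws'"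
        by (rule splitting_Cons)
      also have "(\<Sum>j\<in>{1..<?n}. joining E y ([a] # take j v # drop j v # ws')) =
        (\<Sum>j\<in>{1..<?n}. y ((a # take j v) # drop j v # ws'))"
      proof (rule sum.cong[OF refl])
        fix j assume "j \<in> {1..<?n}"
        then obtain k where "j = Suc k" by (cases j) auto
        then show "joining E y ([a] # take j v # drop j v # ws') = y ((a # take j v) # drop j v # ws')"
          using True by (simp add: v)
      qed
      also have "splitting (\<lambda>us. joining E y ([a] # v # us)) ws' = splitting (\<lambda>us. y ((a # v) # us)) ws'"
        using True by (simp add: v)
      finally have l: "splitting (\<lambda>us. joining E y ([a] # us)) (v # ws') =
        (\<Sum>j\<in>{1..<?n}. y ((a # take j v) # drop j v # ws')) - splitting (\<lambda>us. y ((a # v) # us)) ws'" .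
      define g where "g j = y (take j (a # v) # drop j (a # v) # ws')" for j
      have "sum g {1..<length (a # v)} = g 1 + (\<Sum>j\<in>{1..<?n}. g (Suc j))"
        using sum.atLeast_Suc_lessThan[of 1 "length (a # v)" g] sum.shift_bounds_Suc_ivl[of g 1 ?n]
        by (simp add: v)
      then have "(\<Sum>j\<in>{1..<length (a # v)}. y (take j (a # v) # drop j (a # v) # ws')) =
        y ([a] # v # ws') + (\<Sum>j\<in>{1..<?n}. y ((a # take j v) # drop j v # ws'))"
        by (simp add: g_def)
      then have "splitting y ((a # v) # ws') = y ([a] # v # ws') + splitting (\<lambda>us. joining E y ([a] # us)) (v # ws')"
        unfolding l splitting_Cons[of y] by simp
      then show ?thesis unfolding sj js using True by (simp add: wa ws)
    next
      case False
      \<comment> \<open>Every refinement of \<open>v # ws'\<close> still begins with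
        \<open>b\<close>, so \<open>joining\<close> passes over \<open>[a]\<close> in all of them.
        Its sign for doing so matches the sign that a prepended block causes in
        \<open>splitting\<close>.\<close>
      have "splitting (\<lambda>us. joining E y ([a] # us)) (v # ws') = splitting (\<lambda>us. - joining E ?y us) (v # ws')"
      proof (rule splitting_cong[OF ne])
        fix vs assume "concat vs = concat (v # ws')" "[] \<notin> set vs"
        then obtain u vs' where "vs = (b # u) # vs'" by (cases vs; cases "hd vs") (auto simp: v)
        then show "joining E y ([a] # vs) = - joining E ?y vs" using False by simp
      qed
      moreover have "splitting (joining E ?y) (v # ws') + joining E (splitting ?y) (v # ws') = ?y (v # ws')"
      proof (rule Cons.IH[unfolded ws])
        show "\<not> successively (\<lambda>a b. (a, b) \<notin> E) (concat (v # ws'))"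
          using Cons.prems(3) False by (simp add: wa ws v)
      qed (use Cons.prems in \<open>auto simp: ws\<close>)
      ultimately show ?thesis unfolding sj js using False by (simp add: splitting_uminus wa ws)
    qed
  qed
qed simp

text \<open>By \<open>ex_cherry_tree\<close> the representatives of the two joined blocks may be
  assumed to form a cherry; cutting it off leaves an admissible tree for the coarser quotient. Thus
  the homotopy reads coordinates only where the element determines them.\<close>

lemma path_list_join:
  assumes pg: "pair_graph \<Gamma>" and ws: "path_list \<Gamma> ws" "ws = us @ [a] # (b # w) # vs" and ab: "(a, b) \<in> parcs \<Gamma>"
    and T: "admissible (graph_quotient \<Gamma> (blocks ws)) T" "leaves T = map (\<lambda>w. Min (set w)) ws"
  defines "ws' \<equiv> us @ (a # b # w) # vs"
  shows "path_list \<Gamma> ws'"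
    "\<exists>T'. admissible (graph_quotient \<Gamma> (blocks ws')) T' \<and> leaves T' = map (\<lambda>w. Min (set w)) ws'"
proof -
  show ws': "path_list \<Gamma> ws'"
    using ws(1) ab unfolding path_list_def ws(2) ws'_def by (auto simp: insert_commute)
  let ?i = "length us"
  \<comment> \<open>Joining is undone by splitting off the first vertex again, which makes the facts
    about \<open>split_entry\<close> applicable.\<close>
  have split: "ws = split_entry ?i 1 ws'" "?i < length ws'" "1 < length (ws' ! ?i)"
    by (simp_all add: ws(2) ws'_def split_entry_def)
  define A where "A = {a}"
  define B where "B = set (b # w)"
  have bl: "blocks ws' = insert (A \<union> B) (blocks ws - {A, B})"
    using blocks_split_entry(3)[OF ws' split(2) _ split(3)] split(1) by (simp add: ws'_def A_def B_def)
  note I = path_list_index(1)[OF pg ws(1)]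
  have AB: "A \<in> blocks ws" "B \<in> blocks ws" by (auto simp: ws(2) blocks_def A_def B_def)
  have neq: "A \<noteq> B"
    using ws(1) unfolding path_list_def ws(2) A_def B_def by auto
  have "A \<union> B \<in> blocks ws'" unfolding bl by blast
  then have tAB: "tube \<Gamma> (A \<union> B)" using tube_partitionD(3)[OF path_list_index(1)[OF pg ws']] by blast
  note cq = contract_graph_quotient[OF pg I AB neq tAB, folded bl]
  note pgI = pair_graph_graph_quotient[OF pg I]
  have E: "(Min A, Min B) \<in> parcs (graph_quotient \<Gamma> (blocks ws))"
    unfolding parcs_graph_quotient[OF pg I AB] using neq ab by (auto simp: A_def B_def)
  let ?m = "map (\<lambda>w. Min (set w))"
  have lT: "leaves T = ?m us @ [Min A, Min B] @ ?m vs" unfolding T(2) ws(2) by (simp add: A_def B_def)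
  obtain T1 where T1: "edge_tree (parcs (graph_quotient \<Gamma> (blocks ws))) T1" "leaves T1 = leaves T"
      "cherry (Min A) (Min B) \<in> subtrees T1"
    using ex_cherry_tree[OF _ lT E] T(1) by (auto simp: admissible_iff[OF pgI])
  then have T1adm: "admissible (graph_quotient \<Gamma> (blocks ws)) T1" using T(1) by (simp add: admissible_iff[OF pgI])
  obtain T' xs ys where T': "leaves T' = xs @ [Min (set (leaves (cherry (Min A) (Min B))))] @ ys"
      "leaves T1 = xs @ leaves (cherry (Min A) (Min B)) @ ys"
      "admissible (contract (graph_quotient \<Gamma> (blocks ws)) (set (leaves (cherry (Min A) (Min B))))) T'"
    using admissible_subtree_cut[OF pgI T1adm T1(3)] by metis
  have c: "set (leaves (cherry (Min A) (Min B))) = {Min A, Min B}" by simp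
  have "xs = ?m us \<and> ys = ?m vs"
    using T'(2) T1(2) lT admissible_leaves(1)[OF T1adm]
    by (intro append_distinct_cancel[of _ "[Min A, Min B]"]) auto
  then have xy: "xs = ?m us" "ys = ?m vs" by simp_all
  have "set (a # b # w) = A \<union> B" by (auto simp: A_def B_def)
  then have "?m ws' = ?m us @ [Min (A \<union> B)] @ ?m vs"
    unfolding ws'_def by (simp only: map_append list.map append.simps)
  then have "leaves T' = ?m ws'" using T'(1) unfolding c cq(1) xy by (simp only:)
  moreover have "admissible (graph_quotient \<Gamma> (blocks ws')) T'" using T'(3) unfolding c cq(2) .
  ultimately show "\<exists>T'. admissible (graph_quotient \<Gamma> (blocks ws')) T' \<and> leaves T' = ?m ws'" by blast
qed

text \<open>Without such an edge all blocks are singletons, and the leaves of \<open>T\<close> are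
  the concatenation itself. A cherry of \<open>T\<close> would be an edge between consecutive
  vertices, so \<open>T\<close> is a leaf and the graph has one vertex.\<close>

lemma path_list_has_edge:
  assumes pg: "pair_graph \<Gamma>" and ws: "path_list \<Gamma> ws" and card: "card (pverts \<Gamma>) \<noteq> 1"
    and T: "admissible (graph_quotient \<Gamma> (blocks ws)) T" "leaves T = map (\<lambda>w. Min (set w)) ws"
  shows "\<not> successively (\<lambda>a b. (a, b) \<notin> parcs \<Gamma>) (concat ws)"
proof
  assume no: "successively (\<lambda>a b. (a, b) \<notin> parcs \<Gamma>) (concat ws)"
  have single: "\<exists>v. w = [v]" if w: "w \<in> set ws" for w
  proof -
    obtain us vs where "ws = us @ w # vs" using w by (meson split_list)
    then have "successively (\<lambda>a b. (a, b) \<notin> parcs \<Gamma>) w" using no by (simp add: successively_append_iff)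
    moreover have "w \<noteq> []" "successively (\<lambda>a b. (a, b) \<in> parcs \<Gamma>) w" using ws w by (auto simp: path_list_def)
    ultimately show ?thesis by (cases w rule: list.exhaust; cases "tl w") auto
  qed
  then have "\<forall>w\<in>set ws. \<exists>v. w = [v]" by blast
  then have "map (\<lambda>w. Min (set w)) ws = concat ws" by (induction ws) auto
  then have lT: "leaves T = concat ws" using T(2) by simp
  note I = path_list_index(1)[OF pg ws]
  note pgI = pair_graph_graph_quotient[OF pg I]
  show False
  proof (cases "inner T")
    case 0
    then have "length (concat ws) = 1" using lT inner_conv_leaves[of T] by simp
    then show False using ws card distinct_card[of "concat ws"] by (simp add: path_list_def)
  next
    case (Suc n)
    then obtain a b where ab: "cherry a b \<in> subtrees T" using ex_cherry[of T] by auto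
    have "edge_tree (parcs (graph_quotient \<Gamma> (blocks ws))) (cherry a b)"
      using edge_tree_subtree[OF ab] T(1) by (simp add: admissible_iff[OF pgI])
    then have "(a, b) \<in> parcs (graph_quotient \<Gamma> (blocks ws))" by simp
    then obtain A B where AB: "A \<in> blocks ws" "B \<in> blocks ws" "a = Min A" "b = Min B" "\<exists>a\<in>A. \<exists>b\<in>B. (a, b) \<in> parcs \<Gamma>"
      by (rule parcs_graph_quotientE[OF pg I])
    obtain x y where "A = {x}" "B = {y}" using AB(1,2) single by (fastforce simp: blocks_def)
    then have "(a, b) \<in> parcs \<Gamma>" using AB(3-5) by simp
    moreover obtain xs ys where "leaves T = xs @ leaves (cherry a b) @ ys"
      using admissible_subtree_cut[OF pgI T(1) ab] by metis
    ultimately show False using no unfolding lT[symmetric] by (simp add: successively_append_iff)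
  qed
qed


section \<open>Homology\<close>

text \<open>The degree is one less than the number of blocks, as a tree with \<open>n\<close>
  internal vertices has \<open>Suc n\<close> leaves. Cutting \<open>y\<close> off at other lengths
  leaves an element of degree \<open>n\<close> unchanged.\<close>

lemma koszul_complex_iff:
  fixes x :: "'v::linorder set set \<times> 'v bintree \<times> ('v set \<Rightarrow> 'v list) \<Rightarrow> 'k::field"
  assumes \<Gamma>: "connected_graph \<Gamma>"
  shows "x \<in> koszul_complex \<Gamma> n \<longleftrightarrow> (\<exists>y. x = koszul_element \<Gamma> y \<and> (\<forall>ws. length ws \<noteq> Suc n \<longrightarrow> y ws = 0))"
proof -
  note pg = connected_graphD(1)[OF \<Gamma>]
  have len: "length (list_of I T p) = Suc (inner T)" for I T and p :: "'v set \<Rightarrow> 'v list"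
    by (simp add: list_of_def inner_conv_leaves)
  show ?thesis
  proof
    assume "x \<in> koszul_complex \<Gamma> n"
    then obtain y where x: "x = koszul_element \<Gamma> y" and deg: "\<And>I T p. x (I, T, p) \<noteq> 0 \<Longrightarrow> inner T = n"
      unfolding koszul_complex_def contraction_product_eq_range[OF \<Gamma>] by blast
    have "koszul_element \<Gamma> y i = koszul_element \<Gamma> (\<lambda>ws. if length ws = Suc n then y ws else 0) i" for i
    proof -
      obtain I T p where i: "i = (I, T, p)" by (cases i)
      show ?thesis
      proof (cases "inner T = n")
        case False
        then have "x i = 0" using deg i by blast
        then show ?thesis using False unfolding x by (simp add: i koszul_element_def len)
      qed (simp add: i koszul_element_def len)
    qed
    then show "\<exists>y. x = koszul_element \<Gamma> y \<and> (\<forall>ws. length ws \<noteq> Suc n \<longrightarrow> y ws = 0)"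
      unfolding x by (intro exI[of _ "\<lambda>ws. if length ws = Suc n then y ws else 0"]) auto
  next
    assume "\<exists>y. x = koszul_element \<Gamma> y \<and> (\<forall>ws. length ws \<noteq> Suc n \<longrightarrow> y ws = 0)"
    then obtain y where x: "x = koszul_element \<Gamma> y" and y: "\<And>ws. length ws \<noteq> Suc n \<Longrightarrow> y ws = 0" by blast
    have "inner T = n" if "x (I, T, p) \<noteq> 0" for I T p
      using that y[of "list_of I T p"] by (auto simp: x koszul_element_def len split: if_splits)
    then show "x \<in> koszul_complex \<Gamma> n"
      unfolding koszul_complex_def contraction_product_eq_range[OF \<Gamma>] using x by blast
  qed
qed

lemma koszul_element_add: "koszul_element \<Gamma> y + koszul_element \<Gamma> y' = koszul_element \<Gamma> (\<lambda>ws. y ws + y' ws)"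
  by (auto simp: koszul_element_def fun_eq_iff distrib_left)

lemma koszul_element_scale: "fscale a (koszul_element \<Gamma> y) = koszul_element \<Gamma> (\<lambda>ws. a * y ws)"
  by (auto simp: koszul_element_def fscale_def fun_eq_iff)

lemma koszul_element_zero: "koszul_element \<Gamma> (\<lambda>ws. 0) = 0"
  by (auto simp: koszul_element_def fun_eq_iff)

lemma subspace_koszul_complex:
  fixes \<Gamma> :: "'v::linorder graph"
  assumes \<Gamma>: "connected_graph \<Gamma>"
  shows "fun_vs.subspace (koszul_complex \<Gamma> n :: (_ \<Rightarrow> 'k::field) set)"
  unfolding fun_vs.subspace_def
proof (intro conjI ballI allI)
  show "0 \<in> (koszul_complex \<Gamma> n :: (_ \<Rightarrow> 'k) set)"
    unfolding koszul_complex_iff[OF \<Gamma>] by (intro exI[of _ "\<lambda>_. 0"]) (simp add: koszul_element_zero)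
  fix x x' :: "_ \<Rightarrow> 'k" and a assume "x \<in> koszul_complex \<Gamma> n" "x' \<in> koszul_complex \<Gamma> n"
  then obtain y y' where "x = koszul_element \<Gamma> y" "x' = koszul_element \<Gamma> y'"
    "\<forall>ws. length ws \<noteq> Suc n \<longrightarrow> y ws = 0" "\<forall>ws. length ws \<noteq> Suc n \<longrightarrow> y' ws = 0"
    unfolding koszul_complex_iff[OF \<Gamma>] by blast
  then show "x + x' \<in> koszul_complex \<Gamma> n"
    unfolding koszul_complex_iff[OF \<Gamma>] by (intro exI[of _ "\<lambda>ws. y ws + y' ws"]) (simp add: koszul_element_add)
next
  fix x :: "_ \<Rightarrow> 'k" and a assume "x \<in> koszul_complex \<Gamma> n"
  then obtain y where "x = koszul_element \<Gamma> y" "\<forall>ws. length ws \<noteq> Suc n \<longrightarrow> y ws = 0"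
    unfolding koszul_complex_iff[OF \<Gamma>] by blast
  then show "fscale a x \<in> koszul_complex \<Gamma> n"
    unfolding koszul_complex_iff[OF \<Gamma>] by (intro exI[of _ "\<lambda>ws. a * y ws"]) (simp add: koszul_element_scale)
qed

lemma linear_fscaleI:
  assumes "\<And>x y. f (x + y) = f x + f y" "\<And>a x. f (fscale a x) = fscale a (f x)"
  shows "Vector_Spaces.linear fscale fscale (f :: ('b \<Rightarrow> 'k::field) \<Rightarrow> 'c \<Rightarrow> 'k)"
  using assms by unfold_locales

lemma linear_koszul_differential:
  fixes \<Gamma> :: "'v::linorder graph"
  assumes "pair_graph \<Gamma>"
  shows "Vector_Spaces.linear fscale fscale (koszul_differential \<Gamma> :: (_ \<Rightarrow> 'k::field) \<Rightarrow> _)"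
proof (rule linear_fscaleI)
  fix x y :: "'v set set \<times> 'v bintree \<times> ('v set \<Rightarrow> 'v list) \<Rightarrow> 'k" and a
  have "differential_term \<Gamma> (x + y) J T q I p A B =
    differential_term \<Gamma> x J T q I p A B + differential_term \<Gamma> y J T q I p A B" for J T q I p A B
    by (auto simp: differential_term_def infinitesimal_decomposition_def distrib_left split: option.split)
  then show "koszul_differential \<Gamma> (x + y) = koszul_differential \<Gamma> x + koszul_differential \<Gamma> y"
    by (auto simp: fun_eq_iff koszul_differential_eq_sum(2)[OF assms] case_prod_unfold sum.distrib)
  have "differential_term \<Gamma> (fscale a x) J T q I p A B = a * differential_term \<Gamma> x J T q I p A B" for J T q I p A B
    by (auto simp: differential_term_def infinitesimal_decomposition_def fscale_def ac_simps split: option.split)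
  then show "koszul_differential \<Gamma> (fscale a x) = fscale a (koszul_differential \<Gamma> x)"
    by (auto simp: fun_eq_iff koszul_differential_eq_sum(2)[OF assms] case_prod_unfold fscale_def[of a "koszul_differential \<Gamma> x"] sum_distrib_left)
qed

lemma chain_complex_koszul:
  fixes \<Gamma> :: "'v::linorder graph"
  assumes \<Gamma>: "connected_graph \<Gamma>"
  shows "chain_complex (koszul_complex \<Gamma> :: nat \<Rightarrow> (_ \<Rightarrow> 'k::field) set) (koszul_differential \<Gamma>)"
  unfolding chain_complex_def
proof (intro conjI allI ballI)
  note pg = connected_graphD(1)[OF \<Gamma>]
  show "Vector_Spaces.linear fscale fscale (koszul_differential \<Gamma> :: (_ \<Rightarrow> 'k) \<Rightarrow> _)"
    by (rule linear_koszul_differential[OF pg])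
  show "fun_vs.subspace (koszul_complex \<Gamma> n :: (_ \<Rightarrow> 'k) set)" for n by (rule subspace_koszul_complex[OF \<Gamma>])
  fix x :: "'v set set \<times> 'v bintree \<times> ('v set \<Rightarrow> 'v list) \<Rightarrow> 'k"
  assume "x \<in> koszul_complex \<Gamma> 0"
  then obtain y where x: "x = koszul_element \<Gamma> y" "\<And>ws. length ws \<noteq> Suc 0 \<Longrightarrow> y ws = 0"
    unfolding koszul_complex_iff[OF \<Gamma>] by blast
  \<comment> \<open>The empty list is treated apart: a splitting of it would have length
    \<open>Suc 0\<close>, where \<open>y\<close> may be nonzero, but there is none.\<close>
  have "splitting y ws = 0" for ws by (cases ws) (auto intro!: splitting_length x(2))
  then have "splitting y = (\<lambda>_. 0)" by (rule ext)
  then show "koszul_differential \<Gamma> x = 0"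
    by (simp add: x(1) koszul_differential_element[OF pg] koszul_element_zero)
next
  note pg = connected_graphD(1)[OF \<Gamma>]
  fix n and x :: "'v set set \<times> 'v bintree \<times> ('v set \<Rightarrow> 'v list) \<Rightarrow> 'k"
  assume "x \<in> koszul_complex \<Gamma> (Suc n)"
  then obtain y where x: "x = koszul_element \<Gamma> y" "\<And>ws. length ws \<noteq> Suc (Suc n) \<Longrightarrow> y ws = 0"
    unfolding koszul_complex_iff[OF \<Gamma>] by blast
  have "splitting y ws = 0" if "length ws \<noteq> Suc n" for ws using that by (intro splitting_length x(2)) auto
  then show "koszul_differential \<Gamma> x \<in> koszul_complex \<Gamma> n"
    unfolding koszul_complex_iff[OF \<Gamma>] x(1) koszul_differential_element[OF pg] by blast
  have "splitting (splitting y) = (\<lambda>_. 0)" by (rule ext) (rule splitting_splitting)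
  then show "koszul_differential \<Gamma> (koszul_differential \<Gamma> x) = 0"
    by (simp add: x(1) koszul_differential_element[OF pg] koszul_element_zero)
qed

text \<open>The preimage of a cycle has coordinates \<open>joining\<close> of the given ones. The
  cycle condition says that \<open>splitting y\<close> vanishes at lists with an admissible tree. By
  \<open>path_list_join\<close>, \<open>joining\<close> reads it at no others when applied at such a
  list, so the homotopy identity reduces to the claim.\<close>

lemma koszul_complex_exact:
  fixes \<Gamma> :: "'v::linorder graph" and x :: "_ \<Rightarrow> 'k::field"
  assumes \<Gamma>: "connected_graph \<Gamma>" and card: "card (pverts \<Gamma>) \<noteq> 1"
    and x: "x \<in> koszul_complex \<Gamma> n" "koszul_differential \<Gamma> x = 0"
  shows "x \<in> koszul_differential \<Gamma> ` koszul_complex \<Gamma> (Suc n)"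
proof -
  note pg = connected_graphD(1)[OF \<Gamma>]
  let ?E = "parcs \<Gamma>"
  obtain y where y: "x = koszul_element \<Gamma> y" "\<And>ws. length ws \<noteq> Suc n \<Longrightarrow> y ws = 0"
    using x(1) unfolding koszul_complex_iff[OF \<Gamma>] by blast
  \<comment> \<open>Joining lowers the number of blocks by one, so the preimage lives one degree
    higher.\<close>
  have "joining ?E y ws = 0" if "length ws \<noteq> Suc (Suc n)" for ws
    using that by (intro joining_eq_0 y(2)) auto
  then have "koszul_element \<Gamma> (joining ?E y) \<in> koszul_complex \<Gamma> (Suc n)"
    unfolding koszul_complex_iff[OF \<Gamma>] by blast
  moreover have "koszul_differential \<Gamma> (koszul_element \<Gamma> (joining ?E y)) = x"
    unfolding koszul_differential_element[OF pg] y(1)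
  proof (rule koszul_element_cong[OF pg])
    fix ws T assume ws: "path_list \<Gamma> ws" and T: "admissible (graph_quotient \<Gamma> (blocks ws)) T"
      "leaves T = map (\<lambda>w. Min (set w)) ws"
    have "koszul_element \<Gamma> (splitting y) = koszul_element \<Gamma> (\<lambda>_. 0)"
      using x(2) by (simp add: y(1) koszul_differential_element[OF pg] koszul_element_zero)
    note zero = koszul_element_eqD[OF pg this]
    have "joining ?E (splitting y) ws = 0"
    proof (rule joining_eq_0)
      fix us a b w vs assume *: "ws = us @ [a] # (b # w) # vs" "(a, b) \<in> ?E"
      from path_list_join[OF pg ws * T] show "splitting y (us @ (a # b # w) # vs) = 0"
        using zero by blast
    qed
    moreover have "splitting (joining ?E y) ws + joining ?E (splitting y) ws = y ws"
      by (rule splitting_joining[OF _ _ path_list_has_edge[OF pg ws card T]])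
        (use ws in \<open>auto simp: path_list_def\<close>)
    ultimately show "splitting (joining ?E y) ws = y ws" by simp
  qed
  ultimately show ?thesis by blast
qed

section \<open>The augmentation in coordinates\<close>

lemma linear_koszul_augmentation:
  "Vector_Spaces.linear fscale fscale (koszul_augmentation \<Gamma> :: (_ \<Rightarrow> 'k::field) \<Rightarrow> _)"
  by (rule linear_fscaleI)
    (auto simp: koszul_augmentation_def fun_eq_iff fscale_def sum.distrib distrib_right sum_distrib_left mult.assoc)

text \<open>The counit admits only trees that are leaves, hence only the partition with one block.
  Its path runs through all vertices, and the augmentation of \<open>Ham\<close> kills it unless
  there is just one.\<close>

lemma koszul_augmentation_eq_0:
  fixes \<Gamma> :: "'v::linorder graph" and y :: "'v list list \<Rightarrow> 'k::field"
  assumes pg: "pair_graph \<Gamma>" and card: "card (pverts \<Gamma>) \<noteq> 1"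
  shows "koszul_augmentation \<Gamma> (koszul_element \<Gamma> y) = 0"
proof -
  have *: "koszul_element \<Gamma> y (I, T, p) * (counit T * (\<Prod>G\<in>I. ham_augmentation (p G))) = 0" for I T p
  proof (cases "koszul_index \<Gamma> I T p \<and> inner T = 0")
    case True
    then have ind: "koszul_index \<Gamma> I T p" by simp
    note ws = koszul_index_list_of[OF pg ind] block_path_list_of[OF pg ind]
    have "length (list_of I T p) = Suc 0" using ws(5) True by simp
    then obtain w where w: "list_of I T p = [w]" by (auto simp: length_Suc_conv)
    have I: "I = {set w}" using ws(1) by (simp add: w blocks_def)
    have "p (set w) = w" using block_path_eq[OF ws(3), of w] ws(6) by (simp add: w)
    moreover have "length w \<noteq> 1"
      using ws(3) card distinct_card[of w] by (auto simp: w path_list_def)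
    ultimately show ?thesis by (simp add: I ham_augmentation_def)
  next
    case False
    then show ?thesis by (cases T) (auto simp: koszul_element_def counit_def)
  qed
  show ?thesis by (simp only: koszul_augmentation_def * sum.neutral_const zero_fun_def)
qed

lemma koszul_augmentation_singleton:
  fixes \<Gamma> :: "'v::linorder graph" and y :: "'v list list \<Rightarrow> 'k::field"
  assumes pg: "pair_graph \<Gamma>" and V: "pverts \<Gamma> = {v}"
  shows "koszul_augmentation \<Gamma> (koszul_element \<Gamma> y) = (\<lambda>_. y [[v]])"
proof -
  have tp: "tube_partition \<Gamma> I \<longleftrightarrow> I = {{v}}" for I
  proof
    assume I: "tube_partition \<Gamma> I"
    have "G = {v}" if "G \<in> I" for G using tube_partitionD(4,5)[OF I that] V by auto
    then show "I = {{v}}" using tube_partitionD(1)[OF I] V by blast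
  qed (auto simp: tube_partition_def partition_on_def V tube_singleton[OF pg])
  have I: "{I. tube_partition \<Gamma> I} = {{{v}}}" using tp by auto
  have "ham_paths (induced \<Gamma> {v}) = {[v]}"
  proof (rule set_eqI)
    fix w
    have "{v} \<subseteq> pverts \<Gamma>" by (simp add: V)
    then show "w \<in> ham_paths (induced \<Gamma> {v}) \<longleftrightarrow> w \<in> {[v]}"
      using distinct_set_singleton[of w v] by (auto simp: ham_paths_induced)
  qed
  then have "path_families \<Gamma> {{v}} = (\<Pi>\<^sub>E G\<in>{{v}}. {restrict (\<lambda>_. [v]) {{v}} G})"
    unfolding path_families_def by (intro PiE_cong) auto
  then have P: "path_families \<Gamma> {{v}} = {restrict (\<lambda>_. [v]) {{v}}}"
    using PiE_singleton[of "restrict (\<lambda>_. [v]) {{v}}" "{{v}}"] by simp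
  have pgq: "pair_graph (graph_quotient \<Gamma> {{v}})" by (rule pair_graph_graph_quotient[OF pg]) (simp add: tp)
  have T: "{T. admissible (graph_quotient \<Gamma> {{v}}) T} = {Leaf v}"
  proof -
    have "T = Leaf v" if "distinct (leaves T)" "set (leaves T) = {v}" for T
    proof -
      have "leaves T = [v]" using that by (rule distinct_set_singleton)
      then show ?thesis by (simp add: leaves_1_iff)
    qed
    then show ?thesis by (auto simp: admissible_iff[OF pgq] pverts_graph_quotient)
  qed
  have adm: "admissible (graph_quotient \<Gamma> {{v}}) (Leaf v)" using T by blast
  let ?p = "restrict (\<lambda>_. [v]) {{v}} :: 'v set \<Rightarrow> 'v list"
  have bm: "block_with_Min {{v}} v = {v}"
    using block_with_Min[OF pg, of "{{v}}" "{v}"] by (simp add: tp)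
  have ind: "koszul_index \<Gamma> {{v}} (Leaf v) ?p"
    unfolding koszul_index_def P tp using adm by blast
  have "list_of {{v}} (Leaf v) ?p = [[v]]" by (simp add: list_of_def bm)
  then have val: "koszul_element \<Gamma> y ({{v}}, Leaf v, ?p) = y [[v]]"
    unfolding koszul_element_def prod.case if_P[OF ind] by (simp only: tree_sign.simps mult_1)
  have "(\<Prod>G\<in>{{v}}. ham_augmentation (?p G)) = (1 :: 'k)"
    by (simp add: ham_augmentation_def)
  moreover have "koszul_augmentation \<Gamma> (koszul_element \<Gamma> y) u =
      koszul_element \<Gamma> y ({{v}}, Leaf v, ?p) * (counit (Leaf v) * (\<Prod>G\<in>{{v}}. ham_augmentation (?p G)))" for u
  proof -
    have single: "sum g {a} = g a" for g :: "'x \<Rightarrow> 'k" and a by simp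
    show ?thesis unfolding koszul_augmentation_def I single P T ..
  qed
  ultimately show ?thesis by (intro ext) (simp only: val counit_def bintree.case mult_1_right)
qed

lemma path_list_singleton:
  assumes "path_list \<Gamma> ws" "pverts \<Gamma> = {v}"
  shows "ws = [[v]]"
proof -
  have "concat ws = [v]"
    by (rule distinct_set_singleton) (use assms in \<open>simp_all add: path_list_def\<close>)
  moreover have "[] \<notin> set ws" using assms(1) by (auto simp: path_list_def)
  ultimately show ?thesis by (cases ws; cases "tl ws") (auto simp: append_eq_Cons_conv)
qed

section \<open>Homology in the exact case and for vanishing differentials\<close>

lemma homology_exact:
  assumes "chain_complex C d" "\<And>x. x \<in> C n \<Longrightarrow> d x = 0 \<Longrightarrow> x \<in> d ` C (Suc n)"
  shows "homology C d n = {cycles C d n}" "homologous C d n = cycles C d n \<times> cycles C d n" "0 \<in> cycles C d n"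
proof -
  have lin: "Vector_Spaces.linear fscale fscale d" and sub: "fun_vs.subspace (C n)"
    using assms(1) by (auto simp: chain_complex_def)
  interpret d: Vector_Spaces.linear fscale fscale d by (rule lin)
  have "x - y \<in> d ` C (Suc n)" if "x \<in> cycles C d n" "y \<in> cycles C d n" for x y
    using that by (intro assms(2)) (auto simp: cycles_def d.diff fun_vs.subspace_diff[OF sub])
  then show h: "homologous C d n = cycles C d n \<times> cycles C d n" by (auto simp: homologous_def)
  show z: "0 \<in> cycles C d n" using fun_vs.subspace_0[OF sub] by (simp add: cycles_def d.zero)
  then show "homology C d n = {cycles C d n}" unfolding homology_def h quotient_def by auto
qed

text \<open>Homology is a set of classes, so it becomes the set of singletons of chains and not the
  space of chains itself.\<close>

lemma homology_zero_differential:
  assumes "\<And>x. x \<in> C n \<Longrightarrow> d x = 0" "d ` C (Suc n) = {0}"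
  shows "homology C d n = (\<lambda>x. {x}) ` C n" "x \<in> C n \<Longrightarrow> homologous C d n `` {x} = {x}"
proof -
  have "homologous C d n = {(x, x) | x. x \<in> C n}"
    using assms by (auto simp: homologous_def cycles_def)
  moreover have "cycles C d n = C n" using assms(1) by (auto simp: cycles_def)
  ultimately show "homology C d n = (\<lambda>x. {x}) ` C n" "x \<in> C n \<Longrightarrow> homologous C d n `` {x} = {x}"
    by (auto simp: homology_def quotient_def)
qed

lemma subspace_unit_complex: "fun_vs.subspace (unit_complex \<Gamma> n)"
  by (auto simp: fun_vs.subspace_def unit_complex_def unit_collection_def free_space_def fscale_def)

lemma chain_complex_unit: "chain_complex (unit_complex \<Gamma>) (\<lambda>_. 0)"
  unfolding chain_complex_def
proof (intro conjI allI ballI)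
  show "Vector_Spaces.linear fscale fscale (\<lambda>_. 0)" by (rule linear_fscaleI) (auto simp: fscale_def fun_eq_iff)
qed (use subspace_unit_complex fun_vs.subspace_0 in \<open>auto intro: fun_vs.subspace_0[OF subspace_unit_complex]\<close>)

theorem theorem4p4p1:
  fixes \<Gamma> :: "'v::linorder graph"
  assumes "connected_graph \<Gamma>"
  shows "quasi_isomorphism
           (koszul_complex \<Gamma> ::
              nat \<Rightarrow> ('v set set \<times> 'v bintree \<times> ('v set \<Rightarrow> 'v list) \<Rightarrow> 'k::field) set)
           (koszul_differential \<Gamma>)
           (unit_complex \<Gamma>) (\<lambda>_. 0)
           (koszul_augmentation \<Gamma>)"
proof -
  note \<Gamma> = assms and pg = connected_graphD(1)[OF assms]
  note C = chain_complex_koszul[OF \<Gamma>, where 'k = 'k] and D = chain_complex_unit[of \<Gamma>, where 'a = 'k]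
  let ?C = "koszul_complex \<Gamma> :: nat \<Rightarrow> ('v set set \<times> 'v bintree \<times> ('v set \<Rightarrow> 'v list) \<Rightarrow> 'k) set"
    and ?d = "koszul_differential \<Gamma>" and ?f = "koszul_augmentation \<Gamma>"
    and ?D = "unit_complex \<Gamma> :: nat \<Rightarrow> (unit \<Rightarrow> 'k) set" and ?e = "\<lambda>_ :: unit \<Rightarrow> 'k. 0 :: unit \<Rightarrow> 'k"
  have "(\<forall>n. \<forall>x\<in>?C n. ?f x \<in> ?D n \<and> ?f (?d x) = 0) \<and>
    (\<forall>n. bij_betw (\<lambda>X. homologous ?D ?e n `` (?f ` X)) (homology ?C ?d n) (homology ?D ?e n))"
  proof (cases "card (pverts \<Gamma>) = 1")
    case False
    \<comment> \<open>With several vertices both complexes are exact, so each homology consists of a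
      single class, and it remains to see that one class is sent to the other.\<close>
    have f: "?f (koszul_element \<Gamma> y) = 0" for y :: "'v list list \<Rightarrow> 'k"
      by (rule koszul_augmentation_eq_0[OF pg False])
    have D0: "?D n = {0}" for n
      using False by (auto simp: unit_complex_def unit_collection_def free_space_def fun_eq_iff)
    have fC: "?f x = 0 \<and> ?f (?d x) = 0" if "x \<in> ?C n" for x n
      using that f unfolding koszul_complex_iff[OF \<Gamma>] by (auto simp: koszul_differential_element[OF pg])
    have "bij_betw (\<lambda>X. homologous ?D ?e n `` (?f ` X)) (homology ?C ?d n) (homology ?D ?e n)" for n
    proof -
      have hC: "homology ?C ?d n = {cycles ?C ?d n}" "0 \<in> cycles ?C ?d n"
        by (rule homology_exact[OF C]; rule koszul_complex_exact[OF \<Gamma> False]; assumption)+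
      have hD: "homology ?D ?e n = {cycles ?D ?e n}" "homologous ?D ?e n = cycles ?D ?e n \<times> cycles ?D ?e n"
        "0 \<in> cycles ?D ?e n"
        by (rule homology_exact[OF D]; simp add: D0)+
      have "?f ` cycles ?C ?d n = {0}" using fC hC(2) by (force simp: cycles_def)
      then have "homologous ?D ?e n `` (?f ` cycles ?C ?d n) = cycles ?D ?e n" using hD by auto
      then show ?thesis unfolding hC(1) hD(1) by (simp add: bij_betw_def)
    qed
    then show ?thesis using fC D0 by auto
  next
    case True
    \<comment> \<open>On one vertex both complexes are concentrated in degree 0. The augmentation
      reads off the only coordinate \<open>y [[v]]\<close>, so it is already bijective on
      chains.\<close>
    then obtain v where v: "pverts \<Gamma> = {v}" by (auto simp: card_1_singleton_iff)
    note f = koszul_augmentation_singleton[OF pg v, where 'k = 'k]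
    have eq: "koszul_element \<Gamma> y = (koszul_element \<Gamma> y' :: _ \<Rightarrow> 'k)" if "y [[v]] = y' [[v]]" for y y'
      using that path_list_singleton[OF _ v] by (intro koszul_element_cong[OF pg]) auto
    have C_Suc: "?C (Suc n) = {0}" for n
    proof -
      have "x = 0" if "x \<in> ?C (Suc n)" for x
        using that eq[of _ "\<lambda>_. 0"] unfolding koszul_complex_iff[OF \<Gamma>] by (auto simp: koszul_element_zero)
      then show ?thesis using fun_vs.subspace_0[OF subspace_koszul_complex[OF \<Gamma>]] by blast
    qed
    have D_Suc: "?D (Suc n) = {0}" for n by (simp add: unit_complex_def)
    have D_0: "?D 0 = UNIV" using True by (auto simp: unit_complex_def unit_collection_def free_space_def)
    have "splitting (\<lambda>_. 0 :: 'k) = (\<lambda>_ :: 'v list list. 0)" by (rule ext) (rule splitting_zero)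
    then have d0: "?d 0 = (0 :: _ \<Rightarrow> 'k)"
      using koszul_differential_element[OF pg, of "\<lambda>_. 0 :: 'k"] by (simp add: koszul_element_zero)
    have d: "?d x = 0" if "x \<in> ?C n" for x n
      using that C d0 C_Suc by (cases n) (auto simp: chain_complex_def)
    have f0: "?f 0 = (0 :: unit \<Rightarrow> 'k)" using f[of "\<lambda>_. 0"] by (simp add: koszul_element_zero fun_eq_iff)
    have bij: "bij_betw ?f (?C n) (?D n)" for n
    proof (cases n)
      case 0
      have "inj_on ?f (?C 0)"
      proof (rule inj_onI)
        fix x x' assume *: "x \<in> ?C 0" "x' \<in> ?C 0" "?f x = ?f x'"
        obtain y where y: "x = koszul_element \<Gamma> y" using *(1) unfolding koszul_complex_iff[OF \<Gamma>] by blast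
        obtain y' where y': "x' = koszul_element \<Gamma> y'" using *(2) unfolding koszul_complex_iff[OF \<Gamma>] by blast
        have "y [[v]] = y' [[v]]" using fun_cong[OF *(3)] unfolding y y' f by blast
        then show "x = x'" unfolding y y' by (rule eq)
      qed
      moreover have "z \<in> ?f ` ?C 0" for z :: "unit \<Rightarrow> 'k"
      proof -
        let ?y = "\<lambda>ws :: 'v list list. if length ws = Suc 0 then z () else 0"
        have "koszul_element \<Gamma> ?y \<in> ?C 0" unfolding koszul_complex_iff[OF \<Gamma>] by (intro exI[of _ ?y]) simp
        then have "?f (koszul_element \<Gamma> ?y) \<in> ?f ` ?C 0" by (rule imageI)
        moreover have "?f (koszul_element \<Gamma> ?y) = z" by (simp add: f fun_eq_iff)
        ultimately show ?thesis by (simp only:)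
      qed
      ultimately show ?thesis unfolding 0 D_0 by (auto simp: bij_betw_def)
    qed (simp add: C_Suc D_Suc bij_betw_def f0)
    have "bij_betw (\<lambda>X. homologous ?D ?e n `` (?f ` X)) (homology ?C ?d n) (homology ?D ?e n)" for n
    proof -
      have hC: "homology ?C ?d n = (\<lambda>x. {x}) ` ?C n"
        by (rule homology_zero_differential(1)) (use d d0 in \<open>auto simp: C_Suc\<close>)
      have hD: "homology ?D ?e n = (\<lambda>x. {x}) ` ?D n" "\<And>z. z \<in> ?D n \<Longrightarrow> homologous ?D ?e n `` {z} = {z}"
        by (rule homology_zero_differential; simp add: D_Suc)+
      have *: "homologous ?D ?e n `` (?f ` {x}) = {?f x}" if "x \<in> ?C n" for x
        using hD(2)[of "?f x"] bij_betwE[OF bij] that by auto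
      have "inj_on ?f (?C n)" "?f ` ?C n = ?D n" using bij by (auto simp: bij_betw_def)
      then have "bij_betw (\<lambda>x. {?f x}) (?C n) ((\<lambda>x. {x}) ` ?D n)"
        by (auto simp: bij_betw_def inj_on_def)
      \<comment> \<open>Under the identification of a chain with its one-element class, the induced
        map on homology is the augmentation itself.\<close>
      then have "bij_betw ((\<lambda>X. homologous ?D ?e n `` (?f ` X)) \<circ> (\<lambda>x. {x})) (?C n) ((\<lambda>x. {x}) ` ?D n)"
        unfolding comp_def by (rule bij_betw_cong[THEN iffD1, rotated]) (simp only: *)
      moreover have "bij_betw (\<lambda>x. {x}) (?C n) ((\<lambda>x. {x}) ` ?C n)" by (simp add: bij_betw_def)
      ultimately show ?thesis
        unfolding hC hD(1) using bij_betw_comp_iff by blast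
    qed
    moreover have "?f x \<in> ?D n \<and> ?f (?d x) = 0" if "x \<in> ?C n" for x n
      using bij_betwE[OF bij] that d f0 by auto
    ultimately show ?thesis by blast
  qed
  then show ?thesis
    unfolding quasi_isomorphism_def using C D linear_koszul_augmentation by blast
qed

end
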